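(* Let $\Omega=\{\mathbf{x}\in\mathbb{R}^2:|\mathbf{x}|<1\}$ be the unit disk and let $f\in H^{-1}(\Omega)$. Assume that the azimuthal average $\overline f$ of $f$ satisfies $\overline f(r)\ge f_{\min}>0$ for all $r\in[0,1)$, where $f_{\min}$ is a constant. Then there exists a constant $C=C(f_{\min})$ with $$C\ \ge\ \frac{\pi^2 f_{\min}^2}{64+32\pi e}$$ such that $$\mathcal{J}(\mathrm{Pe})\ \ge\ C\,\frac{\ln^2\mathrm{Pe}}{\mathrm{Pe}^2}\qquad\forall\,\mathrm{Pe}>0.$$ Consequently, there exists a constant $C'=C'(f)$ such that $\mathcal{E}(\mathrm{Pe})\le C'\,\mathrm{Pe}^2/\ln^2\mathrm{Pe}$ for all $\mathrm{Pe}>0$.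
   Context: Optimal cooling problem. Admissible velocities are $\mathbf{u}\in L^2(\Omega;\mathbb{R}^2)$ that are weakly divergence free and satisfy $\mathbf{u}\cdot\hat{\mathbf{n}}=0$ on $\partial\Omega$ in the weak sense (i.e. $\int_\Omega \mathbf{u}\cdot\nabla\varphi\,d\mathbf{x}=0$ for all $\varphi\in H^1(\Omega)$), with $\|\mathbf{u}\|_{L^2}\le \mathrm{Pe}$. For each such $\mathbf{u}$, $T\in H^1_0(\Omega)$ is the unique weak solution of $-\Delta T+\mathbf{u}\cdot\nabla T=f$ in $\Omega$, $T=0$ on $\partial\Omega$, i.e. $\int_\Omega (\nabla\xi\cdot\nabla T+\xi\,\mathbf{u}\cdot\nabla T-f\xi)\,d\mathbf{x}=0$ for all $\xi\in H^1_0(\Omega)$. Here $\int_\Omega f\xi\,d\mathbf{x}$ denotes the $H^{-1}$–$H^1_0$ pairing, and $\int_\Omega\xi\,\mathbf{u}\cdot\nabla T\,d\mathbf{x}$, which is bounded by a constant (depending on $\Omega$) times $\|\nabla\xi\|_{L^2}\|\mathbf{u}\|_{L^2}\|\nabla T\|_{L^2}$, is understood as the continuous extension in $\xi$ from $H^1_0(\Omega)\cap L^\infty(\Omega)$. Then $\mathcal{J}(\mathrm{Pe})$ is the minimum of $\int_\Omega|\nabla T|^2\,d\mathbf{x}$ over all such $\mathbf{u}$. Efficiency. $\mathcal{E}(\mathrm{Pe})=\|f\|_{H^{-1}}^2/\mathcal{J}(\mathrm{Pe})$, where $\|f\|_{H^{-1}}=\sup_{0\ne\varphi\in H^1_0(\Omega)}\left|\int_\Omega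 f\varphi\,d\mathbf{x}\right|/\|\nabla\varphi\|_{L^2}$. Azimuthal average. In polar coordinates $(r,\phi)$, $\overline f(r)=\frac1{2\pi}\int_0^{2\pi}f(r,\phi)\,d\phi$. For general $f\in H^{-1}(\Omega)$, the condition $\overline f\ge f_{\min}$ is understood weakly: $\int_\Omega f\varphi\,d\mathbf{x}\ge f_{\min}\int_\Omega\varphi\,d\mathbf{x}$ for all nonnegative radially symmetric $\varphi\in H^1_0(\Omega)$. $e$ is Euler's number. At $\mathrm{Pe}=1$ the expression $\mathrm{Pe}^2/\ln^2\mathrm{Pe}$ is read as $+\infty$.
   Formalization: Both bounds are stated for all Pe ≥ 1 instead of all Pe > 0: since u = 0 is admissible, J(Pe) stays bounded and E(Pe) ≥ 1 as Pe → 0, while ln²Pe/Pe² tends to infinity, so the claims fail for small Pe. *)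

theory Defs
  imports "HOL-Analysis.Analysis"
begin

text \<open>
  Elements of Lebesgue and Sobolev spaces on \<open>S\<close> are represented by functions on the whole
  space; only their values almost everywhere on \<open>S\<close> matter.
\<close>

definition L2 :: "'a::euclidean_space set \<Rightarrow> ('a \<Rightarrow> 'b::euclidean_space) set" where
  "L2 S = {f. f \<in> borel_measurable (lebesgue_on S) \<and>
              integrable (lebesgue_on S) (\<lambda>x. (norm (f x))\<^sup>2)}"

definition L2_norm :: "'a::euclidean_space set \<Rightarrow> ('a \<Rightarrow> 'b::euclidean_space) \<Rightarrow> real" where
  "L2_norm S f = sqrt (LINT x|lebesgue_on S. (norm (f x))\<^sup>2)"

definition Linf :: "'a::euclidean_space set \<Rightarrow> ('a \<Rightarrow> real) set" where
  "Linf S = {f. f \<in> borel_measurable (lebesgue_on S) \<and>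
                (\<exists>M. AE x in lebesgue_on S. \<bar>f x\<bar> \<le> M)}"

primrec Ck :: "nat \<Rightarrow> ('a::euclidean_space \<Rightarrow> real) \<Rightarrow> bool" where
  "Ck 0 f \<longleftrightarrow> continuous_on UNIV f"
| "Ck (Suc k) f \<longleftrightarrow> (\<forall>x. f differentiable (at x)) \<and>
     (\<forall>b\<in>Basis. Ck k (\<lambda>x. frechet_derivative f (at x) b))"

definition test_functions :: "'a::euclidean_space set \<Rightarrow> ('a \<Rightarrow> real) set" where
  "test_functions S = {\<phi>. (\<forall>k. Ck k \<phi>) \<and> compact (closure {x. \<phi> x \<noteq> 0}) \<and>
                          closure {x. \<phi> x \<noteq> 0} \<subseteq> S}"

definition classical_grad :: "('a::euclidean_space \<Rightarrow> real) \<Rightarrow> 'a \<Rightarrow> 'a" where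
  "classical_grad \<phi> x = (\<Sum>b\<in>Basis. frechet_derivative \<phi> (at x) b *\<^sub>R b)"

definition has_weak_grad ::
    "'a::euclidean_space set \<Rightarrow> ('a \<Rightarrow> real) \<Rightarrow> ('a \<Rightarrow> 'a) \<Rightarrow> bool" where
  "has_weak_grad S v g \<longleftrightarrow>
     (\<forall>\<phi>\<in>test_functions S.
        (LINT x|lebesgue_on S. v x *\<^sub>R classical_grad \<phi> x) =
        - (LINT x|lebesgue_on S. \<phi> x *\<^sub>R g x))"

definition H1 :: "'a::euclidean_space set \<Rightarrow> ('a \<Rightarrow> real) set" where
  "H1 S = {v \<in> L2 S. \<exists>g\<in>L2 S. has_weak_grad S v g}"

text \<open>For open \<open>S\<close> the weak gradient is unique almost everywhere, so the choice is immaterial.\<close>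

definition grad :: "'a::euclidean_space set \<Rightarrow> ('a \<Rightarrow> real) \<Rightarrow> 'a \<Rightarrow> 'a" where
  "grad S v = (SOME g. g \<in> L2 S \<and> has_weak_grad S v g)"

definition H1_norm :: "'a::euclidean_space set \<Rightarrow> ('a \<Rightarrow> real) \<Rightarrow> real" where
  "H1_norm S v = sqrt ((L2_norm S v)\<^sup>2 + (L2_norm S (grad S v))\<^sup>2)"

definition H10 :: "'a::euclidean_space set \<Rightarrow> ('a \<Rightarrow> real) set" where
  "H10 S = {v \<in> H1 S. \<exists>\<phi>. (\<forall>n::nat. \<phi> n \<in> test_functions S) \<and>
                          (\<lambda>n. H1_norm S (\<lambda>x. \<phi> n x - v x)) \<longlonglongrightarrow> 0}"

text \<open>
  Continuity is measured by \<open>\<parallel>\<nabla>\<phi>\<parallel>\<close> in \<open>L\<^sup>2\<close>, which is equivalent to the \<open>H\<^sup>1\<close> norm on \<open>H10 S\<close> when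
  \<open>S\<close> is bounded. The value \<open>F \<phi>\<close> is the duality pairing; it is unconstrained outside \<open>H10 S\<close>.
\<close>

definition Hneg1 :: "'a::euclidean_space set \<Rightarrow> (('a \<Rightarrow> real) \<Rightarrow> real) set" where
  "Hneg1 S = {F. (\<forall>\<phi>\<in>H10 S. \<forall>\<psi>\<in>H10 S. F (\<lambda>x. \<phi> x + \<psi> x) = F \<phi> + F \<psi>) \<and>
                 (\<forall>c. \<forall>\<phi>\<in>H10 S. F (\<lambda>x. c * \<phi> x) = c * F \<phi>) \<and>
                 (\<exists>M. \<forall>\<phi>\<in>H10 S. \<bar>F \<phi>\<bar> \<le> M * L2_norm S (grad S \<phi>))}"

definition Hneg1_norm :: "'a::euclidean_space set \<Rightarrow> (('a \<Rightarrow> real) \<Rightarrow> real) \<Rightarrow> real" where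
  "Hneg1_norm S F =
     (SUP \<phi>\<in>{\<phi> \<in> H10 S. \<not> (AE x in lebesgue_on S. \<phi> x = 0)}. \<bar>F \<phi>\<bar> / L2_norm S (grad S \<phi>))"

definition admissible_velocity ::
    "'a::euclidean_space set \<Rightarrow> real \<Rightarrow> ('a \<Rightarrow> 'a) \<Rightarrow> bool" where
  "admissible_velocity S Pe u \<longleftrightarrow>
     u \<in> L2 S \<and> (\<forall>\<phi>\<in>H1 S. (LINT x|lebesgue_on S. u x \<bullet> grad S \<phi> x) = 0) \<and> L2_norm S u \<le> Pe"

text \<open>
  \<open>B \<xi>\<close> is the advection term \<open>\<integral> \<xi> u \<bullet> \<nabla>T\<close>, extended continuously in \<open>\<xi>\<close> from
  \<open>H10 S \<inter> Linf S\<close> to \<open>H10 S\<close>. By density there is at most one such \<open>B\<close> on \<open>H10 S\<close>.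
\<close>

definition advection_extension ::
    "'a::euclidean_space set \<Rightarrow> ('a \<Rightarrow> 'a) \<Rightarrow> ('a \<Rightarrow> real) \<Rightarrow> (('a \<Rightarrow> real) \<Rightarrow> real) \<Rightarrow> bool" where
  "advection_extension S u T B \<longleftrightarrow>
     B \<in> Hneg1 S \<and>
     (\<forall>\<xi>\<in>H10 S \<inter> Linf S. B \<xi> = (LINT x|lebesgue_on S. \<xi> x * (u x \<bullet> grad S T x)))"

definition weak_temperature ::
    "'a::euclidean_space set \<Rightarrow> (('a \<Rightarrow> real) \<Rightarrow> real) \<Rightarrow> ('a \<Rightarrow> 'a) \<Rightarrow> ('a \<Rightarrow> real) \<Rightarrow> bool" where
  "weak_temperature S f u T \<longleftrightarrow>
     T \<in> H10 S \<and>
     (\<exists>B. advection_extension S u T B \<and>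
          (\<forall>\<xi>\<in>H10 S. (LINT x|lebesgue_on S. grad S \<xi> x \<bullet> grad S T x) + B \<xi> - f \<xi> = 0))"

text \<open>
  Minimum of \<open>\<integral> |\<nabla>T|\<^sup>2\<close> over admissible velocities, written as an infimum; where the minimum is attained
  the two agree.
\<close>

definition cooling_min ::
    "'a::euclidean_space set \<Rightarrow> (('a \<Rightarrow> real) \<Rightarrow> real) \<Rightarrow> real \<Rightarrow> real" where
  "cooling_min S f Pe =
     Inf {LINT x|lebesgue_on S. (norm (grad S T x))\<^sup>2 | u T.
            admissible_velocity S Pe u \<and> weak_temperature S f u T}"

text \<open>Extended reals: division by \<open>0\<close> gives infinity instead of \<open>0\<close>.\<close>

definition efficiency ::
    "'a::euclidean_space set \<Rightarrow> (('a \<Rightarrow> real) \<Rightarrow> real) \<Rightarrow> real \<Rightarrow> ereal" where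
  "efficiency S f Pe = ereal ((Hneg1_norm S f)\<^sup>2) / ereal (cooling_min S f Pe)"

definition unit_disk :: "(real^2) set" where
  "unit_disk = {x. norm x < 1}"

text \<open>The weak form of: the azimuthal average of \<open>f\<close> on the unit disk is at least \<open>m\<close>.\<close>

definition azimuthal_average_ge :: "((real^2 \<Rightarrow> real) \<Rightarrow> real) \<Rightarrow> real \<Rightarrow> bool" where
  "azimuthal_average_ge f m \<longleftrightarrow>
     (\<forall>\<phi>\<in>H10 unit_disk.
        (AE x in lebesgue_on unit_disk. 0 \<le> \<phi> x) \<longrightarrow>
        (\<exists>g. AE x in lebesgue_on unit_disk. \<phi> x = g (norm x)) \<longrightarrow>
        f \<phi> \<ge> m * (LINT x|lebesgue_on unit_disk. \<phi> x))"

end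

theory Submission
  imports Defs
begin

text \<open>
  The weak equation is tested with a single radial function \<open>\<xi>\<close>. The hypothesis on the azimuthal
  average bounds \<open>f \<xi>\<close> from below by \<open>f_min \<integral> \<xi>\<close>, while the equation gives
  \<open>f \<xi> = \<integral> \<nabla>\<xi> \<bullet> \<nabla>T + \<integral> \<xi> u \<bullet> \<nabla>T\<close>. Estimating the advection term by the supremum of \<open>\<xi>\<close> yields only
  \<open>\<parallel>\<nabla>T\<parallel> \<ge> c / Pe\<close>. The logarithm comes from taking for \<open>\<xi>\<close> the logarithm of the distance to the circle,
  smoothly cut off at distance \<open>\<epsilon>\<close> (\<open>cutoff\<close>): then \<open>\<integral> \<xi>\<close> grows like \<open>ln (1 / \<epsilon>)\<close>
  (\<open>profile_half_ge\<close>, \<open>cutoff_integral_ge\<close>) and \<open>\<parallel>\<nabla>\<xi>\<parallel>\<^sup>2 \<le> 2 pi / \<epsilon>\<close> (\<open>cutoff_grad_norm\<close>), but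
  \<open>\<bar>\<integral> \<xi> u \<bullet> \<nabla>T\<bar> \<le> 2 \<parallel>u\<parallel> \<parallel>\<nabla>T\<parallel>\<close> uniformly in \<open>\<epsilon>\<close> (\<open>advection_bound\<close>). With \<open>\<epsilon> = 1 / (8 Pe\<^sup>2)\<close> both terms on
  the right are at most a constant times \<open>Pe \<parallel>\<nabla>T\<parallel>\<close>, so \<open>\<parallel>\<nabla>T\<parallel> \<ge> c ln Pe / Pe\<close>
  (\<open>dissipation_lower_bound\<close>).

  The uniform advection estimate holds because \<open>u\<close> is orthogonal to every gradient, so that only the
  distance of \<open>\<xi> \<nabla>T\<close> from the gradients matters. Integrating \<open>T \<nabla>\<xi>\<close> along rays gives a potential; once it
  is subtracted from \<open>\<xi> T\<close>, the gradient differs from \<open>\<xi> \<nabla>T\<close> only by an azimuthal field \<open>2 N x'\<close>, where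
  \<open>x'\<close> is \<open>x\<close> rotated by a right angle. The factor \<open>N\<close> solves
  the transport equation \<open>2 N + x \<bullet> \<nabla>N = q\<close>, where \<open>q\<close> is the angular derivative of \<open>T\<close> times
  \<open>slope \<epsilon> (\<bar>x\<bar>\<^sup>2) \<le> 1 / (1 - \<bar>x\<bar>\<^sup>2)\<close>. The Hardy inequality \<open>hardy_unit_disk\<close> absorbs exactly this boundary
  singularity and gives \<open>\<parallel>N\<parallel> \<le> \<parallel>\<nabla>T\<parallel>\<close>.

  An infimum is bounded below by a bound on its elements only if there are any. The velocity \<open>u = 0\<close>
  with the solution of \<open>-\<Delta> T = f\<close> is one; it is obtained by minimising the Dirichlet energy
  (\<open>riesz_H10\<close>), which rests on the completeness of \<open>L2\<close> and a Poincare inequality. All integrations by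
  parts reduce to one fact, \<open>integral_directional_derivative_eq_0\<close>, and all computations with \<open>grad\<close> rest
  on the uniqueness of weak gradients, \<open>has_weak_grad_unique\<close>.
\<close>

section \<open>Square-integrable functions\<close>

text \<open>
  The common source of the Cauchy-Schwarz inequality and of the first-variation estimate for the
  Dirichlet energy.
\<close>

lemma nonneg_quadratic_imp_discriminant_le:
  fixes a b c :: real
  assumes q: "\<And>t. 0 \<le> a - 2 * t * b + t\<^sup>2 * c" and c: "0 \<le> c"
  shows "b\<^sup>2 \<le> a * c"
proof (cases "c = 0")
  case True
  have "b = 0"
  proof (rule ccontr)
    assume b: "b \<noteq> 0"
    have "0 \<le> a - 2 * ((a + 1) / (2 * b)) * b"
      using q[of "(a + 1) / (2 * b)"] True by simp
    with b show False by simp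
  qed
  with True show ?thesis by simp
next
  case False
  with c have c: "c > 0" by simp
  have "0 \<le> a - 2 * (b / c) * b + (b / c)\<^sup>2 * c" by (rule q)
  also have "\<dots> = a - b\<^sup>2 / c" using c by (simp add: power2_eq_square field_simps)
  finally have "b\<^sup>2 / c \<le> a" by simp
  then show ?thesis using c by (simp add: field_simps)
qed

lemma L2_measurable: "f \<in> L2 S \<Longrightarrow> f \<in> borel_measurable (lebesgue_on S)"
  by (simp add: L2_def)

lemma L2_integrable: "f \<in> L2 S \<Longrightarrow> integrable (lebesgue_on S) (\<lambda>x. (norm (f x))\<^sup>2)"
  by (simp add: L2_def)

lemma L2_dominated:
  fixes f :: "'a::euclidean_space \<Rightarrow> 'b::euclidean_space"
  assumes "f \<in> borel_measurable (lebesgue_on S)" "integrable (lebesgue_on S) g"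
    "AE x in lebesgue_on S. (norm (f x))\<^sup>2 \<le> g x"
  shows "f \<in> L2 S"
proof -
  have "integrable (lebesgue_on S) (\<lambda>x. (norm (f x))\<^sup>2)"
    by (rule Bochner_Integration.integrable_bound[OF assms(2)]) (use assms in auto)
  with assms show ?thesis by (simp add: L2_def)
qed

lemma L2_scaleR: "f \<in> L2 S \<Longrightarrow> (\<lambda>x. c *\<^sub>R f x) \<in> L2 S"
  by (auto simp: L2_def power_mult_distrib)

lemma L2_add:
  assumes f: "f \<in> L2 S" and g: "g \<in> L2 S"
  shows "(\<lambda>x. f x + g x) \<in> L2 S"
proof (rule L2_dominated)
  show "integrable (lebesgue_on S) (\<lambda>x. 2 * ((norm (f x))\<^sup>2 + (norm (g x))\<^sup>2))"
    by (intro integrable_mult_right Bochner_Integration.integrable_add L2_integrable f g)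
  show "AE x in lebesgue_on S. (norm (f x + g x))\<^sup>2 \<le> 2 * ((norm (f x))\<^sup>2 + (norm (g x))\<^sup>2)"
  proof (rule AE_I2)
    fix x
    have "(norm (f x + g x))\<^sup>2 \<le> (norm (f x) + norm (g x))\<^sup>2"
      by (simp add: norm_triangle_ineq power_mono)
    also have "\<dots> \<le> 2 * ((norm (f x))\<^sup>2 + (norm (g x))\<^sup>2)"
      using sum_squares_ge_zero[of "norm (f x) - norm (g x)" 0]
      by (simp add: power2_eq_square algebra_simps)
    finally show "(norm (f x + g x))\<^sup>2 \<le> 2 * ((norm (f x))\<^sup>2 + (norm (g x))\<^sup>2)" .
  qed
qed (use f g in \<open>auto simp: L2_def\<close>)

lemma L2_diff: "f \<in> L2 S \<Longrightarrow> g \<in> L2 S \<Longrightarrow> (\<lambda>x. f x - g x) \<in> L2 S"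
  using L2_add[of f S "\<lambda>x. (-1) *\<^sub>R g x"] L2_scaleR[of g S "-1"] by simp

lemma L2_mult: "f \<in> L2 S \<Longrightarrow> (\<lambda>x. c * f x) \<in> L2 S" for f :: "'a::euclidean_space \<Rightarrow> real"
  using L2_scaleR[of f S c] by simp

lemma L2_zero: "(\<lambda>x. 0) \<in> L2 S"
  by (simp add: L2_def)

lemma L2_inner_integrable:
  assumes f: "f \<in> L2 S" and g: "g \<in> L2 S"
  shows "integrable (lebesgue_on S) (\<lambda>x. f x \<bullet> g x)"
proof (rule Bochner_Integration.integrable_bound)
  show "integrable (lebesgue_on S) (\<lambda>x. (norm (f x))\<^sup>2 + (norm (g x))\<^sup>2)"
    by (intro Bochner_Integration.integrable_add L2_integrable f g)
  show "AE x in lebesgue_on S. norm (f x \<bullet> g x) \<le> norm ((norm (f x))\<^sup>2 + (norm (g x))\<^sup>2)"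
  proof (rule AE_I2)
    fix x
    have "\<bar>f x \<bullet> g x\<bar> \<le> norm (f x) * norm (g x)" by (rule Cauchy_Schwarz_ineq2)
    also have "\<dots> \<le> (norm (f x))\<^sup>2 + (norm (g x))\<^sup>2"
    proof -
      have "0 \<le> (norm (f x) - norm (g x))\<^sup>2" "0 \<le> norm (f x) * norm (g x)" by simp_all
      then show ?thesis unfolding power2_diff by linarith
    qed
    finally show "norm (f x \<bullet> g x) \<le> norm ((norm (f x))\<^sup>2 + (norm (g x))\<^sup>2)" by simp
  qed
qed (use f g in \<open>auto simp: L2_def\<close>)

lemma L2_norm_nonneg [simp]: "0 \<le> L2_norm S f"
  by (simp add: L2_norm_def)

lemma L2_norm_power2: "(L2_norm S f)\<^sup>2 = (LINT x|lebesgue_on S. (norm (f x))\<^sup>2)"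
  by (simp add: L2_norm_def)

lemma L2_norm_power2_inner: "(L2_norm S f)\<^sup>2 = (LINT x|lebesgue_on S. f x \<bullet> f x)"
  by (simp add: L2_norm_power2 power2_norm_eq_inner)

lemma L2_norm_zero [simp]: "L2_norm S (\<lambda>x. 0) = 0"
  by (simp add: L2_norm_def)

lemma L2_norm_scaleR: "L2_norm S (\<lambda>x. c *\<^sub>R f x) = \<bar>c\<bar> * L2_norm S f"
  by (simp add: L2_norm_def power_mult_distrib real_sqrt_mult)

lemma L2_norm_minus_commute: "L2_norm S (\<lambda>x. f x - g x) = L2_norm S (\<lambda>x. g x - f x)"
  by (simp add: L2_norm_def norm_minus_commute)

lemma L2_norm_cong_AE:
  assumes "AE x in lebesgue_on S. f x = g x"
    "f \<in> borel_measurable (lebesgue_on S)" "g \<in> borel_measurable (lebesgue_on S)"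
  shows "L2_norm S f = L2_norm S g"
proof -
  have "(LINT x|lebesgue_on S. (norm (f x))\<^sup>2) = (LINT x|lebesgue_on S. (norm (g x))\<^sup>2)"
    by (rule integral_cong_AE) (use assms in auto)
  then show ?thesis by (simp add: L2_norm_def)
qed

lemma L2_norm_mono:
  assumes "AE x in lebesgue_on S. norm (f x) \<le> norm (g x)" "f \<in> L2 S" "g \<in> L2 S"
  shows "L2_norm S f \<le> L2_norm S g"
proof -
  have "(LINT x|lebesgue_on S. (norm (f x))\<^sup>2) \<le> (LINT x|lebesgue_on S. (norm (g x))\<^sup>2)"
  proof (rule integral_mono_AE)
    show "AE x in lebesgue_on S. (norm (f x))\<^sup>2 \<le> (norm (g x))\<^sup>2"
      using assms(1) by eventually_elim (simp add: power_mono)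
  qed (use assms in \<open>auto intro: L2_integrable\<close>)
  then show ?thesis by (simp add: L2_norm_def)
qed

lemma L2_norm_power2_add_scaleR:
  assumes f: "f \<in> L2 S" and g: "g \<in> L2 S"
  shows "(L2_norm S (\<lambda>x. f x + t *\<^sub>R g x))\<^sup>2 =
    (L2_norm S f)\<^sup>2 + 2 * t * (LINT x|lebesgue_on S. f x \<bullet> g x) + t\<^sup>2 * (L2_norm S g)\<^sup>2"
proof -
  have "(LINT x|lebesgue_on S. (f x + t *\<^sub>R g x) \<bullet> (f x + t *\<^sub>R g x)) =
        (LINT x|lebesgue_on S. (f x \<bullet> f x + (2 * t) * (f x \<bullet> g x)) + t\<^sup>2 * (g x \<bullet> g x))"
    by (simp add: inner_add_left inner_add_right inner_commute algebra_simps power2_eq_square)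
  also have "\<dots> = (LINT x|lebesgue_on S. f x \<bullet> f x) + (2 * t) * (LINT x|lebesgue_on S. f x \<bullet> g x)
      + t\<^sup>2 * (LINT x|lebesgue_on S. g x \<bullet> g x)"
    using f g by (simp add: L2_inner_integrable)
  finally show ?thesis by (simp add: L2_norm_power2_inner)
qed

lemma L2_Cauchy_Schwarz:
  assumes f: "f \<in> L2 S" and g: "g \<in> L2 S"
  shows "\<bar>LINT x|lebesgue_on S. f x \<bullet> g x\<bar> \<le> L2_norm S f * L2_norm S g"
proof -
  have "(LINT x|lebesgue_on S. f x \<bullet> g x)\<^sup>2 \<le> (L2_norm S f)\<^sup>2 * (L2_norm S g)\<^sup>2"
  proof (rule nonneg_quadratic_imp_discriminant_le)
    fix t :: real
    have "0 \<le> (L2_norm S (\<lambda>x. f x + (-t) *\<^sub>R g x))\<^sup>2" by simp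
    then show "0 \<le> (L2_norm S f)\<^sup>2 - 2 * t * (LINT x|lebesgue_on S. f x \<bullet> g x)
        + t\<^sup>2 * (L2_norm S g)\<^sup>2"
      unfolding L2_norm_power2_add_scaleR[OF f g] by simp
  qed simp
  then have "\<bar>LINT x|lebesgue_on S. f x \<bullet> g x\<bar> \<le> \<bar>L2_norm S f * L2_norm S g\<bar>"
    unfolding power_mult_distrib[symmetric] by (simp only: abs_le_square_iff)
  then show ?thesis by (simp add: abs_mult)
qed

lemma L2_norm_triangle:
  assumes f: "f \<in> L2 S" and g: "g \<in> L2 S"
  shows "L2_norm S (\<lambda>x. f x + g x) \<le> L2_norm S f + L2_norm S g"
proof (rule power2_le_imp_le)
  have "(L2_norm S (\<lambda>x. f x + g x))\<^sup>2 =
      (L2_norm S f)\<^sup>2 + 2 * (LINT x|lebesgue_on S. f x \<bullet> g x) + (L2_norm S g)\<^sup>2"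
    using L2_norm_power2_add_scaleR[OF f g, of 1] by simp
  also have "\<dots> \<le> (L2_norm S f + L2_norm S g)\<^sup>2"
    using L2_Cauchy_Schwarz[OF f g] by (simp add: power2_sum)
  finally show "(L2_norm S (\<lambda>x. f x + g x))\<^sup>2 \<le> (L2_norm S f + L2_norm S g)\<^sup>2" .
qed simp

lemma L2_tendsto_inner:
  assumes f: "\<And>n. f n \<in> L2 S" "F \<in> L2 S" and lim: "(\<lambda>n. L2_norm S (\<lambda>x. f n x - F x)) \<longlonglongrightarrow> 0"
    and g: "g \<in> L2 S"
  shows "(\<lambda>n. LINT x|lebesgue_on S. f n x \<bullet> g x) \<longlonglongrightarrow> (LINT x|lebesgue_on S. F x \<bullet> g x)"
proof (rule LIM_zero_cancel, rule Lim_null_comparison)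
  show "(\<lambda>n. L2_norm S (\<lambda>x. f n x - F x) * L2_norm S g) \<longlonglongrightarrow> 0"
    using tendsto_mult_right[OF lim, of "L2_norm S g"] by simp
  show "\<forall>\<^sub>F n in sequentially. norm ((LINT x|lebesgue_on S. f n x \<bullet> g x) - (LINT x|lebesgue_on S. F x \<bullet> g x))
      \<le> L2_norm S (\<lambda>x. f n x - F x) * L2_norm S g"
  proof (rule always_eventually, rule allI)
    fix n
    have "(LINT x|lebesgue_on S. f n x \<bullet> g x) - (LINT x|lebesgue_on S. F x \<bullet> g x) =
        (LINT x|lebesgue_on S. (f n x - F x) \<bullet> g x)"
      using f g by (simp add: inner_diff_left L2_inner_integrable)
    then show "norm ((LINT x|lebesgue_on S. f n x \<bullet> g x) - (LINT x|lebesgue_on S. F x \<bullet> g x))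
      \<le> L2_norm S (\<lambda>x. f n x - F x) * L2_norm S g"
      using L2_Cauchy_Schwarz[OF L2_diff[OF f(1)[of n] f(2)] g] by simp
  qed
qed

lemma L2_tendsto_norm:
  assumes f: "\<And>n. f n \<in> L2 S" "F \<in> L2 S" and lim: "(\<lambda>n. L2_norm S (\<lambda>x. f n x - F x)) \<longlonglongrightarrow> 0"
  shows "(\<lambda>n. L2_norm S (f n)) \<longlonglongrightarrow> L2_norm S F"
proof (rule LIM_zero_cancel, rule Lim_null_comparison[OF _ lim], rule always_eventually, rule allI)
  fix n
  have "L2_norm S (f n) \<le> L2_norm S (\<lambda>x. f n x - F x) + L2_norm S F"
    using L2_norm_triangle[OF L2_diff[OF f(1)[of n] f(2)] f(2)] by simp
  moreover have "L2_norm S F \<le> L2_norm S (\<lambda>x. f n x - F x) + L2_norm S (f n)"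
    using L2_norm_triangle[OF L2_diff[OF f(2) f(1)[of n]] f(1)[of n]]
      L2_norm_minus_commute[of S F "f n"] by simp
  ultimately show "norm (L2_norm S (f n) - L2_norm S F) \<le> L2_norm S (\<lambda>x. f n x - F x)" by simp
qed

text \<open>
  The Riesz-Fischer argument: along a subsequence whose increments \<open>d k\<close> satisfy \<open>\<parallel>d k\<parallel> \<le> 2\<^sup>-\<^sup>k\<close> the series
  \<open>\<Sum> 2\<^sup>k \<bar>d k\<bar>\<^sup>2\<close> is integrable, hence finite almost everywhere. This forces pointwise convergence, and
  Fatou's lemma turns the pointwise limit into a limit in norm.
\<close>

lemma L2_complete:
  fixes f :: "nat \<Rightarrow> 'a::euclidean_space \<Rightarrow> 'b::euclidean_space"
  assumes f: "\<And>n. f n \<in> L2 S"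
    and cauchy: "\<And>e. e > 0 \<Longrightarrow> \<exists>N. \<forall>m\<ge>N. \<forall>n\<ge>N. L2_norm S (\<lambda>x. f m x - f n x) < e"
  obtains F where "F \<in> L2 S" "(\<lambda>n. L2_norm S (\<lambda>x. f n x - F x)) \<longlonglongrightarrow> 0"
proof -
  define M where "M = lebesgue_on S"
  have meas [measurable]: "f n \<in> borel_measurable M" for n
    using f L2_measurable M_def by blast
  have nn: "(\<integral>\<^sup>+x. ennreal ((norm (h x))\<^sup>2) \<partial>M) = ennreal ((L2_norm S h)\<^sup>2)"
    if "h \<in> L2 S" for h :: "'a \<Rightarrow> 'b"
    using that unfolding L2_norm_power2 M_def
    by (intro nn_integral_eq_integral L2_integrable) auto
  obtain N where N: "\<And>k m n. m \<ge> N k \<Longrightarrow> n \<ge> N k \<Longrightarrow> L2_norm S (\<lambda>x. f m x - f n x) < (1/2) ^ k"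
  proof -
    have "\<forall>k. \<exists>N. \<forall>m\<ge>N. \<forall>n\<ge>N. L2_norm S (\<lambda>x. f m x - f n x) < (1/2::real) ^ k"
      using cauchy by simp
    then show ?thesis using that by metis
  qed
  \<comment> \<open>partial sums make the indices monotone while keeping them above \<open>N k\<close>\<close>
  define r where "r = (\<lambda>k. \<Sum>j\<le>k. N j)"
  have r: "r k \<ge> N k" for k
    unfolding r_def by (rule member_le_sum) auto
  have r_mono: "r (Suc k) \<ge> r k" for k
    by (simp add: r_def)
  have rN: "j \<ge> k \<Longrightarrow> r j \<ge> N k" for j k
    using r lift_Suc_mono_le[of r, OF r_mono] by (meson le_trans)
  define d where "d k x = f (r (Suc k)) x - f (r k) x" for k x
  have dL: "d k \<in> L2 S" for k
    unfolding d_def by (intro L2_diff f)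
  have dm [measurable]: "d k \<in> borel_measurable M" for k
    using dL L2_measurable M_def by blast
  have dn: "(L2_norm S (d k))\<^sup>2 \<le> ((1/2) ^ k)\<^sup>2" for k
    unfolding d_def by (rule power_mono[OF less_imp_le[OF N[OF rN rN]]]) auto
  have "(\<integral>\<^sup>+x. (\<Sum>k. ennreal (2 ^ k * (norm (d k x))\<^sup>2)) \<partial>M) =
      (\<Sum>k. \<integral>\<^sup>+x. ennreal (2 ^ k * (norm (d k x))\<^sup>2) \<partial>M)"
    by (rule nn_integral_suminf) measurable
  also have "\<dots> \<le> (\<Sum>k. ennreal ((1/2) ^ k))"
  proof (rule suminf_le)
    fix k
    have "(\<integral>\<^sup>+x. ennreal (2 ^ k * (norm (d k x))\<^sup>2) \<partial>M) =
        ennreal (2 ^ k) * (\<integral>\<^sup>+x. ennreal ((norm (d k x))\<^sup>2) \<partial>M)"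
      by (subst nn_integral_cmult[symmetric]) (auto simp: ennreal_mult)
    also have "\<dots> = ennreal (2 ^ k * (L2_norm S (d k))\<^sup>2)"
      by (simp add: nn[OF dL] ennreal_mult)
    also have "\<dots> \<le> ennreal ((1/2) ^ k)"
    proof (rule ennreal_leI)
      have "2 ^ k * (L2_norm S (d k))\<^sup>2 \<le> 2 ^ k * ((1/2) ^ k)\<^sup>2"
        using dn by (simp add: mult_left_mono)
      also have "\<dots> = (1/2::real) ^ k"
        by (simp add: power2_eq_square power_mult_distrib[symmetric] mult.assoc[symmetric])
      finally show "2 ^ k * (L2_norm S (d k))\<^sup>2 \<le> (1/2) ^ k" .
    qed
    finally show "(\<integral>\<^sup>+x. ennreal (2 ^ k * (norm (d k x))\<^sup>2) \<partial>M) \<le> ennreal ((1/2) ^ k)" .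
  qed auto
  also have "\<dots> < \<infinity>"
    by (subst suminf_ennreal2) (auto simp: summable_geometric)
  finally have "(\<integral>\<^sup>+x. (\<Sum>k. ennreal (2 ^ k * (norm (d k x))\<^sup>2)) \<partial>M) \<noteq> \<infinity>" by simp
  then have ae: "AE x in M. (\<Sum>k. ennreal (2 ^ k * (norm (d k x))\<^sup>2)) \<noteq> \<infinity>"
    by (intro nn_integral_PInf_AE) auto
  have ae_conv: "AE x in M. convergent (\<lambda>k. f (r k) x)"
    using ae
  proof eventually_elim
    fix x assume "(\<Sum>k. ennreal (2 ^ k * (norm (d k x))\<^sup>2)) \<noteq> \<infinity>"
    then have s: "summable (\<lambda>k. 2 ^ k * (norm (d k x))\<^sup>2)"
      by (intro summable_suminf_not_top) auto
    have "summable (\<lambda>k. d k x)"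
    proof (rule summable_comparison_test')
      show "summable (\<lambda>k. (1/2) ^ k + 2 ^ k * (norm (d k x))\<^sup>2)"
        by (intro summable_add s) (simp add: summable_geometric)
      fix k
      define a where "a = (2::real) ^ k"
      have a: "a > 0" "(1/2) ^ k = 1 / a" by (auto simp: a_def power_one_over)
      \<comment> \<open>by the inequality of arithmetic and geometric means, \<open>\<bar>d k\<bar> \<le> 1 / a + a \<bar>d k\<bar>\<^sup>2\<close> with weight \<open>a = 2\<^sup>k\<close>\<close>
      have "0 \<le> (1 - a * norm (d k x))\<^sup>2 + (a * norm (d k x))\<^sup>2 + 1" by simp
      then have "a * norm (d k x) \<le> 1 + a\<^sup>2 * (norm (d k x))\<^sup>2"
        by (simp add: power2_eq_square algebra_simps)
      then have "norm (d k x) \<le> 1 / a + a * (norm (d k x))\<^sup>2"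
        using a by (simp add: field_simps power2_eq_square)
      then show "norm (d k x) \<le> (1/2) ^ k + 2 ^ k * (norm (d k x))\<^sup>2"
        using a(2) a_def by simp
    qed
    then have "convergent (\<lambda>n. \<Sum>k<n. d k x)"
      by (simp add: summable_iff_convergent)
    moreover have "(\<Sum>k<n. d k x) = f (r n) x - f (r 0) x" for n
      unfolding d_def by (rule sum_lessThan_telescope)
    ultimately have "convergent (\<lambda>n. f (r n) x - f (r 0) x)" by simp
    then show "convergent (\<lambda>n. f (r n) x)"
      by (simp add: convergent_diff_const_right_iff)
  qed
  define F where "F x = lim (\<lambda>k. f (r k) x)" for x
  have Fm [measurable]: "F \<in> borel_measurable M"
    unfolding F_def by measurable
  have est: "(\<integral>\<^sup>+x. ennreal ((norm (f n x - F x))\<^sup>2) \<partial>M) \<le> ennreal (((1/2) ^ k)\<^sup>2)" if n: "n \<ge> N k" for n k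
  proof -
    have "(\<integral>\<^sup>+x. ennreal ((norm (f n x - F x))\<^sup>2) \<partial>M) =
        (\<integral>\<^sup>+x. liminf (\<lambda>j. ennreal ((norm (f n x - f (r j) x))\<^sup>2)) \<partial>M)"
    proof (rule nn_integral_cong_AE)
      show "AE x in M. ennreal ((norm (f n x - F x))\<^sup>2) = liminf (\<lambda>j. ennreal ((norm (f n x - f (r j) x))\<^sup>2))"
        using ae_conv
      proof eventually_elim
        fix x assume "convergent (\<lambda>k. f (r k) x)"
        then have "(\<lambda>k. f (r k) x) \<longlonglongrightarrow> F x" unfolding F_def by (simp add: convergent_LIMSEQ_iff)
        then have "(\<lambda>j. ennreal ((norm (f n x - f (r j) x))\<^sup>2)) \<longlonglongrightarrow> ennreal ((norm (f n x - F x))\<^sup>2)"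
          by (intro tendsto_intros)
        then show "ennreal ((norm (f n x - F x))\<^sup>2) = liminf (\<lambda>j. ennreal ((norm (f n x - f (r j) x))\<^sup>2))"
          by (intro lim_imp_Liminf[symmetric]) auto
      qed
    qed
    also have "\<dots> \<le> liminf (\<lambda>j. \<integral>\<^sup>+x. ennreal ((norm (f n x - f (r j) x))\<^sup>2) \<partial>M)"
      by (rule nn_integral_liminf) measurable
    also have "\<dots> \<le> ennreal (((1/2) ^ k)\<^sup>2)"
    proof (rule Liminf_le)
      show "\<forall>\<^sub>F j in sequentially. (\<integral>\<^sup>+x. ennreal ((norm (f n x - f (r j) x))\<^sup>2) \<partial>M) \<le> ennreal (((1/2) ^ k)\<^sup>2)"
        using eventually_ge_at_top[of k]
      proof eventually_elim
        fix j assume "k \<le> j"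
        then show "(\<integral>\<^sup>+x. ennreal ((norm (f n x - f (r j) x))\<^sup>2) \<partial>M) \<le> ennreal (((1/2) ^ k)\<^sup>2)"
          unfolding nn[OF L2_diff[OF f f]]
          by (intro ennreal_leI power_mono less_imp_le[OF N[OF n rN]]) auto
      qed
    qed simp
    finally show ?thesis .
  qed
  have diffL: "(\<lambda>x. f n x - F x) \<in> L2 S" if "n \<ge> N k" for n k
  proof -
    have "integrable M (\<lambda>x. (norm (f n x - F x))\<^sup>2)"
    proof (rule integrableI_bounded)
      have "(\<integral>\<^sup>+x. ennreal (norm ((norm (f n x - F x))\<^sup>2)) \<partial>M) \<le> ennreal (((1/2) ^ k)\<^sup>2)"
        using est[OF that] by simp
      also have "\<dots> < \<infinity>" by simp
      finally show "(\<integral>\<^sup>+x. ennreal (norm ((norm (f n x - F x))\<^sup>2)) \<partial>M) < \<infinity>" .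
    qed measurable
    then show ?thesis unfolding L2_def M_def[symmetric] by simp
  qed
  have FL: "F \<in> L2 S"
    using L2_diff[OF f[of "N 0"] diffL[of 0 "N 0"]] by simp
  have "L2_norm S (\<lambda>x. f n x - F x) \<le> (1/2) ^ k" if "n \<ge> N k" for n k
  proof -
    have "ennreal ((L2_norm S (\<lambda>x. f n x - F x))\<^sup>2) \<le> ennreal (((1/2) ^ k)\<^sup>2)"
      using est[OF that] nn[OF diffL[OF that]] by simp
    then have "(L2_norm S (\<lambda>x. f n x - F x))\<^sup>2 \<le> ((1/2) ^ k)\<^sup>2"
      by (subst (asm) ennreal_le_iff) auto
    then show ?thesis by (rule power2_le_imp_le) simp
  qed
  note bound = this
  have "(\<lambda>n. L2_norm S (\<lambda>x. f n x - F x)) \<longlonglongrightarrow> 0"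
  proof (rule LIMSEQ_I)
    fix e :: real assume "e > 0"
    then obtain k where "(1/2::real) ^ k < e"
      using real_arch_pow_inv[of e "1/2"] by auto
    then show "\<exists>no. \<forall>n\<ge>no. norm (L2_norm S (\<lambda>x. f n x - F x) - 0) < e"
      using bound[of k] by (intro exI[of _ "N k"]) (auto intro: le_less_trans)
  qed
  with FL that show ?thesis by blast
qed

section \<open>Smooth functions\<close>

lemma Ck_SucI:
  assumes "\<And>x. (f has_derivative D x) (at x)" "\<And>b. b \<in> Basis \<Longrightarrow> Ck k (\<lambda>x. D x b)"
  shows "Ck (Suc k) f"
proof -
  have "frechet_derivative f (at x) = D x" for x
    using assms(1) frechet_derivative_at by metis
  then show ?thesis using assms by (auto simp: differentiable_def)
qed

lemma Ck_SucE:
  assumes "Ck (Suc k) f"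
  shows "(f has_derivative frechet_derivative f (at x)) (at x)"
    "b \<in> Basis \<Longrightarrow> Ck k (\<lambda>x. frechet_derivative f (at x) b)"
  using assms by (auto simp: frechet_derivative_works)

lemma Ck_SucD: "Ck (Suc k) f \<Longrightarrow> Ck k f"
proof (induction k arbitrary: f)
  case 0
  then have "(f has_derivative frechet_derivative f (at x)) (at x)" for x
    using Ck_SucE by blast
  then show ?case
    by (auto simp: continuous_on_eq_continuous_within intro: has_derivative_continuous)
next
  case (Suc k)
  show ?case
    by (rule Ck_SucI[OF Ck_SucE(1)[OF Suc.prems]]) (use Suc Ck_SucE(2) in blast)
qed

lemma Ck_imp_continuous: "Ck k f \<Longrightarrow> continuous_on UNIV f"
  by (induction k) (auto dest: Ck_SucD simp del: Ck.simps(2))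

lemma Ck_const: "Ck k (\<lambda>x. c)"
proof (induction k arbitrary: c)
  case (Suc k)
  show ?case by (rule Ck_SucI[where D = "\<lambda>x h. 0"]) (use Suc in auto)
qed auto

lemma Ck_bounded_linear: "bounded_linear f \<Longrightarrow> Ck k f"
proof (cases k)
  case (Suc j)
  assume "bounded_linear f"
  then show ?thesis unfolding Suc
    by (intro Ck_SucI[where D = "\<lambda>x. f"] bounded_linear_imp_has_derivative Ck_const)
qed (auto intro: linear_continuous_on)

lemma Ck_add: "Ck k f \<Longrightarrow> Ck k g \<Longrightarrow> Ck k (\<lambda>x. f x + g x)"
proof (induction k arbitrary: f g)
  case (Suc k)
  show ?case
    by (rule Ck_SucI[OF has_derivative_add[OF Ck_SucE(1)[OF Suc.prems(1)] Ck_SucE(1)[OF Suc.prems(2)]]])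
      (intro Suc.IH Ck_SucE(2)[OF Suc.prems(1)] Ck_SucE(2)[OF Suc.prems(2)])
qed (simp add: continuous_on_add continuous_on_mult)

lemma Ck_mult: "Ck k f \<Longrightarrow> Ck k g \<Longrightarrow> Ck k (\<lambda>x. f x * g x)"
proof (induction k arbitrary: f g)
  case (Suc k)
  show ?case
    by (rule Ck_SucI[OF has_derivative_mult[OF Ck_SucE(1)[OF Suc.prems(1)] Ck_SucE(1)[OF Suc.prems(2)]]])
      (intro Ck_add Suc.IH Ck_SucE(2)[OF Suc.prems(1)] Ck_SucE(2)[OF Suc.prems(2)]
        Ck_SucD[OF Suc.prems(1)] Ck_SucD[OF Suc.prems(2)])
qed (simp add: continuous_on_add continuous_on_mult)

lemma Ck_cmult: "Ck k f \<Longrightarrow> Ck k (\<lambda>x. c * f x)"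
  by (intro Ck_mult Ck_const)

lemma Ck_diff: "Ck k f \<Longrightarrow> Ck k g \<Longrightarrow> Ck k (\<lambda>x. f x - g x)"
  using Ck_add[of k f "\<lambda>x. (-1) * g x"] Ck_cmult[of k g "-1"] by simp

lemma Ck_sum: "(\<And>i. i \<in> I \<Longrightarrow> Ck k (f i)) \<Longrightarrow> Ck k (\<lambda>x. \<Sum>i\<in>I. f i x)"
  by (induction I rule: infinite_finite_induct) (auto intro: Ck_add Ck_const)

lemma Ck_prod: "(\<And>i. i \<in> I \<Longrightarrow> Ck k (f i)) \<Longrightarrow> Ck k (\<lambda>x. \<Prod>i\<in>I. f i x)"
  by (induction I rule: infinite_finite_induct) (auto intro: Ck_mult Ck_const)

lemma Ck_inner_self: "Ck k (\<lambda>x. x \<bullet> x)"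
proof -
  have eq: "(\<lambda>x::'a. x \<bullet> x) = (\<lambda>x. \<Sum>b\<in>Basis. (x \<bullet> b) * (x \<bullet> b))"
    by (rule ext) (rule euclidean_inner)
  show ?thesis
    by (rule ssubst[OF eq, where P = "Ck k"])
      (intro Ck_sum Ck_mult Ck_bounded_linear bounded_linear_inner_left)
qed

lemma Ck_real_SucI:
  fixes f :: "real \<Rightarrow> real"
  assumes "\<And>x. (f has_real_derivative f' x) (at x)" "Ck k f'"
  shows "Ck (Suc k) f"
  by (rule Ck_SucI[OF assms(1)[unfolded has_field_derivative_def]]) (use assms(2) in simp)

lemma Ck_compose:
  fixes f :: "real \<Rightarrow> real"
  shows "Ck k f \<Longrightarrow> Ck k g \<Longrightarrow> Ck k (\<lambda>x. f (g x))"
proof (induction k arbitrary: f)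
  case (Suc k)
  define f' where "f' x = frechet_derivative f (at x) 1" for x
  have f: "(f has_derivative frechet_derivative f (at x)) (at x)" for x
    by (rule Ck_SucE(1)[OF Suc.prems(1)])
  have f': "(f has_derivative (*) (f' x)) (at x)" for x
  proof -
    have "frechet_derivative f (at x) h = f' x * h" for h
      using linear_scale[OF has_derivative_linear[OF f[of x]], of h 1] by (simp add: f'_def)
    then have "frechet_derivative f (at x) = (*) (f' x)" by (rule ext)
    then show ?thesis using f[of x] by simp
  qed
  have Cf': "Ck k f'" unfolding f'_def by (rule Ck_SucE(2)[OF Suc.prems(1)]) simp
  show ?case
  proof (rule Ck_SucI)
    show "((\<lambda>x. f (g x)) has_derivative (\<lambda>h. f' (g x) * frechet_derivative g (at x) h)) (at x)" for x
      by (rule has_derivative_compose[OF Ck_SucE(1)[OF Suc.prems(2)] f'])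
    show "Ck k (\<lambda>x. f' (g x) * frechet_derivative g (at x) b)" if "b \<in> Basis" for b
      by (rule Ck_mult[OF Suc.IH[OF Cf' Ck_SucD[OF Suc.prems(2)]] Ck_SucE(2)[OF Suc.prems(2) that]])
  qed
next
  case 0
  then show ?case by (auto intro: continuous_on_compose2)
qed

lemma classical_grad_inner: "b \<in> Basis \<Longrightarrow> classical_grad f x \<bullet> b = frechet_derivative f (at x) b"
  unfolding classical_grad_def by (simp add: inner_sum_left inner_Basis if_distrib sum.delta cong: if_cong)

lemma GDERIV_classical_grad:
  assumes "f differentiable (at x)"
  shows "GDERIV f x :> classical_grad f x"
proof -
  have d: "(f has_derivative frechet_derivative f (at x)) (at x)"
    using assms by (simp add: frechet_derivative_works)
  have "frechet_derivative f (at x) h = h \<bullet> classical_grad f x" for h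
  proof -
    have "frechet_derivative f (at x) h = (\<Sum>b\<in>Basis. (h \<bullet> b) * frechet_derivative f (at x) b)"
      using linear_sum[OF has_derivative_linear[OF d], of "\<lambda>b. (h \<bullet> b) *\<^sub>R b" Basis]
      by (simp add: linear_scale[OF has_derivative_linear[OF d]] euclidean_representation)
    then show ?thesis
      unfolding euclidean_inner[of h "classical_grad f x"] by (simp add: classical_grad_inner)
  qed
  then have "frechet_derivative f (at x) = (\<lambda>h. h \<bullet> classical_grad f x)" by auto
  with d show ?thesis by (simp add: gderiv_def)
qed

lemma GDERIV_imp_continuous_on:
  assumes "\<And>x. GDERIV f x :> g x"
  shows "continuous_on UNIV f"
  by (intro continuous_at_imp_continuous_on ballI has_derivative_continuous[OF assms[unfolded gderiv_def]])

lemma GDERIV_unique: "GDERIV f x :> a \<Longrightarrow> GDERIV f x :> b \<Longrightarrow> a = b"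
  unfolding gderiv_def by (metis has_derivative_unique vector_eq_rdot inner_commute)

lemma classical_grad_eq: "GDERIV f x :> g \<Longrightarrow> classical_grad f x = g"
  using GDERIV_unique GDERIV_classical_grad by (metis differentiable_def gderiv_def)

lemma Ck_GDERIV: "Ck (Suc k) f \<Longrightarrow> GDERIV f x :> classical_grad f x"
  by (intro GDERIV_classical_grad) simp

lemma Ck_classical_grad_inner: "Ck (Suc k) f \<Longrightarrow> Ck k (\<lambda>x. classical_grad f x \<bullet> c)"
proof -
  assume f: "Ck (Suc k) f"
  have "Ck k (\<lambda>x. \<Sum>b\<in>Basis. (c \<bullet> b) * frechet_derivative f (at x) b)"
    by (intro Ck_sum Ck_cmult Ck_SucE(2)[OF f])
  then show ?thesis
    unfolding euclidean_inner[of "classical_grad f _" c] by (simp add: classical_grad_inner mult.commute)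
qed

lemma Ck_continuous_grad:
  assumes "Ck (Suc k) f"
  shows "continuous_on UNIV (classical_grad f)"
  unfolding classical_grad_def
  by (intro continuous_on_sum continuous_on_scaleR continuous_on_const
      Ck_imp_continuous[OF Ck_SucE(2)[OF assms]])

section \<open>A function flat at the origin\<close>

text \<open>
  The classical smooth function that is flat at \<open>0\<close>. The powers of \<open>1 / z\<close> make the family closed under
  differentiation, so that smoothness of all members is a single induction.
\<close>

definition flat :: "real \<Rightarrow> nat \<Rightarrow> real \<Rightarrow> real" where
  "flat \<epsilon> m z = (if z > 0 then (1 / z) ^ m * exp (- \<epsilon> / z) else 0)"

lemma flat_nonneg: "0 \<le> flat \<epsilon> m z"
  by (simp add: flat_def)

text \<open>
  The exponential beats every power of \<open>z\<close>. A quadratic bound is all that differentiability at \<open>0\<close>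
  requires.
\<close>

lemma flat_le_square:
  assumes "\<epsilon> > 0"
  obtains C where "\<And>z. flat \<epsilon> m z \<le> C * z\<^sup>2"
proof
  fix z
  define N where "N = m + 2"
  show "flat \<epsilon> m z \<le> (real N / \<epsilon>) ^ N * z\<^sup>2"
  proof (cases "z > 0")
    case True
    have N: "N > 0" by (simp add: N_def)
    have "(1 + (\<epsilon> / z) / real N) ^ N \<le> exp (\<epsilon> / z)"
      by (rule exp_ge_one_plus_x_over_n_power_n) (use True assms N in \<open>auto intro: order_trans[of _ 0]\<close>)
    moreover have "((\<epsilon> / z) / real N) ^ N \<le> (1 + (\<epsilon> / z) / real N) ^ N"
      by (rule power_mono) (use True assms in auto)
    ultimately have "((\<epsilon> / z) / real N) ^ N \<le> exp (\<epsilon> / z)" by linarith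
    then have "exp (- \<epsilon> / z) \<le> (real N / \<epsilon>) ^ N * z ^ N"
      using True assms N by (simp add: exp_minus field_simps power_divide power_mult_distrib)
    then have "(1 / z) ^ m * exp (- \<epsilon> / z) \<le> (1 / z) ^ m * ((real N / \<epsilon>) ^ N * z ^ N)"
      using True by (intro mult_left_mono) auto
    also have "\<dots> = (real N / \<epsilon>) ^ N * z\<^sup>2"
      using True unfolding N_def power_add by (simp add: power_divide)
    finally show ?thesis using True by (simp add: flat_def)
  qed (use assms in \<open>auto simp: flat_def\<close>)
qed

lemma has_derivative_0_of_le_square:
  fixes f :: "real \<Rightarrow> real"
  assumes "f 0 = 0" "\<And>z. \<bar>f z\<bar> \<le> C * z\<^sup>2"
  shows "(f has_real_derivative 0) (at 0)"
  unfolding DERIV_def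
proof (rule Lim_null_comparison)
  show "\<forall>\<^sub>F h in at 0. norm ((f (0 + h) - f 0) / h) \<le> \<bar>C\<bar> * \<bar>h\<bar>"
  proof (rule always_eventually, rule allI)
    fix h :: real
    have "\<bar>f h\<bar> \<le> \<bar>C\<bar> * \<bar>h\<bar> * \<bar>h\<bar>"
      using assms(2)[of h] mult_right_mono[OF abs_ge_self[of C], of "h\<^sup>2"]
      by (simp add: power2_eq_square mult.assoc)
    then show "norm ((f (0 + h) - f 0) / h) \<le> \<bar>C\<bar> * \<bar>h\<bar>"
      using assms(1) by (cases "h = 0") (auto simp: divide_le_eq)
  qed
  show "((\<lambda>h. \<bar>C\<bar> * \<bar>h\<bar>) \<longlongrightarrow> 0) (at 0)"
    by (auto intro!: tendsto_eq_intros)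
qed

lemma flat_has_derivative:
  assumes "\<epsilon> > 0"
  shows "(flat \<epsilon> m has_real_derivative (\<epsilon> * flat \<epsilon> (m + 2) z - real m * flat \<epsilon> (m + 1) z)) (at z)"
proof -
  consider "z > 0" | "z < 0" | "z = 0" by linarith
  then show ?thesis
  proof cases
    case 1
    define w where "w = 1 / z"
    have w: "((\<lambda>z. 1 / z) has_real_derivative - (w * w)) (at z)"
      unfolding w_def using 1 by (auto intro!: derivative_eq_intros)
    have "((\<lambda>w. w ^ m * exp (- \<epsilon> * w)) has_real_derivative
        (real m * w ^ (m - 1) * exp (- \<epsilon> * w) - \<epsilon> * w ^ m * exp (- \<epsilon> * w))) (at (1 / z))"
      unfolding w_def by (auto intro!: derivative_eq_intros)
    from DERIV_chain2[OF this w]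
    have "((\<lambda>z. (1 / z) ^ m * exp (- \<epsilon> / z)) has_real_derivative
        (real m * w ^ (m - 1) * exp (- \<epsilon> * w) - \<epsilon> * w ^ m * exp (- \<epsilon> * w)) * - (w * w)) (at z)"
      by simp
    moreover have "(real m * w ^ (m - 1) * exp (- \<epsilon> * w) - \<epsilon> * w ^ m * exp (- \<epsilon> * w)) * - (w * w)
        = \<epsilon> * (w ^ (m + 2) * exp (- \<epsilon> * w)) - real m * (w ^ (m + 1) * exp (- \<epsilon> * w))"
      by (cases m) (simp_all add: algebra_simps)
    ultimately have "((\<lambda>z. (1 / z) ^ m * exp (- \<epsilon> / z)) has_real_derivative
        \<epsilon> * flat \<epsilon> (m + 2) z - real m * flat \<epsilon> (m + 1) z) (at z)"
      using 1 by (simp add: flat_def w_def)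
    then show ?thesis
      by (rule has_field_derivative_transform_within_open[of _ _ _ "{0<..}"]) (use 1 in \<open>auto simp: flat_def\<close>)
  next
    case 2
    have "((\<lambda>z. 0) has_real_derivative 0) (at z)" by simp
    then have "(flat \<epsilon> m has_real_derivative 0) (at z)"
      by (rule has_field_derivative_transform_within_open[of _ _ _ "{..<0}"]) (use 2 in \<open>auto simp: flat_def\<close>)
    then show ?thesis using 2 by (simp add: flat_def)
  next
    case 3
    obtain C where C: "\<And>z. flat \<epsilon> m z \<le> C * z\<^sup>2"
      using flat_le_square[OF assms] by blast
    have "(flat \<epsilon> m has_real_derivative 0) (at 0)"
      by (rule has_derivative_0_of_le_square[of _ C]) (use C flat_nonneg in \<open>auto simp: flat_def\<close>)
    then show ?thesis using 3 by (simp add: flat_def)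
  qed
qed

lemma Ck_flat:
  assumes "\<epsilon> > 0"
  shows "Ck k (flat \<epsilon> m)"
proof (induction k arbitrary: m)
  case 0
  then show ?case
    using DERIV_isCont[OF flat_has_derivative[OF assms]]
    by (auto intro: continuous_at_imp_continuous_on)
next
  case (Suc k)
  show ?case
    by (rule Ck_real_SucI[OF flat_has_derivative[OF assms]]) (intro Ck_diff Ck_cmult Suc.IH)
qed

section \<open>Integration by parts\<close>

lemma lborel_integral_translate:
  fixes f :: "'a::euclidean_space \<Rightarrow> real"
  assumes "f \<in> borel_measurable borel"
  shows "integral\<^sup>L lborel (\<lambda>x. f (x + c)) = integral\<^sup>L lborel f"
proof -
  have "integral\<^sup>L lborel f = integral\<^sup>L (distr lborel borel ((+) c)) f"
    by (simp add: lborel_distr_plus)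
  also have "\<dots> = integral\<^sup>L lborel (\<lambda>x. f (c + x))"
    by (rule integral_distr) (use assms in auto)
  finally show ?thesis by (simp add: add.commute)
qed

text \<open>
  Difference quotients have integral \<open>0\<close> by translation invariance of Lebesgue measure, and the
  Lipschitz bound dominates them by a multiple of the indicator of a ball. Lipschitz continuity instead
  of continuous differentiability admits functions with a kink along the unit circle, such as products
  with the positive part of \<open>1 - x \<bullet> x\<close>.
\<close>

lemma integral_directional_derivative_eq_0:
  fixes w g :: "'a::euclidean_space \<Rightarrow> real"
  assumes lip: "\<And>r. \<exists>K. K-lipschitz_on (cball 0 r) w"
    and supp: "\<And>x. norm x > R \<Longrightarrow> w x = 0"
    and der: "AE x in lborel. ((\<lambda>t. w (x + t *\<^sub>R b)) has_real_derivative g x) (at 0)"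
    and meas: "g \<in> borel_measurable borel"
  shows "integrable lborel g" "integral\<^sup>L lborel g = 0"
proof -
  \<comment> \<open>all difference quotients with step at most \<open>1\<close> vanish outside \<open>cball 0 Q\<close>\<close>
  define Q where "Q = \<bar>R\<bar> + norm b"
  obtain K where K: "K-lipschitz_on (cball 0 (Q + norm b)) w" using lip by blast
  have K0: "K \<ge> 0" using K by (rule lipschitz_on_nonneg)
  have contw: "continuous_on UNIV w"
  proof -
    have "continuous_on (ball 0 r) w" for r
      using lip[of r] lipschitz_on_continuous_on continuous_on_subset ball_subset_cball by blast
    then have "continuous (at x) w" for x
      using continuous_on_interior[of "ball 0 (norm x + 1)" w x] by simp
    then show ?thesis by (simp add: continuous_at_imp_continuous_on)
  qed
  then have wm [measurable]: "w \<in> borel_measurable borel"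
    by (rule borel_measurable_continuous_onI)
  have wi: "integrable lborel w"
  proof -
    have "integrable lborel (\<lambda>x. indicator (cball 0 \<bar>R\<bar>) x *\<^sub>R w x)"
      by (rule borel_integrable_compact) (use contw continuous_on_subset in auto)
    moreover have "(\<lambda>x. indicator (cball 0 \<bar>R\<bar>) x *\<^sub>R w x) = w"
      using supp by (auto simp: fun_eq_iff indicator_def not_le)
    ultimately show ?thesis by simp
  qed
  define s where "s n x = real (Suc n) * (w (x + (1 / real (Suc n)) *\<^sub>R b) - w x)" for n x
  have s_int: "integral\<^sup>L lborel (s n) = 0" for n
  proof -
    have "integrable lborel (\<lambda>x. w ((1 / real (Suc n)) *\<^sub>R b + 1 *\<^sub>R x))"
      using integrable_distr[of "(+) ((1 / real (Suc n)) *\<^sub>R b)" lborel borel w] wi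
      by (simp add: lborel_distr_plus)
    then have "integrable lborel (\<lambda>x. w (x + (1 / real (Suc n)) *\<^sub>R b))"
      by (simp add: add.commute)
    then show ?thesis unfolding s_def
      using wi lborel_integral_translate[OF wm, of "(1 / real (Suc n)) *\<^sub>R b"]
      by simp
  qed
  have bound: "norm (s n x) \<le> indicator (cball 0 Q) x *\<^sub>R (K * norm b)" for n x
  proof -
    have small: "norm ((1 / real (Suc n)) *\<^sub>R b) \<le> norm b"
      by (simp add: divide_le_eq mult_le_cancel_left1)
    show ?thesis
    proof (cases "norm x \<le> Q")
      case True
      have "norm (x + (1 / real (Suc n)) *\<^sub>R b) \<le> Q + norm b"
        using True small norm_triangle_le by (meson add_mono order_trans norm_triangle_ineq)
      moreover have "norm x \<le> Q + norm b" using True by (simp add: add_increasing2)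
      ultimately have "dist (w (x + (1 / real (Suc n)) *\<^sub>R b)) (w x) \<le>
          K * dist (x + (1 / real (Suc n)) *\<^sub>R b) x"
        by (intro lipschitz_onD[OF K]) auto
      also have "\<dots> = K * norm b / real (Suc n)"
        by (simp add: dist_norm)
      finally have "\<bar>w (x + (1 / real (Suc n)) *\<^sub>R b) - w x\<bar> \<le> K * norm b / real (Suc n)"
        by (simp add: dist_norm)
      then have "real (Suc n) * \<bar>w (x + (1 / real (Suc n)) *\<^sub>R b) - w x\<bar> \<le> K * norm b"
        by (simp add: pos_le_divide_eq mult.commute del: of_nat_Suc)
      then show ?thesis using True by (simp add: s_def abs_mult)
    next
      case False
      have "norm x \<le> norm (x + (1 / real (Suc n)) *\<^sub>R b) + norm ((1 / real (Suc n)) *\<^sub>R b)"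
        by (metis add_diff_cancel norm_triangle_ineq4)
      then have "norm (x + (1 / real (Suc n)) *\<^sub>R b) > R" "norm x > R"
        using False small norm_ge_zero[of b] abs_ge_self[of R] unfolding Q_def by linarith+
      then have "s n x = 0" using supp unfolding s_def by simp
      then show ?thesis using False by simp
    qed
  qed
  have lim: "AE x in lborel. (\<lambda>n. s n x) \<longlonglongrightarrow> g x"
    using der
  proof eventually_elim
    fix x assume "((\<lambda>t. w (x + t *\<^sub>R b)) has_real_derivative g x) (at 0)"
    then have "((\<lambda>h. (w (x + h *\<^sub>R b) - w x) / h) \<longlongrightarrow> g x) (at 0)"
      by (simp add: DERIV_def)
    moreover have "filterlim (\<lambda>n. 1 / real (Suc n)) (at 0) sequentially"
      by (intro filterlim_atI LIMSEQ_Suc[OF lim_1_over_n]) auto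
    ultimately have "(\<lambda>n. (w (x + (1 / real (Suc n)) *\<^sub>R b) - w x) / (1 / real (Suc n))) \<longlonglongrightarrow> g x"
      by (rule filterlim_compose)
    then show "(\<lambda>n. s n x) \<longlonglongrightarrow> g x" by (simp add: s_def mult.commute del: of_nat_Suc)
  qed
  have dom: "integrable lborel (\<lambda>x::'a. indicator (cball 0 Q) x *\<^sub>R (K * norm b))"
    by (rule borel_integrable_compact) auto
  have sm: "s n \<in> borel_measurable lborel" for n
    unfolding s_def by measurable
  have gm: "g \<in> borel_measurable lborel" using meas by simp
  have ae: "\<And>n. AE x in lborel. norm (s n x) \<le> indicator (cball 0 Q) x *\<^sub>R (K * norm b)"
    using bound by simp
  show "integrable lborel g"
    by (rule integrable_dominated_convergence[OF gm sm dom lim ae])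
  have "(\<lambda>n. integral\<^sup>L lborel (s n)) \<longlonglongrightarrow> integral\<^sup>L lborel g"
    by (rule integral_dominated_convergence[OF gm sm dom lim ae])
  then show "integral\<^sup>L lborel g = 0"
    unfolding s_int using LIMSEQ_unique tendsto_const by blast
qed

lemma GDERIV_directional:
  assumes "GDERIV w x :> d"
  shows "((\<lambda>t. w (x + t *\<^sub>R b)) has_real_derivative (d \<bullet> b)) (at 0)"
proof -
  have "(w has_derivative (\<lambda>h. h \<bullet> d)) (at (x + 0 *\<^sub>R b))"
    using assms by (simp add: gderiv_def)
  moreover have "((\<lambda>t. x + t *\<^sub>R b) has_derivative (\<lambda>t. t *\<^sub>R b)) (at (0::real))"
    by (auto intro!: derivative_eq_intros)
  ultimately have "((\<lambda>t. w (x + t *\<^sub>R b)) has_derivative (\<lambda>t. (t *\<^sub>R b) \<bullet> d)) (at 0)"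
    by (rule has_derivative_compose[rotated])
  then show ?thesis
    by (simp add: has_field_derivative_def inner_commute mult_commute_abs)
qed

lemma locally_lipschitz_of_continuous_GDERIV:
  fixes w :: "'a::euclidean_space \<Rightarrow> real"
  assumes "\<And>x. GDERIV w x :> d x" "continuous_on UNIV d"
  shows "\<exists>K. K-lipschitz_on (cball 0 r) w"
proof -
  have "compact (d ` cball 0 r)"
    by (rule compact_continuous_image[OF continuous_on_subset[OF assms(2)]]) auto
  then obtain B where B: "\<And>x. x \<in> cball 0 r \<Longrightarrow> norm (d x) \<le> B"
    by (meson compact_imp_bounded bounded_iff image_eqI)
  have "\<bar>B\<bar>-lipschitz_on (cball 0 r) w"
  proof (rule lipschitz_onI)
    fix x y :: 'a assume xy: "x \<in> cball 0 r" "y \<in> cball 0 r"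
    have "norm (w x - w y) \<le> \<bar>B\<bar> * norm (x - y)"
    proof (rule differentiable_bound[OF convex_cball _ _ xy])
      fix z :: 'a assume z: "z \<in> cball 0 r"
      show "(w has_derivative (\<lambda>h. h \<bullet> d z)) (at z within cball 0 r)"
        using assms(1)[of z] unfolding gderiv_def by (rule has_derivative_at_withinI)
      show "onorm (\<lambda>h. h \<bullet> d z) \<le> \<bar>B\<bar>"
      proof (rule onorm_bound)
        fix h
        have "\<bar>h \<bullet> d z\<bar> \<le> norm h * norm (d z)" by (rule Cauchy_Schwarz_ineq2)
        also have "\<dots> \<le> norm h * \<bar>B\<bar>" using B[OF z] by (intro mult_left_mono) auto
        finally show "norm (h \<bullet> d z) \<le> \<bar>B\<bar> * norm h" by (simp add: mult.commute)
      qed simp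
    qed
    then show "dist (w x) (w y) \<le> \<bar>B\<bar> * dist x y" by (simp add: dist_norm)
  qed simp
  then show ?thesis by blast
qed

lemma test_functionsD:
  assumes "\<phi> \<in> test_functions S"
  shows "Ck k \<phi>" "compact (closure {x. \<phi> x \<noteq> 0})" "closure {x. \<phi> x \<noteq> 0} \<subseteq> S"
  using assms by (auto simp: test_functions_def)

lemma test_functionsI:
  assumes "\<And>k. Ck k \<phi>" "compact K" "K \<subseteq> S" "\<And>x. x \<notin> K \<Longrightarrow> \<phi> x = 0"
  shows "\<phi> \<in> test_functions S"
proof -
  have sub: "closure {x. \<phi> x \<noteq> 0} \<subseteq> K"
    using assms by (intro closure_minimal compact_imp_closed) auto
  then have "compact (closure {x. \<phi> x \<noteq> 0})"
    using compact_Int_closed[OF assms(2) closed_closure, of "{x. \<phi> x \<noteq> 0}"] by (simp add: Int_absorb1)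
  with sub show ?thesis
    using assms(1,3) unfolding test_functions_def by auto
qed

lemma test_functions_GDERIV:
  assumes "\<phi> \<in> test_functions S"
  shows "GDERIV \<phi> x :> classical_grad \<phi> x" "continuous_on UNIV \<phi>" "continuous_on UNIV (classical_grad \<phi>)"
  using Ck_GDERIV[OF test_functionsD(1)[OF assms, of "Suc 0"]]
    Ck_continuous_grad[OF test_functionsD(1)[OF assms, of "Suc 0"]]
    Ck_imp_continuous[OF test_functionsD(1)[OF assms]] by auto

lemma test_functions_outside:
  assumes \<phi>: "\<phi> \<in> test_functions S" and x: "x \<notin> closure {x. \<phi> x \<noteq> 0}"
  shows "\<phi> x = 0" "classical_grad \<phi> x = 0"
proof -
  show "\<phi> x = 0" using x closure_subset[of "{x. \<phi> x \<noteq> 0}"] by auto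
  have "((\<lambda>x. 0) has_derivative (\<lambda>h. 0)) (at x)" by simp
  then have "(\<phi> has_derivative (\<lambda>h. 0)) (at x)"
  proof (rule has_derivative_transform_within_open)
    show "open (- closure {x. \<phi> x \<noteq> 0})" by (simp add: open_Compl)
    show "\<And>y. y \<in> - closure {x. \<phi> x \<noteq> 0} \<Longrightarrow> 0 = \<phi> y"
      using closure_subset[of "{x. \<phi> x \<noteq> 0}"] by auto
  qed (use x in auto)
  then have "GDERIV \<phi> x :> 0" by (simp add: gderiv_def)
  then show "classical_grad \<phi> x = 0" by (rule classical_grad_eq)
qed

lemma test_functions_add:
  assumes \<phi>: "\<phi> \<in> test_functions S" and \<psi>: "\<psi> \<in> test_functions S"
  shows "(\<lambda>x. \<phi> x + \<psi> x) \<in> test_functions S"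
proof (rule test_functionsI[where K = "closure {x. \<phi> x \<noteq> 0} \<union> closure {x. \<psi> x \<noteq> 0}"])
  show "Ck k (\<lambda>x. \<phi> x + \<psi> x)" for k
    by (rule Ck_add[OF test_functionsD(1)[OF \<phi>] test_functionsD(1)[OF \<psi>]])
  show "compact (closure {x. \<phi> x \<noteq> 0} \<union> closure {x. \<psi> x \<noteq> 0})"
    by (rule compact_Un[OF test_functionsD(2)[OF \<phi>] test_functionsD(2)[OF \<psi>]])
  show "closure {x. \<phi> x \<noteq> 0} \<union> closure {x. \<psi> x \<noteq> 0} \<subseteq> S"
    by (rule Un_least[OF test_functionsD(3)[OF \<phi>] test_functionsD(3)[OF \<psi>]])
  show "\<phi> x + \<psi> x = 0" if "x \<notin> closure {x. \<phi> x \<noteq> 0} \<union> closure {x. \<psi> x \<noteq> 0}" for x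
  proof -
    have "\<phi> x = 0" by (rule test_functions_outside(1)[OF \<phi>]) (use that in blast)
    moreover have "\<psi> x = 0" by (rule test_functions_outside(1)[OF \<psi>]) (use that in blast)
    ultimately show ?thesis by (simp only: add_0)
  qed
qed

lemma test_functions_mult:
  assumes \<phi>: "\<phi> \<in> test_functions S" and \<psi>: "\<And>k. Ck k \<psi>"
  shows "(\<lambda>x. \<psi> x * \<phi> x) \<in> test_functions S"
proof (rule test_functionsI[where K = "closure {x. \<phi> x \<noteq> 0}"])
  show "Ck k (\<lambda>x. \<psi> x * \<phi> x)" for k by (rule Ck_mult[OF \<psi> test_functionsD(1)[OF \<phi>]])
  show "\<psi> x * \<phi> x = 0" if "x \<notin> closure {x. \<phi> x \<noteq> 0}" for x
    by (simp only: test_functions_outside(1)[OF \<phi> that] mult_zero_right)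
qed (rule test_functionsD(2,3)[OF \<phi>])+

lemma test_functions_cmult: "\<phi> \<in> test_functions S \<Longrightarrow> (\<lambda>x. c * \<phi> x) \<in> test_functions S"
  using test_functions_mult[of \<phi> S "\<lambda>x. c"] Ck_const by auto

lemma test_functions_zero: "(\<lambda>x. 0) \<in> test_functions S"
  by (rule test_functionsI[where K = "{}"]) (auto intro: Ck_const)

lemma integral_lebesgue_on_supported:
  fixes f :: "'a::euclidean_space \<Rightarrow> 'b::euclidean_space"
  assumes "continuous_on UNIV f" "S \<in> sets lebesgue" "\<And>x. x \<notin> S \<Longrightarrow> f x = 0"
  shows "integral\<^sup>L (lebesgue_on S) f = integral\<^sup>L lborel f"
proof -
  have "f \<in> borel_measurable borel" by (rule borel_measurable_continuous_onI[OF assms(1)])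
  then have "integral\<^sup>L lborel f = integral\<^sup>L lebesgue f" by (simp add: integral_completion)
  also have "\<dots> = integral\<^sup>L lebesgue (\<lambda>x. indicator S x *\<^sub>R f x)"
    by (rule Bochner_Integration.integral_cong) (use assms in \<open>auto simp: indicator_def\<close>)
  also have "\<dots> = integral\<^sup>L (lebesgue_on S) f"
    by (subst integral_restrict_space) (use assms in auto)
  finally show ?thesis by simp
qed

lemma integrable_compact_support:
  fixes f :: "'a::euclidean_space \<Rightarrow> 'b::euclidean_space"
  assumes "continuous_on UNIV f" "compact K" "\<And>x. x \<notin> K \<Longrightarrow> f x = 0"
  shows "integrable lborel f"
proof -
  have "integrable lborel (\<lambda>x. indicator K x *\<^sub>R f x)"
    by (rule borel_integrable_compact[OF assms(2) continuous_on_subset[OF assms(1)]]) simp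
  moreover have "(\<lambda>x. indicator K x *\<^sub>R f x) = f"
    using assms(3) by (auto simp: fun_eq_iff indicator_def)
  ultimately show ?thesis by simp
qed

lemma integral_gradient_component_eq_0:
  fixes w :: "'a::euclidean_space \<Rightarrow> real"
  assumes w: "\<And>x. GDERIV w x :> d x" and d: "continuous_on UNIV d"
    and K: "compact K" "\<And>x. x \<notin> K \<Longrightarrow> w x = 0"
  shows "integrable lborel (\<lambda>x. d x \<bullet> b)" "(LINT x|lborel. d x \<bullet> b) = 0"
proof -
  obtain R where R: "\<And>x. x \<in> K \<Longrightarrow> norm x \<le> R"
    using compact_imp_bounded[OF K(1)] by (auto simp: bounded_iff)
  have lip: "\<exists>K. K-lipschitz_on (cball 0 r) w" for r
    by (rule locally_lipschitz_of_continuous_GDERIV[OF w d])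
  have out: "w x = 0" if "norm x > R" for x
    using R[of x] K(2)[of x] that by force
  have der: "AE x in lborel. ((\<lambda>t. w (x + t *\<^sub>R b)) has_real_derivative d x \<bullet> b) (at 0)"
    using GDERIV_directional[OF w] by simp
  have "continuous_on UNIV (\<lambda>x. d x \<bullet> b)" by (intro continuous_intros d)
  then have m: "(\<lambda>x. d x \<bullet> b) \<in> borel_measurable borel" by (rule borel_measurable_continuous_onI)
  show "integrable lborel (\<lambda>x. d x \<bullet> b)" "(LINT x|lborel. d x \<bullet> b) = 0"
    by (rule integral_directional_derivative_eq_0[OF lip out der m]; simp)+
qed

text \<open>
  The product of \<open>v\<close> with a test function has compact support, so its gradient integrates to \<open>0\<close>; this
  is integration by parts.
\<close>

lemma has_weak_grad_of_continuous_GDERIV: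
  fixes v :: "'a::euclidean_space \<Rightarrow> real"
  assumes S: "S \<in> sets lebesgue"
    and v: "\<And>x. GDERIV v x :> g x" and g: "continuous_on UNIV g"
  shows "has_weak_grad S v g"
  unfolding has_weak_grad_def
proof
  fix \<phi> assume \<phi>: "\<phi> \<in> test_functions S"
  define K where "K = closure {x. \<phi> x \<noteq> 0}"
  have K: "compact K" "K \<subseteq> S" using test_functionsD[OF \<phi>] by (auto simp: K_def)
  have out: "\<phi> x = 0" "classical_grad \<phi> x = 0" if "x \<notin> K" for x
    by (rule test_functions_outside[OF \<phi> that[unfolded K_def]])+
  note \<phi>c = test_functions_GDERIV[OF \<phi>]
  have vc: "continuous_on UNIV v"
    by (rule GDERIV_imp_continuous_on[OF v])
  define h where "h x = v x *\<^sub>R classical_grad \<phi> x + \<phi> x *\<^sub>R g x" for x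
  have hc: "continuous_on UNIV h" unfolding h_def by (intro continuous_intros vc \<phi>c g)
  have hd: "GDERIV (\<lambda>x. v x * \<phi> x) x :> h x" for x
    unfolding h_def by (rule GDERIV_mult[OF v \<phi>c(1)])
  have c1: "continuous_on UNIV (\<lambda>x. v x *\<^sub>R classical_grad \<phi> x)" "continuous_on UNIV (\<lambda>x. \<phi> x *\<^sub>R g x)"
    by (intro continuous_intros vc \<phi>c g)+
  have "integrable lborel (\<lambda>x. v x *\<^sub>R classical_grad \<phi> x)"
    by (rule integrable_compact_support[OF c1(1) K(1)]) (simp add: out)
  moreover have "integrable lborel (\<lambda>x. \<phi> x *\<^sub>R g x)"
    by (rule integrable_compact_support[OF c1(2) K(1)]) (simp add: out)
  ultimately have i1: "integrable lborel (\<lambda>x. v x *\<^sub>R classical_grad \<phi> x)"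
    "integrable lborel (\<lambda>x. \<phi> x *\<^sub>R g x)" by blast+
  have "integral\<^sup>L lborel h = 0"
  proof (rule euclidean_eqI)
    fix b :: 'a assume "b \<in> Basis"
    have "integral\<^sup>L lborel (\<lambda>x. h x \<bullet> b) = 0"
      by (rule integral_gradient_component_eq_0(2)[OF hd hc K(1)]) (simp add: out)
    moreover have "integrable lborel h" unfolding h_def using i1 by simp
    ultimately show "integral\<^sup>L lborel h \<bullet> b = 0 \<bullet> b" by simp
  qed
  then have "integral\<^sup>L lborel (\<lambda>x. v x *\<^sub>R classical_grad \<phi> x) = - integral\<^sup>L lborel (\<lambda>x. \<phi> x *\<^sub>R g x)"
    unfolding h_def using i1 by (simp add: add_eq_0_iff2)
  then show "(LINT x|lebesgue_on S. v x *\<^sub>R classical_grad \<phi> x) = - (LINT x|lebesgue_on S. \<phi> x *\<^sub>R g x)"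
    using K(2) out integral_lebesgue_on_supported[OF c1(1) S] integral_lebesgue_on_supported[OF c1(2) S]
    by (metis (no_types, lifting) scaleR_zero_left scaleR_zero_right subsetD)
qed

section \<open>The fundamental lemma of the calculus of variations\<close>

text \<open>
  Boxes form an intersection-stable generator of the Borel sets, so \<open>h\<close> integrates to \<open>0\<close> over every
  Borel set. The set where \<open>h > 0\<close> is Borel up to a null set.
\<close>

lemma AE_nonpos_of_box_integrals_eq_0:
  fixes h :: "'a::euclidean_space \<Rightarrow> real"
  assumes h: "integrable lebesgue h"
    and box: "\<And>a b. (LINT x|lebesgue. indicator (box a b) x * h x) = 0"
  shows "AE x in lebesgue. h x \<le> 0"
proof -
  have hi: "integrable lebesgue (\<lambda>x. indicator A x * h x)" if "A \<in> sets lebesgue" for A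
    using integrable_mult_indicator[OF that h] by simp
  have total: "integral\<^sup>L lebesgue h = 0"
  proof -
    have "(\<lambda>n. LINT x|lebesgue. indicator (box (- (real n *\<^sub>R One)) (real n *\<^sub>R One)) x * h x) \<longlonglongrightarrow> integral\<^sup>L lebesgue h"
    proof (rule integral_dominated_convergence[where w = "\<lambda>x. norm (h x)"])
      show "AE x in lebesgue. (\<lambda>n. indicator (box (- (real n *\<^sub>R One)) (real n *\<^sub>R One)) x * h x) \<longlonglongrightarrow> h x"
      proof (rule AE_I2, rule tendsto_eventually)
        fix x :: 'a
        obtain N :: nat where N: "norm x < real N" using reals_Archimedean2 by blast
        show "\<forall>\<^sub>F n in sequentially. indicator (box (- (real n *\<^sub>R One)) (real n *\<^sub>R One)) x * h x = h x"
          using eventually_ge_at_top[of N]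
        proof eventually_elim
          fix n assume "N \<le> n"
          have "- real n < x \<bullet> i \<and> x \<bullet> i < real n" if "i \<in> Basis" for i
            using Basis_le_norm[OF that, of x] N \<open>N \<le> n\<close> by (simp add: abs_le_iff)
          then have "x \<in> box (- (real n *\<^sub>R One)) (real n *\<^sub>R One)" by (simp add: mem_box)
          then show "indicator (box (- (real n *\<^sub>R One)) (real n *\<^sub>R One)) x * h x = h x" by simp
        qed
      qed
    next
      show "(\<lambda>x. indicator (box (- (real n *\<^sub>R One)) (real n *\<^sub>R One)) x * h x) \<in> borel_measurable lebesgue" for n
        by (rule borel_measurable_integrable[OF hi]) (simp add: sets_completionI_sets)
    qed (use h in \<open>auto simp: indicator_def\<close>)
    then show ?thesis unfolding box using LIMSEQ_unique tendsto_const by blast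
  qed
  have bor: "(LINT x|lebesgue. indicator A x * h x) = 0" if A: "A \<in> sets borel" for A
  proof -
    have "Int_stable (range (\<lambda>(a, b). box a b :: 'a set))"
      by (auto simp: Int_stable_def box_Int_box)
    moreover have "range (\<lambda>(a, b). box a b :: 'a set) \<subseteq> Pow UNIV" by auto
    moreover have "A \<in> sigma_sets UNIV (range (\<lambda>(a, b). box a b))"
      using A unfolding borel_eq_box by simp
    ultimately show ?thesis
    proof (induction rule: sigma_sets_induct_disjoint)
      case (basic A)
      then show ?case using box by auto
    next
      case empty
      then show ?case by simp
    next
      case (compl A)
      then have "A \<in> sets borel" by (simp add: borel_eq_box)
      then have A: "A \<in> sets lebesgue" by (simp add: sets_completionI_sets)
      have "(LINT x|lebesgue. indicator (UNIV - A) x * h x) = (LINT x|lebesgue. h x - indicator A x * h x)"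
        by (rule Bochner_Integration.integral_cong) (auto simp: indicator_def)
      also have "\<dots> = integral\<^sup>L lebesgue h - (LINT x|lebesgue. indicator A x * h x)"
        by (rule Bochner_Integration.integral_diff[OF h hi[OF A]])
      finally show ?case using total compl by simp
    next
      case (union F)
      then have "F i \<in> sets borel" for i by (auto simp: borel_eq_box)
      then have F: "F i \<in> sets lebesgue" for i by (simp add: sets_completionI_sets)
      have "(LINT x:(\<Union>i. F i)|lebesgue. h x) = (\<Sum>i. LINT x:F i|lebesgue. h x)"
        using union(1) F hi[of "\<Union>i. F i"]
        by (intro lebesgue_integral_countable_add) (auto simp: disjoint_family_on_def set_integrable_def)
      then show ?case using union.IH by (simp add: set_lebesgue_integral_def)
    qed
  qed
  have hm: "h \<in> borel_measurable lebesgue" using h by simp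
  define A where "A = {x. h x > 0}"
  have A: "A \<in> sets lebesgue" unfolding A_def using hm by (simp add: borel_measurable_iff_greater)
  obtain B N N' where B: "A = B \<union> N" "N \<subseteq> N'" "N' \<in> null_sets lborel" "B \<in> sets lborel"
    by (rule sets_completionE[OF A])
  have "(LINT x|lebesgue. indicator A x * h x) = (LINT x|lebesgue. indicator B x * h x)"
  proof (rule integral_cong_AE)
    have "AE x in lebesgue. x \<notin> N'"
      using B(3) by (intro AE_not_in null_sets_completionI)
    then show "AE x in lebesgue. indicator A x * h x = indicator B x * h x"
      by eventually_elim (use B in \<open>auto simp: indicator_def\<close>)
  qed (use hi[OF A] hi[of B] B in \<open>auto simp: sets_completionI_sets\<close>)
  then have "(LINT x|lebesgue. indicator A x * h x) = 0" using bor B by simp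
  then have "AE x in lebesgue. indicator A x * h x = 0"
    by (subst (asm) integral_nonneg_eq_0_iff_AE[OF hi[OF A]]) (auto simp: A_def indicator_def)
  then show ?thesis by eventually_elim (auto simp: A_def indicator_def split: if_splits)
qed

lemma AE_eq_0_of_box_integrals_eq_0:
  fixes h :: "'a::euclidean_space \<Rightarrow> real"
  assumes h: "integrable lebesgue h"
    and box: "\<And>a b. (LINT x|lebesgue. indicator (box a b) x * h x) = 0"
  shows "AE x in lebesgue. h x = 0"
proof -
  have "AE x in lebesgue. h x \<le> 0" by (rule AE_nonpos_of_box_integrals_eq_0[OF assms])
  moreover have "AE x in lebesgue. - h x \<le> 0"
    by (rule AE_nonpos_of_box_integrals_eq_0) (use h box in auto)
  ultimately show ?thesis by eventually_elim simp
qed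

text \<open>
  A smooth function that is positive exactly on the box and tends to its indicator as \<open>\<epsilon> \<rightarrow> 0\<close>.
\<close>

definition box_bump :: "real \<Rightarrow> 'a::euclidean_space \<Rightarrow> 'a \<Rightarrow> 'a \<Rightarrow> real" where
  "box_bump \<epsilon> a b x = (\<Prod>i\<in>Basis. flat \<epsilon> 0 (x \<bullet> i - a \<bullet> i) * flat \<epsilon> 0 (b \<bullet> i - x \<bullet> i))"

lemma flat_0_le_1: "\<epsilon> > 0 \<Longrightarrow> flat \<epsilon> 0 z \<le> 1"
  by (simp add: flat_def)

lemma box_bump_eq_0: "x \<notin> box a b \<Longrightarrow> box_bump \<epsilon> a b x = 0"
  by (auto simp: box_bump_def mem_box flat_def)

lemma box_bump_bounds:
  assumes "\<epsilon> > 0"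
  shows "0 \<le> box_bump \<epsilon> a b x" "box_bump \<epsilon> a b x \<le> 1"
  unfolding box_bump_def using assms
  by (auto intro!: prod_nonneg prod_le_1 mult_le_one simp: flat_nonneg flat_0_le_1)

lemma box_bump_test_function:
  assumes "\<epsilon> > 0" "cbox a b \<subseteq> S"
  shows "box_bump \<epsilon> a b \<in> test_functions S"
proof (rule test_functionsI[where K = "cbox a b"])
  fix k
  have "Ck k (\<lambda>x::'a. flat \<epsilon> 0 (x \<bullet> i - a \<bullet> i))" "Ck k (\<lambda>x::'a. flat \<epsilon> 0 (b \<bullet> i - x \<bullet> i))" for i
    by (rule Ck_compose[OF Ck_flat[OF assms(1)]],
        rule Ck_diff[OF Ck_bounded_linear[OF bounded_linear_inner_left] Ck_const]
             Ck_diff[OF Ck_const Ck_bounded_linear[OF bounded_linear_inner_left]])+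
  then show "Ck k (box_bump \<epsilon> a b)"
    unfolding box_bump_def[abs_def] by (intro Ck_prod Ck_mult)
next
  fix x assume "x \<notin> cbox a b"
  then have "x \<notin> box a b" using box_subset_cbox by blast
  then show "box_bump \<epsilon> a b x = 0" by (rule box_bump_eq_0)
qed (use assms in auto)

lemma box_bump_tendsto: "(\<lambda>n. box_bump (1 / real (Suc n)) a b x) \<longlonglongrightarrow> indicator (box a b) x"
proof (cases "x \<in> box a b")
  case True
  have fl: "(\<lambda>n. flat (1 / real (Suc n)) 0 z) \<longlonglongrightarrow> 1" if "z > 0" for z
  proof -
    have "(\<lambda>n. exp (- (1 / real (Suc n)) / z)) \<longlonglongrightarrow> exp (- 0 / z)"
      by (intro tendsto_intros LIMSEQ_Suc[OF lim_1_over_n]) (use that in auto)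
    then show ?thesis using that by (simp add: flat_def)
  qed
  have "(\<lambda>n. box_bump (1 / real (Suc n)) a b x) \<longlonglongrightarrow> (\<Prod>i\<in>(Basis::'a set). 1 * 1)"
    unfolding box_bump_def using True
    by (intro tendsto_prod tendsto_mult fl) (auto simp: mem_box)
  then show ?thesis using True by simp
qed (simp add: box_bump_eq_0)

text \<open>
  Bumps approximate the indicator of each box whose closure lies in \<open>S\<close>, so \<open>g\<close> has integral \<open>0\<close> over all
  these boxes. Since boxes intersect in boxes, this determines \<open>g\<close> on each of them, and countably many of
  them cover \<open>S\<close>.
\<close>

lemma fundamental_lemma_calculus_of_variations:
  fixes g :: "'a::euclidean_space \<Rightarrow> real"
  assumes S: "open S" and g: "integrable (lebesgue_on S) g"
    and z: "\<And>\<phi>. \<phi> \<in> test_functions S \<Longrightarrow> (LINT x|lebesgue_on S. \<phi> x * g x) = 0"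
  shows "AE x in lebesgue_on S. g x = 0"
proof -
  have Sm: "S \<in> sets lebesgue" using S by (simp add: sets_completionI_sets)
  define G where "G x = indicator S x * g x" for x
  have G: "integrable lebesgue G"
    unfolding G_def using g Sm by (simp add: integrable_restrict_space)
  have box0: "(LINT x|lebesgue. indicator (box a b) x * G x) = 0" if ab: "cbox a b \<subseteq> S" for a b
  proof -
    have lim: "(\<lambda>n. LINT x|lebesgue. box_bump (1 / real (Suc n)) a b x * G x) \<longlonglongrightarrow>
        (LINT x|lebesgue. indicator (box a b) x * G x)"
    proof (rule integral_dominated_convergence[where w = "\<lambda>x. norm (G x)"])
      show "AE x in lebesgue. (\<lambda>n. box_bump (1 / real (Suc n)) a b x * G x) \<longlonglongrightarrow> indicator (box a b) x * G x"
        by (intro AE_I2 tendsto_mult box_bump_tendsto tendsto_const)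
      show "(\<lambda>x. box_bump (1 / real (Suc n)) a b x * G x) \<in> borel_measurable lebesgue" for n
      proof -
        have "continuous_on UNIV (box_bump (1 / real (Suc n)) a b)"
          by (rule test_functions_GDERIV(2)[OF box_bump_test_function[OF _ ab]]) simp
        then have "box_bump (1 / real (Suc n)) a b \<in> borel_measurable borel"
          by (rule borel_measurable_continuous_onI)
        then have "box_bump (1 / real (Suc n)) a b \<in> borel_measurable lebesgue"
          by (simp add: measurable_completion)
        then show ?thesis using G by measurable
      qed
      show "AE x in lebesgue. norm (box_bump (1 / real (Suc n)) a b x * G x) \<le> norm (G x)" for n
        using box_bump_bounds[of "1 / real (Suc n)" a b]
        by (intro AE_I2) (simp add: abs_mult mult_left_le_one_le del: of_nat_Suc)
    qed (use G in \<open>auto intro!: borel_measurable_times borel_measurable_indicator simp: sets_completionI_sets\<close>)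
    have zero: "(LINT x|lebesgue. box_bump (1 / real (Suc n)) a b x * G x) = 0" for n
    proof -
      have "(LINT x|lebesgue. box_bump (1 / real (Suc n)) a b x * G x) =
          (LINT x|lebesgue_on S. box_bump (1 / real (Suc n)) a b x * g x)"
        using Sm by (subst integral_restrict_space) (auto simp: G_def ac_simps)
      then show ?thesis using z[OF box_bump_test_function[OF _ ab]] by simp
    qed
    show ?thesis by (rule LIMSEQ_unique[OF lim]) (simp add: zero del: of_nat_Suc)
  qed
  have loc: "AE x in lebesgue. x \<in> box c d \<longrightarrow> G x = 0" if cd: "cbox c d \<subseteq> S" for c d
  proof -
    have "AE x in lebesgue. indicator (box c d) x * G x = 0"
    proof (rule AE_eq_0_of_box_integrals_eq_0)
      show "integrable lebesgue (\<lambda>x. indicator (box c d) x * G x)"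
        using integrable_mult_indicator[OF _ G, of "box c d"] by (simp add: sets_completionI_sets)
      fix a b :: 'a
      define a' b' where "a' = (\<Sum>i\<in>Basis. max (a \<bullet> i) (c \<bullet> i) *\<^sub>R i)" and
        "b' = (\<Sum>i\<in>Basis. min (b \<bullet> i) (d \<bullet> i) *\<^sub>R i)"
      have int: "box a b \<inter> box c d = box a' b'"
        unfolding a'_def b'_def by (rule box_Int_box)
      have "cbox a' b' \<subseteq> cbox c d"
        unfolding a'_def b'_def by (auto simp: mem_box)
      then have "(LINT x|lebesgue. indicator (box a' b') x * G x) = 0"
        by (intro box0 order_trans[OF _ cd])
      then show "(LINT x|lebesgue. indicator (box a b) x * (indicator (box c d) x * G x)) = 0"
        unfolding int[symmetric] by (simp add: indicator_inter_arith ac_simps)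
    qed
    then show ?thesis by eventually_elim (auto simp: indicator_def)
  qed
  obtain \<D> where \<D>: "countable \<D>" "\<D> \<subseteq> Pow S" "\<And>X. X \<in> \<D> \<Longrightarrow> \<exists>a b. X = cbox a b" "\<Union>\<D> = S"
    using open_countable_Union_open_cbox[OF S] by metis
  have "AE x in lebesgue. G x = 0"
  proof -
    have "AE x in lebesgue. \<forall>X\<in>\<D>. x \<in> X \<longrightarrow> G x = 0"
    proof (rule AE_ball_countable[THEN iffD2, OF \<D>(1)], rule ballI)
      fix X assume X: "X \<in> \<D>"
      then obtain c d where cd: "X = cbox c d" using \<D>(3) by blast
      have "AE x in lebesgue. x \<notin> cbox c d - box c d"
        using negligible_frontier_interval[of c d] by (intro AE_not_in) (simp add: negligible_iff_null_sets)
      moreover have "AE x in lebesgue. x \<in> box c d \<longrightarrow> G x = 0"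
        using X \<D>(2) cd by (intro loc) auto
      ultimately show "AE x in lebesgue. x \<in> X \<longrightarrow> G x = 0"
        unfolding cd by eventually_elim auto
    qed
    then show ?thesis
      by eventually_elim (use \<D>(4) in \<open>auto simp: G_def indicator_def\<close>)
  qed
  then show ?thesis
    using Sm by (subst AE_restrict_space_iff) (auto simp: G_def indicator_def elim!: eventually_mono)
qed

section \<open>Square-integrable functions on bounded domains\<close>

lemma integrable_const_lebesgue_on:
  fixes S :: "'a::euclidean_space set"
  assumes "open S" "bounded S"
  shows "integrable (lebesgue_on S) (\<lambda>x. c :: real)"
proof -
  have "S \<in> lmeasurable" using assms by (rule lmeasurable_open[rotated])
  then have "finite_measure (lebesgue_on S)" by (rule finite_measure_lebesgue_on)
  then show ?thesis by (rule finite_measure.integrable_const)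
qed

lemma L2_imp_integrable:
  assumes "open S" "bounded S" "f \<in> L2 S"
  shows "integrable (lebesgue_on S) f"
proof (rule Bochner_Integration.integrable_bound)
  show "integrable (lebesgue_on S) (\<lambda>x. 1 + (norm (f x))\<^sup>2)"
    by (intro Bochner_Integration.integrable_add integrable_const_lebesgue_on L2_integrable assms)
  show "AE x in lebesgue_on S. norm (f x) \<le> norm (1 + (norm (f x))\<^sup>2)"
  proof (rule AE_I2)
    fix x
    have "0 \<le> (norm (f x) - 1)\<^sup>2" "0 \<le> norm (f x)" by simp_all
    then have "norm (f x) \<le> 1 + (norm (f x))\<^sup>2"
      unfolding power2_diff one_power2 mult_1_right by linarith
    then show "norm (f x) \<le> norm (1 + (norm (f x))\<^sup>2)" by simp
  qed
qed (rule L2_measurable[OF assms(3)])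

lemma L2_bounded:
  assumes "open S" "bounded S" "f \<in> borel_measurable (lebesgue_on S)" "\<And>x. x \<in> S \<Longrightarrow> norm (f x) \<le> B"
  shows "f \<in> L2 S"
proof (rule L2_dominated[OF assms(3) integrable_const_lebesgue_on[OF assms(1,2), of "B\<^sup>2"]])
  show "AE x in lebesgue_on S. (norm (f x))\<^sup>2 \<le> B\<^sup>2"
    using assms(4) by (intro AE_I2) (simp add: power_mono)
qed

lemma continuous_measurable_lebesgue_on:
  assumes "open S" "continuous_on UNIV f"
  shows "f \<in> borel_measurable (lebesgue_on S)"
  using assms
  by (intro continuous_imp_measurable_on_sets_lebesgue) (auto intro: continuous_on_subset simp: sets_completionI_sets)

lemma continuous_bounded_on_bounded:
  fixes f :: "'a::euclidean_space \<Rightarrow> 'b::real_normed_vector"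
  assumes "bounded S" "continuous_on UNIV f"
  obtains B where "\<And>x. x \<in> S \<Longrightarrow> norm (f x) \<le> B"
proof -
  have "compact (f ` closure S)"
    using assms by (intro compact_continuous_image continuous_on_subset[OF assms(2)]) (auto simp: compact_closure)
  then have "bounded (f ` closure S)" by (rule compact_imp_bounded)
  then obtain B where "\<And>y. y \<in> f ` closure S \<Longrightarrow> norm y \<le> B" unfolding bounded_iff by blast
  then show ?thesis using that closure_subset by blast
qed

lemma continuous_imp_L2:
  assumes "open S" "bounded S" "continuous_on UNIV f"
  shows "f \<in> L2 S"
  using L2_bounded[OF assms(1,2) continuous_measurable_lebesgue_on[OF assms(1,3)]]
    continuous_bounded_on_bounded[OF assms(2,3)] by metis

lemma L2_mult_bounded:
  assumes "f \<in> borel_measurable (lebesgue_on S)" "AE x in lebesgue_on S. \<bar>f x\<bar> \<le> B" "g \<in> L2 S"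
  shows "(\<lambda>x. f x *\<^sub>R g x) \<in> L2 S"
proof (rule L2_dominated)
  show "integrable (lebesgue_on S) (\<lambda>x. B\<^sup>2 * (norm (g x))\<^sup>2)"
    by (intro integrable_mult_right L2_integrable assms)
  show "AE x in lebesgue_on S. (norm (f x *\<^sub>R g x))\<^sup>2 \<le> B\<^sup>2 * (norm (g x))\<^sup>2"
    using assms(2)
  proof eventually_elim
    fix x assume "\<bar>f x\<bar> \<le> B"
    then have "\<bar>f x\<bar>\<^sup>2 \<le> B\<^sup>2" by (intro power_mono) auto
    then show "(norm (f x *\<^sub>R g x))\<^sup>2 \<le> B\<^sup>2 * (norm (g x))\<^sup>2"
      by (simp add: power_mult_distrib mult_right_mono)
  qed
qed (rule borel_measurable_scaleR[OF assms(1) L2_measurable[OF assms(3)]])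

lemma L2_component: "f \<in> L2 S \<Longrightarrow> b \<in> Basis \<Longrightarrow> (\<lambda>x. f x \<bullet> b) \<in> L2 S"
proof (rule L2_dominated[OF _ L2_integrable])
  assume "f \<in> L2 S" "b \<in> Basis"
  then show "AE x in lebesgue_on S. (norm (f x \<bullet> b))\<^sup>2 \<le> (norm (f x))\<^sup>2"
    using Basis_le_norm by (intro AE_I2 power_mono) auto
qed (auto simp: L2_def)

lemma L2_norm_component_le:
  "f \<in> L2 S \<Longrightarrow> b \<in> Basis \<Longrightarrow> L2_norm S (\<lambda>x. f x \<bullet> b) \<le> L2_norm S f"
  by (rule L2_norm_mono) (auto simp: L2_component Basis_le_norm)

lemma L2_scaleR_integrable:
  assumes f: "f \<in> L2 S" and g: "g \<in> L2 S"
  shows "integrable (lebesgue_on S) (\<lambda>x. f x *\<^sub>R g x)"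
proof (rule Bochner_Integration.integrable_bound)
  show "integrable (lebesgue_on S) (\<lambda>x. (norm (f x))\<^sup>2 + (norm (g x))\<^sup>2)"
    by (intro Bochner_Integration.integrable_add L2_integrable f g)
  show "AE x in lebesgue_on S. norm (f x *\<^sub>R g x) \<le> norm ((norm (f x))\<^sup>2 + (norm (g x))\<^sup>2)"
  proof (rule AE_I2)
    fix x
    have "0 \<le> (norm (f x) - norm (g x))\<^sup>2" "0 \<le> norm (f x) * norm (g x)" by simp_all
    then have "norm (f x) * norm (g x) \<le> (norm (f x))\<^sup>2 + (norm (g x))\<^sup>2"
      unfolding power2_diff by linarith
    then show "norm (f x *\<^sub>R g x) \<le> norm ((norm (f x))\<^sup>2 + (norm (g x))\<^sup>2)" by simp
  qed
qed (rule borel_measurable_scaleR[OF L2_measurable[OF f] L2_measurable[OF g]])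

lemma test_functions_L2:
  assumes "open S" "bounded S" "\<phi> \<in> test_functions S"
  shows "\<phi> \<in> L2 S" "classical_grad \<phi> \<in> L2 S"
  by (rule continuous_imp_L2[OF assms(1,2) test_functions_GDERIV(2)[OF assms(3)]],
      rule continuous_imp_L2[OF assms(1,2) test_functions_GDERIV(3)[OF assms(3)]])

section \<open>Weak gradients\<close>

text \<open>
  Written in components, both sides of the defining identity are \<open>L2\<close> inner products; linearity,
  stability under limits and uniqueness of weak gradients follow from this form.
\<close>

lemma has_weak_grad_iff:
  assumes S: "open S" "bounded S" and v: "v \<in> L2 S" and g: "g \<in> L2 S"
  shows "has_weak_grad S v g \<longleftrightarrow> (\<forall>\<phi>\<in>test_functions S. \<forall>b\<in>Basis.
     (LINT x|lebesgue_on S. v x \<bullet> (classical_grad \<phi> x \<bullet> b)) = - (LINT x|lebesgue_on S. (g x \<bullet> b) \<bullet> \<phi> x))"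
proof -
  have "(LINT x|lebesgue_on S. v x *\<^sub>R classical_grad \<phi> x) = - (LINT x|lebesgue_on S. \<phi> x *\<^sub>R g x) \<longleftrightarrow>
     (\<forall>b\<in>Basis. (LINT x|lebesgue_on S. v x \<bullet> (classical_grad \<phi> x \<bullet> b)) = - (LINT x|lebesgue_on S. (g x \<bullet> b) \<bullet> \<phi> x))"
    if \<phi>: "\<phi> \<in> test_functions S" for \<phi>
  proof -
    note \<phi>L = test_functions_L2[OF S \<phi>]
    have 1: "(LINT x|lebesgue_on S. v x *\<^sub>R classical_grad \<phi> x) \<bullet> b =
        (LINT x|lebesgue_on S. v x \<bullet> (classical_grad \<phi> x \<bullet> b))" for b
      using L2_scaleR_integrable[OF v \<phi>L(2)] by (simp flip: integral_inner_left)
    have 2: "(LINT x|lebesgue_on S. \<phi> x *\<^sub>R g x) \<bullet> b = (LINT x|lebesgue_on S. (g x \<bullet> b) \<bullet> \<phi> x)" for b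
      using L2_scaleR_integrable[OF \<phi>L(1) g] by (simp add: mult.commute flip: integral_inner_left)
    show ?thesis by (subst euclidean_eq_iff) (simp add: 1 2)
  qed
  then show ?thesis unfolding has_weak_grad_def by blast
qed

lemma has_weak_grad_add:
  assumes S: "open S" "bounded S" and L: "v \<in> L2 S" "g \<in> L2 S" "w \<in> L2 S" "h \<in> L2 S"
    and v: "has_weak_grad S v g" and w: "has_weak_grad S w h"
  shows "has_weak_grad S (\<lambda>x. v x + w x) (\<lambda>x. g x + h x)"
proof -
  have "(LINT x|lebesgue_on S. (v x + w x) \<bullet> (classical_grad \<phi> x \<bullet> b)) =
      - (LINT x|lebesgue_on S. ((g x + h x) \<bullet> b) \<bullet> \<phi> x)"
    if \<phi>: "\<phi> \<in> test_functions S" and b: "b \<in> Basis" for \<phi> b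
  proof -
    note \<phi>L = test_functions_L2[OF S \<phi>] and c = L2_component[OF _ b]
    show ?thesis
      using v w \<phi> b L2_inner_integrable[OF L(1) c[OF \<phi>L(2)]] L2_inner_integrable[OF L(3) c[OF \<phi>L(2)]]
        L2_inner_integrable[OF c[OF L(2)] \<phi>L(1)] L2_inner_integrable[OF c[OF L(4)] \<phi>L(1)]
      unfolding has_weak_grad_iff[OF S L(1,2)] has_weak_grad_iff[OF S L(3,4)]
      by (simp add: inner_add_left distrib_right)
  qed
  then show ?thesis
    unfolding has_weak_grad_iff[OF S L2_add[OF L(1,3)] L2_add[OF L(2,4)]] by blast
qed

lemma has_weak_grad_cmult:
  assumes "has_weak_grad S v g"
  shows "has_weak_grad S (\<lambda>x. c * v x) (\<lambda>x. c *\<^sub>R g x)"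
proof -
  have "(LINT x|lebesgue_on S. (c * v x) *\<^sub>R classical_grad \<phi> x) =
      c *\<^sub>R (LINT x|lebesgue_on S. v x *\<^sub>R classical_grad \<phi> x)" for \<phi>
    by (simp flip: scaleR_scaleR)
  moreover have "(LINT x|lebesgue_on S. \<phi> x *\<^sub>R c *\<^sub>R g x) = c *\<^sub>R (LINT x|lebesgue_on S. \<phi> x *\<^sub>R g x)" for \<phi>
    by (subst scaleR_left_commute) (rule integral_scaleR_right)
  ultimately show ?thesis using assms unfolding has_weak_grad_def by simp
qed

lemma has_weak_grad_limit:
  assumes S: "open S" "bounded S"
    and L: "\<And>n. v n \<in> L2 S" "\<And>n. g n \<in> L2 S" "V \<in> L2 S" "G \<in> L2 S"
    and w: "\<And>n. has_weak_grad S (v n) (g n)"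
    and lim: "(\<lambda>n. L2_norm S (\<lambda>x. v n x - V x)) \<longlonglongrightarrow> 0" "(\<lambda>n. L2_norm S (\<lambda>x. g n x - G x)) \<longlonglongrightarrow> 0"
  shows "has_weak_grad S V G"
  unfolding has_weak_grad_iff[OF S L(3,4)]
proof (intro ballI)
  fix \<phi> and b :: 'a assume \<phi>: "\<phi> \<in> test_functions S" and b: "b \<in> Basis"
  note \<phi>L = test_functions_L2[OF S \<phi>]
  have 1: "(\<lambda>n. LINT x|lebesgue_on S. v n x \<bullet> (classical_grad \<phi> x \<bullet> b)) \<longlonglongrightarrow>
      (LINT x|lebesgue_on S. V x \<bullet> (classical_grad \<phi> x \<bullet> b))"
    by (rule L2_tendsto_inner[OF L(1,3) lim(1) L2_component[OF \<phi>L(2) b]])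
  have "(\<lambda>n. L2_norm S (\<lambda>x. g n x \<bullet> b - G x \<bullet> b)) \<longlonglongrightarrow> 0"
  proof (rule Lim_null_comparison[OF _ lim(2)], rule always_eventually, rule allI)
    fix n
    show "norm (L2_norm S (\<lambda>x. g n x \<bullet> b - G x \<bullet> b)) \<le> L2_norm S (\<lambda>x. g n x - G x)"
      using L2_norm_component_le[OF L2_diff[OF L(2)[of n] L(4)] b] by (simp add: inner_diff_left)
  qed
  then have "(\<lambda>n. LINT x|lebesgue_on S. (g n x \<bullet> b) \<bullet> \<phi> x) \<longlonglongrightarrow> (LINT x|lebesgue_on S. (G x \<bullet> b) \<bullet> \<phi> x)"
    by (rule L2_tendsto_inner[OF L2_component[OF L(2) b] L2_component[OF L(4) b] _ \<phi>L(1)])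
  then have 2: "(\<lambda>n. LINT x|lebesgue_on S. v n x \<bullet> (classical_grad \<phi> x \<bullet> b)) \<longlonglongrightarrow>
      - (LINT x|lebesgue_on S. (G x \<bullet> b) \<bullet> \<phi> x)"
    using w \<phi> b unfolding has_weak_grad_iff[OF S L(1,2)] by (simp add: tendsto_minus)
  show "(LINT x|lebesgue_on S. V x \<bullet> (classical_grad \<phi> x \<bullet> b)) = - (LINT x|lebesgue_on S. (G x \<bullet> b) \<bullet> \<phi> x)"
    by (rule LIMSEQ_unique[OF 1 2])
qed

lemma has_weak_grad_unique:
  assumes S: "open S" "bounded S" and L: "v \<in> L2 S" "g \<in> L2 S" "h \<in> L2 S"
    and g: "has_weak_grad S v g" and h: "has_weak_grad S v h"
  shows "AE x in lebesgue_on S. g x = h x"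
proof -
  have "AE x in lebesgue_on S. (g x - h x) \<bullet> b = 0" if b: "b \<in> Basis" for b
  proof (rule fundamental_lemma_calculus_of_variations[OF S(1) L2_imp_integrable[OF S L2_component[OF L2_diff[OF L(2,3)] b]]])
    fix \<phi> assume \<phi>: "\<phi> \<in> test_functions S"
    have "(LINT x|lebesgue_on S. (g x \<bullet> b) \<bullet> \<phi> x) = (LINT x|lebesgue_on S. (h x \<bullet> b) \<bullet> \<phi> x)"
      using g h \<phi> b unfolding has_weak_grad_iff[OF S L(1,2)] has_weak_grad_iff[OF S L(1,3)] by force
    moreover have "(LINT x|lebesgue_on S. \<phi> x * ((g x - h x) \<bullet> b)) =
        (LINT x|lebesgue_on S. (g x \<bullet> b) \<bullet> \<phi> x - (h x \<bullet> b) \<bullet> \<phi> x)"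
      by (simp add: inner_diff_left algebra_simps)
    ultimately show "(LINT x|lebesgue_on S. \<phi> x * ((g x - h x) \<bullet> b)) = 0"
      using L2_inner_integrable[OF L2_component[OF L(2) b] test_functions_L2(1)[OF S \<phi>]]
        L2_inner_integrable[OF L2_component[OF L(3) b] test_functions_L2(1)[OF S \<phi>]]
      by simp
  qed
  then have "AE x in lebesgue_on S. \<forall>b\<in>Basis. (g x - h x) \<bullet> b = 0"
    by (intro AE_ball_countable') (auto intro: countable_finite)
  then show ?thesis by eventually_elim (auto intro: euclidean_eqI simp: inner_diff_left)
qed

section \<open>Functions with square-integrable weak gradient\<close>

lemma H1I: "v \<in> L2 S \<Longrightarrow> g \<in> L2 S \<Longrightarrow> has_weak_grad S v g \<Longrightarrow> v \<in> H1 S"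
  by (auto simp: H1_def)

lemma H1_grad:
  assumes "v \<in> H1 S"
  shows "v \<in> L2 S" "grad S v \<in> L2 S" "has_weak_grad S v (grad S v)"
proof -
  have "\<exists>g. g \<in> L2 S \<and> has_weak_grad S v g" using assms by (auto simp: H1_def)
  from someI_ex[OF this] show "grad S v \<in> L2 S" "has_weak_grad S v (grad S v)"
    by (auto simp: grad_def)
qed (use assms in \<open>simp add: H1_def\<close>)

lemma grad_AE_eq:
  assumes S: "open S" "bounded S" and L: "v \<in> L2 S" "g \<in> L2 S" and g: "has_weak_grad S v g"
  shows "AE x in lebesgue_on S. grad S v x = g x"
  using has_weak_grad_unique[OF S L(1) _ L(2) _ g] H1_grad[OF H1I[OF L g]] by blast

lemma continuous_GDERIV_H1:
  assumes S: "open S" "bounded S" and v: "\<And>x. GDERIV v x :> g x" and g: "continuous_on UNIV g"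
  shows "v \<in> H1 S" "AE x in lebesgue_on S. grad S v x = g x"
proof -
  have "continuous_on UNIV v"
    by (rule GDERIV_imp_continuous_on[OF v])
  then have L: "v \<in> L2 S" "g \<in> L2 S" using continuous_imp_L2[OF S] g by blast+
  have w: "has_weak_grad S v g"
    by (rule has_weak_grad_of_continuous_GDERIV[OF _ v g]) (use S in \<open>simp add: sets_completionI_sets\<close>)
  show "v \<in> H1 S" by (rule H1I[OF L w])
  show "AE x in lebesgue_on S. grad S v x = g x" by (rule grad_AE_eq[OF S L w])
qed

lemma test_functions_weak_grad:
  assumes "open S" "\<phi> \<in> test_functions S"
  shows "has_weak_grad S \<phi> (classical_grad \<phi>)"
  by (rule has_weak_grad_of_continuous_GDERIV[OF _ test_functions_GDERIV(1,3)[OF assms(2)]])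
    (use assms(1) in \<open>simp add: sets_completionI_sets\<close>)

text \<open>
  The \<open>H1\<close> norm of \<open>\<phi> n - v\<close> involves the weak gradient chosen for this difference. Together with its
  converse \<open>H10E\<close>, this rule replaces it by the difference of the classical gradient of \<open>\<phi> n\<close> and a given
  candidate for the weak gradient of \<open>v\<close>.
\<close>

lemma H10I:
  assumes S: "open S" "bounded S" and L: "v \<in> L2 S" "g \<in> L2 S"
    and \<phi>: "\<And>n. \<phi> n \<in> test_functions S"
    and lim: "(\<lambda>n. L2_norm S (\<lambda>x. \<phi> n x - v x)) \<longlonglongrightarrow> 0" "(\<lambda>n. L2_norm S (\<lambda>x. classical_grad (\<phi> n) x - g x)) \<longlonglongrightarrow> 0"
  shows "v \<in> H10 S" "AE x in lebesgue_on S. grad S v x = g x"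
proof -
  note \<phi>L = test_functions_L2[OF S \<phi>] and \<phi>w = test_functions_weak_grad[OF S(1) \<phi>]
  have w: "has_weak_grad S v g"
    by (rule has_weak_grad_limit[OF S \<phi>L L \<phi>w lim])
  show "AE x in lebesgue_on S. grad S v x = g x" by (rule grad_AE_eq[OF S L w])
  have H: "H1_norm S (\<lambda>x. \<phi> n x - v x) = sqrt ((L2_norm S (\<lambda>x. \<phi> n x - v x))\<^sup>2 +
      (L2_norm S (\<lambda>x. classical_grad (\<phi> n) x - g x))\<^sup>2)" for n
  proof -
    have dw: "has_weak_grad S (\<lambda>x. \<phi> n x - v x) (\<lambda>x. classical_grad (\<phi> n) x - g x)"
      using has_weak_grad_add[OF S \<phi>L(1)[of n] \<phi>L(2)[of n] L2_mult[OF L(1), of "-1"]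
          L2_scaleR[OF L(2), of "-1"] \<phi>w[of n] has_weak_grad_cmult[OF w]] by simp
    have dL: "(\<lambda>x. \<phi> n x - v x) \<in> L2 S" "(\<lambda>x. classical_grad (\<phi> n) x - g x) \<in> L2 S"
      using L2_diff \<phi>L L by blast+
    have "L2_norm S (grad S (\<lambda>x. \<phi> n x - v x)) = L2_norm S (\<lambda>x. classical_grad (\<phi> n) x - g x)"
      by (rule L2_norm_cong_AE[OF grad_AE_eq[OF S dL dw] L2_measurable L2_measurable])
        (use H1_grad[OF H1I[OF dL dw]] dL in auto)
    then show ?thesis by (simp add: H1_norm_def)
  qed
  have "(\<lambda>n. sqrt ((L2_norm S (\<lambda>x. \<phi> n x - v x))\<^sup>2 +
      (L2_norm S (\<lambda>x. classical_grad (\<phi> n) x - g x))\<^sup>2)) \<longlonglongrightarrow> sqrt (0\<^sup>2 + 0\<^sup>2)"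
    by (intro tendsto_intros lim)
  then have "(\<lambda>n. H1_norm S (\<lambda>x. \<phi> n x - v x)) \<longlonglongrightarrow> 0" by (simp add: H)
  then show "v \<in> H10 S" using H1I[OF L w] \<phi> unfolding H10_def by blast
qed

lemma H10E:
  assumes S: "open S" "bounded S" and v: "v \<in> H10 S"
  obtains \<phi> where "\<And>n. \<phi> n \<in> test_functions S" "(\<lambda>n. L2_norm S (\<lambda>x. \<phi> n x - v x)) \<longlonglongrightarrow> 0"
    "(\<lambda>n. L2_norm S (\<lambda>x. classical_grad (\<phi> n) x - grad S v x)) \<longlonglongrightarrow> 0"
proof -
  obtain \<phi> where \<phi>: "\<And>n::nat. \<phi> n \<in> test_functions S" and lim: "(\<lambda>n. H1_norm S (\<lambda>x. \<phi> n x - v x)) \<longlonglongrightarrow> 0"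
    using v by (auto simp: H10_def)
  have v1: "v \<in> H1 S" using v by (simp add: H10_def)
  note \<phi>L = test_functions_L2[OF S \<phi>] and \<phi>w = test_functions_weak_grad[OF S(1) \<phi>] and vg = H1_grad[OF v1]
  have eq: "L2_norm S (grad S (\<lambda>x. \<phi> n x - v x)) = L2_norm S (\<lambda>x. classical_grad (\<phi> n) x - grad S v x)" for n
  proof -
    have dw: "has_weak_grad S (\<lambda>x. \<phi> n x - v x) (\<lambda>x. classical_grad (\<phi> n) x - grad S v x)"
      using has_weak_grad_add[OF S \<phi>L(1)[of n] \<phi>L(2)[of n] L2_mult[OF vg(1), of "-1"]
          L2_scaleR[OF vg(2), of "-1"] \<phi>w[of n] has_weak_grad_cmult[OF vg(3)]] by simp
    have dL: "(\<lambda>x. \<phi> n x - v x) \<in> L2 S" "(\<lambda>x. classical_grad (\<phi> n) x - grad S v x) \<in> L2 S"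
      using L2_diff \<phi>L vg by blast+
    show ?thesis
      by (rule L2_norm_cong_AE[OF grad_AE_eq[OF S dL dw] L2_measurable L2_measurable])
        (use H1_grad[OF H1I[OF dL dw]] dL in auto)
  qed
  show ?thesis
  proof (rule that[OF \<phi>])
    show "(\<lambda>n. L2_norm S (\<lambda>x. \<phi> n x - v x)) \<longlonglongrightarrow> 0"
      by (rule Lim_null_comparison[OF always_eventually lim]) (simp add: H1_norm_def real_le_rsqrt)
    show "(\<lambda>n. L2_norm S (\<lambda>x. classical_grad (\<phi> n) x - grad S v x)) \<longlonglongrightarrow> 0"
      by (rule Lim_null_comparison[OF always_eventually lim]) (simp add: H1_norm_def eq real_le_rsqrt)
  qed
qed

lemma H10_grad:
  assumes "v \<in> H10 S"
  shows "v \<in> L2 S" "grad S v \<in> L2 S" "has_weak_grad S v (grad S v)"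
  using assms H1_grad[of v S] by (auto simp: H10_def)

lemma classical_grad_add_cmult:
  assumes "\<phi> \<in> test_functions S" "\<psi> \<in> test_functions S"
  shows "classical_grad (\<lambda>x. \<phi> x + c * \<psi> x) x = classical_grad \<phi> x + c *\<^sub>R classical_grad \<psi> x"
proof (rule classical_grad_eq)
  have "GDERIV (\<lambda>x. c * \<psi> x) x :> c *\<^sub>R classical_grad \<psi> x + \<psi> x *\<^sub>R 0"
    by (rule GDERIV_mult[OF GDERIV_const test_functions_GDERIV(1)[OF assms(2)]])
  then show "GDERIV (\<lambda>x. \<phi> x + c * \<psi> x) x :> classical_grad \<phi> x + c *\<^sub>R classical_grad \<psi> x"
    by (intro GDERIV_add test_functions_GDERIV(1)[OF assms(1)]) simp
qed

lemma test_functions_H10: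
  assumes S: "open S" "bounded S" and \<phi>: "\<phi> \<in> test_functions S"
  shows "\<phi> \<in> H10 S" "AE x in lebesgue_on S. grad S \<phi> x = classical_grad \<phi> x"
    "L2_norm S (grad S \<phi>) = L2_norm S (classical_grad \<phi>)"
proof -
  note H = H10I[OF S test_functions_L2[OF S \<phi>], of "\<lambda>n. \<phi>"]
  show 1: "\<phi> \<in> H10 S" and 2: "AE x in lebesgue_on S. grad S \<phi> x = classical_grad \<phi> x"
    using H \<phi> by simp_all
  show "L2_norm S (grad S \<phi>) = L2_norm S (classical_grad \<phi>)"
    by (rule L2_norm_cong_AE[OF 2 L2_measurable[OF H10_grad(2)[OF 1]] L2_measurable[OF test_functions_L2(2)[OF S \<phi>]]])
qed

lemma H10_add_cmult:
  assumes S: "open S" "bounded S" and v: "v \<in> H10 S" and w: "w \<in> H10 S"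
  shows "(\<lambda>x. v x + c * w x) \<in> H10 S"
    "AE x in lebesgue_on S. grad S (\<lambda>x. v x + c * w x) x = grad S v x + c *\<^sub>R grad S w x"
proof -
  obtain \<phi> where \<phi>: "\<And>n. \<phi> n \<in> test_functions S" "(\<lambda>n. L2_norm S (\<lambda>x. \<phi> n x - v x)) \<longlonglongrightarrow> 0"
    "(\<lambda>n. L2_norm S (\<lambda>x. classical_grad (\<phi> n) x - grad S v x)) \<longlonglongrightarrow> 0"
    by (rule H10E[OF S v]) blast
  obtain \<psi> where \<psi>: "\<And>n. \<psi> n \<in> test_functions S" "(\<lambda>n. L2_norm S (\<lambda>x. \<psi> n x - w x)) \<longlonglongrightarrow> 0"
    "(\<lambda>n. L2_norm S (\<lambda>x. classical_grad (\<psi> n) x - grad S w x)) \<longlonglongrightarrow> 0"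
    by (rule H10E[OF S w]) blast
  note vg = H10_grad[OF v] and wg = H10_grad[OF w]
  note \<phi>L = test_functions_L2[OF S \<phi>(1)] and \<psi>L = test_functions_L2[OF S \<psi>(1)]
  have lim: "(\<lambda>n. L2_norm S (\<lambda>x. (a n x + c *\<^sub>R b n x) - (A x + c *\<^sub>R B x))) \<longlonglongrightarrow> 0"
    if "\<And>n. a n \<in> L2 S" "\<And>n. b n \<in> L2 S" "A \<in> L2 S" "B \<in> L2 S"
      "(\<lambda>n. L2_norm S (\<lambda>x. a n x - A x)) \<longlonglongrightarrow> 0" "(\<lambda>n. L2_norm S (\<lambda>x. b n x - B x)) \<longlonglongrightarrow> 0"
    for a b :: "nat \<Rightarrow> 'a \<Rightarrow> 'c::euclidean_space" and A B
  proof (rule Lim_null_comparison[OF always_eventually, OF allI])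
    fix n
    have "L2_norm S (\<lambda>x. (a n x - A x) + c *\<^sub>R (b n x - B x)) \<le>
        L2_norm S (\<lambda>x. a n x - A x) + L2_norm S (\<lambda>x. c *\<^sub>R (b n x - B x))"
      by (intro L2_norm_triangle L2_diff L2_scaleR that)
    then show "norm (L2_norm S (\<lambda>x. (a n x + c *\<^sub>R b n x) - (A x + c *\<^sub>R B x))) \<le>
        L2_norm S (\<lambda>x. a n x - A x) + \<bar>c\<bar> * L2_norm S (\<lambda>x. b n x - B x)"
      unfolding L2_norm_scaleR by (simp add: scaleR_diff_right add_diff_add)
  next
    show "(\<lambda>n. L2_norm S (\<lambda>x. a n x - A x) + \<bar>c\<bar> * L2_norm S (\<lambda>x. b n x - B x)) \<longlonglongrightarrow> 0"
      using tendsto_add[OF that(5) tendsto_mult_left[OF that(6), of "\<bar>c\<bar>"]] by simp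
  qed
  have test: "(\<lambda>x. \<phi> n x + c * \<psi> n x) \<in> test_functions S" for n
    by (intro test_functions_add test_functions_cmult \<phi> \<psi>)
  have l1: "(\<lambda>n. L2_norm S (\<lambda>x. (\<phi> n x + c * \<psi> n x) - (v x + c * w x))) \<longlonglongrightarrow> 0"
    using lim[OF \<phi>L(1) \<psi>L(1) vg(1) wg(1) \<phi>(2) \<psi>(2)] by simp
  have l2: "(\<lambda>n. L2_norm S (\<lambda>x. classical_grad (\<lambda>x. \<phi> n x + c * \<psi> n x) x - (grad S v x + c *\<^sub>R grad S w x))) \<longlonglongrightarrow> 0"
    unfolding classical_grad_add_cmult[OF \<phi>(1) \<psi>(1)]
    by (rule lim[OF \<phi>L(2) \<psi>L(2) vg(2) wg(2) \<phi>(3) \<psi>(3)])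
  note H = H10I[OF S L2_add[OF vg(1) L2_mult[OF wg(1)]] L2_add[OF vg(2) L2_scaleR[OF wg(2)]] test l1 l2]
  show "(\<lambda>x. v x + c * w x) \<in> H10 S"
    "AE x in lebesgue_on S. grad S (\<lambda>x. v x + c * w x) x = grad S v x + c *\<^sub>R grad S w x"
    by (rule H)+
qed

section \<open>The dual space\<close>

lemma Hneg1D:
  assumes "F \<in> Hneg1 S"
  shows "\<phi> \<in> H10 S \<Longrightarrow> \<psi> \<in> H10 S \<Longrightarrow> F (\<lambda>x. \<phi> x + \<psi> x) = F \<phi> + F \<psi>"
    "\<phi> \<in> H10 S \<Longrightarrow> F (\<lambda>x. c * \<phi> x) = c * F \<phi>"
  using assms by (auto simp: Hneg1_def)

lemma Hneg1_bound:
  assumes "F \<in> Hneg1 S"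
  obtains M where "M \<ge> 0" "\<And>\<phi>. \<phi> \<in> H10 S \<Longrightarrow> \<bar>F \<phi>\<bar> \<le> M * L2_norm S (grad S \<phi>)"
proof -
  obtain M where M: "\<And>\<phi>. \<phi> \<in> H10 S \<Longrightarrow> \<bar>F \<phi>\<bar> \<le> M * L2_norm S (grad S \<phi>)"
    using assms unfolding Hneg1_def by blast
  show ?thesis
  proof (rule that[of "\<bar>M\<bar>"])
    fix \<phi> assume "\<phi> \<in> H10 S"
    then show "\<bar>F \<phi>\<bar> \<le> \<bar>M\<bar> * L2_norm S (grad S \<phi>)"
      using M mult_right_mono[OF abs_ge_self[of M], of "L2_norm S (grad S \<phi>)"] L2_norm_nonneg
      by (meson order_trans)
  qed simp
qed

lemma Hneg1_tendsto:
  assumes S: "open S" "bounded S" and F: "F \<in> Hneg1 S" and v: "v \<in> H10 S"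
    and \<phi>: "\<And>n. \<phi> n \<in> test_functions S"
    and lim: "(\<lambda>n. L2_norm S (\<lambda>x. classical_grad (\<phi> n) x - grad S v x)) \<longlonglongrightarrow> 0"
  shows "(\<lambda>n. F (\<phi> n)) \<longlonglongrightarrow> F v"
proof -
  obtain M where M: "M \<ge> 0" "\<And>\<phi>. \<phi> \<in> H10 S \<Longrightarrow> \<bar>F \<phi>\<bar> \<le> M * L2_norm S (grad S \<phi>)"
    by (rule Hneg1_bound[OF F]) blast
  note \<phi>H = test_functions_H10[OF S \<phi>]
  show ?thesis
  proof (rule LIM_zero_cancel, rule Lim_null_comparison[OF always_eventually, OF allI])
    fix n
    let ?d = "\<lambda>x. \<phi> n x + (-1) * v x"
    have d: "?d \<in> H10 S" "AE x in lebesgue_on S. grad S ?d x = grad S (\<phi> n) x + (-1) *\<^sub>R grad S v x"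
      by (rule H10_add_cmult[OF S \<phi>H(1) v])+
    have z: "(\<lambda>x. 0 + (-1) * v x) \<in> H10 S"
      by (rule H10_add_cmult(1)[OF S test_functions_H10(1)[OF S test_functions_zero] v])
    have "F ?d = F (\<phi> n) + F (\<lambda>x. (-1) * v x)"
      using Hneg1D(1)[OF F \<phi>H(1)[of n], of "\<lambda>x. (-1) * v x"] z by simp
    also have "F (\<lambda>x. (-1) * v x) = - F v"
      using Hneg1D(2)[OF F v, of "-1"] by simp
    finally have "\<bar>F (\<phi> n) - F v\<bar> \<le> M * L2_norm S (grad S ?d)"
      using M(2)[OF d(1)] by simp
    also have "L2_norm S (grad S ?d) = L2_norm S (\<lambda>x. classical_grad (\<phi> n) x - grad S v x)"
    proof (rule L2_norm_cong_AE)
      show "AE x in lebesgue_on S. grad S ?d x = classical_grad (\<phi> n) x - grad S v x"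
        using d(2) \<phi>H(2)[of n] by eventually_elim simp
    qed (use H10_grad(2)[OF d(1)] L2_diff[OF test_functions_L2(2)[OF S \<phi>[of n]] H10_grad(2)[OF v]] L2_measurable in auto)
    finally show "norm (F (\<phi> n) - F v) \<le> M * L2_norm S (\<lambda>x. classical_grad (\<phi> n) x - grad S v x)" by simp
  next
    show "(\<lambda>n. M * L2_norm S (\<lambda>x. classical_grad (\<phi> n) x - grad S v x)) \<longlonglongrightarrow> 0"
      using tendsto_mult_left[OF lim, of M] by simp
  qed
qed

section \<open>Solvability of the conduction problem\<close>

text \<open>
  The divergence of \<open>\<phi>\<^sup>2 x\<close> is \<open>d \<phi>\<^sup>2 + 2 \<phi> (x \<bullet> \<nabla>\<phi>)\<close> with \<open>d\<close> the dimension. It integrates to \<open>0\<close>, and the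
  Cauchy-Schwarz inequality does the rest.
\<close>

lemma poincare_test_functions:
  fixes S :: "'a::euclidean_space set"
  assumes S: "open S" "bounded S" and R: "\<And>x. x \<in> S \<Longrightarrow> norm x \<le> R" and R0: "R \<ge> 0"
    and \<phi>: "\<phi> \<in> test_functions S"
  shows "DIM('a) * L2_norm S \<phi> \<le> 2 * R * L2_norm S (classical_grad \<phi>)"
proof -
  have Sm: "S \<in> sets lebesgue" using S by (simp add: sets_completionI_sets)
  note \<phi>c = test_functions_GDERIV[OF \<phi>]
  define K where "K = closure {x. \<phi> x \<noteq> 0}"
  have K: "compact K" "K \<subseteq> S" using test_functionsD[OF \<phi>] by (auto simp: K_def)
  have out: "\<phi> x = 0" "classical_grad \<phi> x = 0" if "x \<notin> K" for x
    by (rule test_functions_outside[OF \<phi> that[unfolded K_def]])+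
  define d where "d b x = (\<phi> x * \<phi> x) *\<^sub>R b + (x \<bullet> b) *\<^sub>R (\<phi> x *\<^sub>R classical_grad \<phi> x + \<phi> x *\<^sub>R classical_grad \<phi> x)" for b x
  have G: "GDERIV (\<lambda>x. (\<phi> x * \<phi> x) * (x \<bullet> b)) x :> d b x" for b x
  proof -
    have "GDERIV (\<lambda>x. x \<bullet> b) x :> b"
      unfolding gderiv_def by (rule bounded_linear_imp_has_derivative[OF bounded_linear_inner_left])
    then show ?thesis unfolding d_def by (intro GDERIV_mult \<phi>c(1))
  qed
  have dc: "continuous_on UNIV (d b)" for b
    unfolding d_def by (intro continuous_intros \<phi>c)
  have i: "integrable lborel (\<lambda>x. d b x \<bullet> b)" "(LINT x|lborel. d b x \<bullet> b) = 0" for b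
    by (rule integral_gradient_component_eq_0[OF G dc K(1)]; simp add: out)+
  define f where "f x = DIM('a) * (\<phi> x \<bullet> \<phi> x) + 2 * (\<phi> x \<bullet> (x \<bullet> classical_grad \<phi> x))" for x
  have "(\<Sum>b\<in>Basis. d b x \<bullet> b) = f x" for x
  proof -
    have "(\<Sum>b\<in>Basis. d b x \<bullet> b) =
        (\<Sum>b\<in>(Basis::'a set). \<phi> x * \<phi> x + 2 * \<phi> x * ((x \<bullet> b) * (classical_grad \<phi> x \<bullet> b)))"
      by (rule sum.cong) (auto simp: d_def inner_add_left algebra_simps)
    also have "\<dots> = f x"
      by (simp add: f_def sum.distrib euclidean_inner[of x "classical_grad \<phi> x"] flip: sum_distrib_left)
    finally show ?thesis .
  qed
  then have "(LINT x|lborel. f x) = (\<Sum>b\<in>Basis. LINT x|lborel. d b x \<bullet> b)"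
    using i(1) by (subst Bochner_Integration.integral_sum[symmetric]) auto
  then have "(LINT x|lborel. f x) = 0" using i(2) by simp
  moreover have fc: "continuous_on UNIV f" unfolding f_def by (intro continuous_intros \<phi>c)
  have "(LINT x|lebesgue_on S. f x) = (LINT x|lborel. f x)"
  proof (rule integral_lebesgue_on_supported[OF fc Sm])
    fix x assume "x \<notin> S"
    then have "x \<notin> K" using K(2) by blast
    then show "f x = 0" by (simp add: f_def out)
  qed
  ultimately have f0: "(LINT x|lebesgue_on S. f x) = 0" by simp
  note \<phi>L = test_functions_L2[OF S \<phi>]
  have rc: "continuous_on UNIV (\<lambda>x. x \<bullet> classical_grad \<phi> x)" by (intro continuous_intros \<phi>c)
  have rL: "(\<lambda>x. x \<bullet> classical_grad \<phi> x) \<in> L2 S" by (rule continuous_imp_L2[OF S rc])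
  have rn: "L2_norm S (\<lambda>x. x \<bullet> classical_grad \<phi> x) \<le> R * L2_norm S (classical_grad \<phi>)"
  proof -
    have "L2_norm S (\<lambda>x. x \<bullet> classical_grad \<phi> x) \<le> L2_norm S (\<lambda>x. R *\<^sub>R classical_grad \<phi> x)"
    proof (rule L2_norm_mono[OF _ rL L2_scaleR[OF \<phi>L(2)]], rule AE_I2)
      fix x assume "x \<in> space (lebesgue_on S)"
      then have "norm x \<le> R" using R by simp
      have "\<bar>x \<bullet> classical_grad \<phi> x\<bar> \<le> norm x * norm (classical_grad \<phi> x)" by (rule Cauchy_Schwarz_ineq2)
      also have "\<dots> \<le> R * norm (classical_grad \<phi> x)" using \<open>norm x \<le> R\<close> by (rule mult_right_mono) simp
      finally show "norm (x \<bullet> classical_grad \<phi> x) \<le> norm (R *\<^sub>R classical_grad \<phi> x)" using R0 by simp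
    qed
    then show ?thesis using R0 by (simp add: L2_norm_scaleR)
  qed
  have "0 = DIM('a) * (L2_norm S \<phi>)\<^sup>2 + 2 * (LINT x|lebesgue_on S. \<phi> x \<bullet> (x \<bullet> classical_grad \<phi> x))"
    unfolding f0[symmetric] f_def L2_norm_power2_inner
    using L2_inner_integrable[OF \<phi>L(1) \<phi>L(1)] L2_inner_integrable[OF \<phi>L(1) rL]
    by (subst Bochner_Integration.integral_add) auto
  then have "DIM('a) * (L2_norm S \<phi>)\<^sup>2 \<le> 2 * \<bar>LINT x|lebesgue_on S. \<phi> x \<bullet> (x \<bullet> classical_grad \<phi> x)\<bar>" by linarith
  also have "\<dots> \<le> 2 * (L2_norm S \<phi> * (R * L2_norm S (classical_grad \<phi>)))"
    using L2_Cauchy_Schwarz[OF \<phi>L(1) rL] mult_left_mono[OF rn L2_norm_nonneg[of S \<phi>]] by linarith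
  finally have le: "L2_norm S \<phi> * (DIM('a) * L2_norm S \<phi>) \<le> L2_norm S \<phi> * (2 * R * L2_norm S (classical_grad \<phi>))"
    by (simp add: power2_eq_square algebra_simps)
  show ?thesis
  proof (cases "L2_norm S \<phi> = 0")
    case False
    then have "L2_norm S \<phi> > 0" using L2_norm_nonneg[of S \<phi>] by linarith
    with le show ?thesis by (simp only: mult_le_cancel_left_pos)
  qed (use R0 in simp)
qed

text \<open>
  The energy \<open>J \<phi> = \<parallel>\<nabla>\<phi>\<parallel>\<^sup>2 / 2 - F \<phi>\<close> is minimised over test functions. Expanding \<open>J (\<phi> + t \<xi>) \<ge> m\<close> in \<open>t\<close>,
  where \<open>m\<close> is the infimum, shows that the residual \<open>\<beta> \<phi> \<xi> = \<integral> \<nabla>\<phi> \<bullet> \<nabla>\<xi> - F \<xi>\<close> is at most \<open>\<delta> \<phi> \<parallel>\<nabla>\<xi>\<parallel>\<close> with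
  \<open>(\<delta> \<phi>)\<^sup>2 = 2 (J \<phi> - m)\<close>. This one estimate serves twice: it makes a minimising sequence Cauchy, and it
  yields the equation for the limit.
\<close>

lemma riesz_H10:
  fixes S :: "'a::euclidean_space set"
  assumes S: "open S" "bounded S" and F: "F \<in> Hneg1 S"
  obtains T where "T \<in> H10 S" "\<And>\<xi>. \<xi> \<in> H10 S \<Longrightarrow> (LINT x|lebesgue_on S. grad S \<xi> x \<bullet> grad S T x) = F \<xi>"
proof -
  let ?D = "classical_grad"
  let ?N = "\<lambda>\<phi>. L2_norm S (?D \<phi>)"
  let ?X = "test_functions S"
  obtain M where M: "M \<ge> 0" "\<And>\<phi>. \<phi> \<in> H10 S \<Longrightarrow> \<bar>F \<phi>\<bar> \<le> M * L2_norm S (grad S \<phi>)"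
    by (rule Hneg1_bound[OF F]) blast
  note tH = test_functions_H10[OF S] and tL = test_functions_L2[OF S]
  have MX: "\<bar>F \<phi>\<bar> \<le> M * ?N \<phi>" if "\<phi> \<in> ?X" for \<phi>
    using M(2)[OF tH(1)[OF that]] tH(3)[OF that] by simp
  have lin: "F (\<lambda>x. \<phi> x + c * \<psi> x) = F \<phi> + c * F \<psi>" if "\<phi> \<in> ?X" "\<psi> \<in> ?X" for \<phi> \<psi> c
    using Hneg1D(1)[OF F tH(1)[OF that(1)] tH(1)[OF test_functions_cmult[OF that(2)]], of c]
      Hneg1D(2)[OF F tH(1)[OF that(2)], of c] by simp
  define J where "J \<phi> = (?N \<phi>)\<^sup>2 / 2 - F \<phi>" for \<phi>
  define m where "m = Inf (J ` ?X)"
  have bdd: "bdd_below (J ` ?X)"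
  proof (rule bdd_belowI2[where m = "- M\<^sup>2 / 2"])
    fix \<phi> assume "\<phi> \<in> ?X"
    have "0 \<le> (?N \<phi> - M)\<^sup>2" by simp
    then show "- M\<^sup>2 / 2 \<le> J \<phi>"
      unfolding J_def power2_diff using MX[OF \<open>\<phi> \<in> ?X\<close>] by (simp add: abs_le_iff mult.commute)
  qed
  have mJ: "m \<le> J \<phi>" if "\<phi> \<in> ?X" for \<phi>
    unfolding m_def using that bdd by (intro cInf_lower) auto
  define \<beta> where "\<beta> \<phi> \<xi> = (LINT x|lebesgue_on S. ?D \<phi> x \<bullet> ?D \<xi> x) - F \<xi>" for \<phi> \<xi>
  define \<delta> where "\<delta> \<phi> = sqrt (2 * (J \<phi> - m))" for \<phi>
  have var: "\<bar>\<beta> \<phi> \<xi>\<bar> \<le> \<delta> \<phi> * ?N \<xi>" if \<phi>: "\<phi> \<in> ?X" and \<xi>: "\<xi> \<in> ?X" for \<phi> \<xi>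
  proof -
    have "(- \<beta> \<phi> \<xi> / 2)\<^sup>2 \<le> (J \<phi> - m) * ((?N \<xi>)\<^sup>2 / 2)"
    proof (rule nonneg_quadratic_imp_discriminant_le)
      fix t :: real
      have in_X: "(\<lambda>x. \<phi> x + t * \<xi> x) \<in> ?X" by (intro test_functions_add test_functions_cmult \<phi> \<xi>)
      have "?D (\<lambda>x. \<phi> x + t * \<xi> x) = (\<lambda>x. ?D \<phi> x + t *\<^sub>R ?D \<xi> x)"
        by (rule ext) (rule classical_grad_add_cmult[OF \<phi> \<xi>])
      then have "J (\<lambda>x. \<phi> x + t * \<xi> x) = J \<phi> + t * \<beta> \<phi> \<xi> + t\<^sup>2 * (?N \<xi>)\<^sup>2 / 2"
        unfolding J_def \<beta>_def lin[OF \<phi> \<xi>]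
        by (simp add: L2_norm_power2_add_scaleR[OF tL(2)[OF \<phi>] tL(2)[OF \<xi>]] field_simps)
      then show "0 \<le> J \<phi> - m - 2 * t * (- \<beta> \<phi> \<xi> / 2) + t\<^sup>2 * ((?N \<xi>)\<^sup>2 / 2)"
        using mJ[OF in_X] by simp
    qed simp
    then have "(\<beta> \<phi> \<xi>)\<^sup>2 \<le> 2 * (J \<phi> - m) * (?N \<xi>)\<^sup>2" by (simp add: power_divide algebra_simps)
    then have "sqrt ((\<beta> \<phi> \<xi>)\<^sup>2) \<le> sqrt (2 * (J \<phi> - m) * (?N \<xi>)\<^sup>2)" by (rule real_sqrt_le_mono)
    then show ?thesis by (simp add: real_sqrt_mult \<delta>_def)
  qed
  have ex: "\<exists>\<phi>. \<phi> \<in> ?X \<and> J \<phi> < m + 1 / real (Suc n)" for n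
  proof -
    have "J ` ?X \<noteq> {}" using test_functions_zero by blast
    then have "\<exists>y\<in>J ` ?X. y < m + 1 / real (Suc n)"
      using cInf_less_iff[OF _ bdd, of "m + 1 / real (Suc n)"] unfolding m_def by simp
    then show ?thesis by blast
  qed
  then obtain \<phi> where \<phi>: "\<And>n. \<phi> n \<in> ?X" and J\<phi>: "\<And>n. J (\<phi> n) < m + 1 / real (Suc n)" by metis
  have \<delta>0: "(\<lambda>n. \<delta> (\<phi> n)) \<longlonglongrightarrow> 0"
  proof (rule Lim_null_comparison[OF always_eventually, OF allI])
    fix n
    have "\<bar>\<delta> (\<phi> n)\<bar> = \<delta> (\<phi> n)" using mJ[OF \<phi>[of n]] by (simp add: \<delta>_def)
    then show "norm (\<delta> (\<phi> n)) \<le> sqrt (2 * (1 / real (Suc n)))"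
      using J\<phi>[of n] unfolding \<delta>_def by (simp add: algebra_simps)
  next
    have "(\<lambda>n. sqrt (2 * (1 / real (Suc n)))) \<longlonglongrightarrow> sqrt (2 * 0)"
      by (intro tendsto_intros LIMSEQ_Suc[OF lim_1_over_n])
    then show "(\<lambda>n. sqrt (2 * (1 / real (Suc n)))) \<longlonglongrightarrow> 0" by simp
  qed
  have diffX: "(\<lambda>x. \<phi> j x + (-1) * \<phi> k x) \<in> ?X" for j k by (intro test_functions_add test_functions_cmult \<phi>)
  have Ddiff: "?D (\<lambda>x. \<phi> j x + (-1) * \<phi> k x) = (\<lambda>x. ?D (\<phi> j) x - ?D (\<phi> k) x)" for j k
    using classical_grad_add_cmult[OF \<phi>[of j] \<phi>[of k], of "-1"] by (simp add: fun_eq_iff)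
  \<comment> \<open>test both residuals with \<open>\<xi> = \<phi> j - \<phi> k\<close> and subtract\<close>
  have dist_grad: "L2_norm S (\<lambda>x. ?D (\<phi> j) x - ?D (\<phi> k) x) \<le> \<delta> (\<phi> j) + \<delta> (\<phi> k)" for j k
  proof -
    define \<xi> where "\<xi> = (\<lambda>x. \<phi> j x + (-1) * \<phi> k x)"
    have \<xi>: "\<xi> \<in> ?X" and D\<xi>: "?D \<xi> = (\<lambda>x. ?D (\<phi> j) x - ?D (\<phi> k) x)"
      using diffX Ddiff by (auto simp: \<xi>_def)
    have "(?N \<xi>)\<^sup>2 = (LINT x|lebesgue_on S. ?D (\<phi> j) x \<bullet> ?D \<xi> x - ?D (\<phi> k) x \<bullet> ?D \<xi> x)"
      unfolding L2_norm_power2_inner by (subst (1) D\<xi>) (simp add: inner_diff_left)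
    also have "\<dots> = \<beta> (\<phi> j) \<xi> - \<beta> (\<phi> k) \<xi>"
      using L2_inner_integrable[OF tL(2)[OF \<phi>[of j]] tL(2)[OF \<xi>]] L2_inner_integrable[OF tL(2)[OF \<phi>[of k]] tL(2)[OF \<xi>]]
      by (simp add: \<beta>_def)
    also have "\<dots> \<le> \<delta> (\<phi> j) * ?N \<xi> + \<delta> (\<phi> k) * ?N \<xi>"
      using var[OF \<phi>[of j] \<xi>] var[OF \<phi>[of k] \<xi>] by linarith
    finally have le: "?N \<xi> * ?N \<xi> \<le> (\<delta> (\<phi> j) + \<delta> (\<phi> k)) * ?N \<xi>"
      by (simp add: power2_eq_square distrib_right)
    have "?N \<xi> \<le> \<delta> (\<phi> j) + \<delta> (\<phi> k)"
    proof (cases "?N \<xi> = 0")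
      case True
      then show ?thesis using mJ[OF \<phi>[of j]] mJ[OF \<phi>[of k]] by (simp add: \<delta>_def)
    next
      case False
      then have "?N \<xi> > 0" using L2_norm_nonneg[of S "?D \<xi>"] by linarith
      with le show ?thesis by (simp only: mult_le_cancel_right_pos)
    qed
    then show ?thesis by (simp add: D\<xi>)
  qed
  have cauchy_grad: "\<exists>N. \<forall>j\<ge>N. \<forall>k\<ge>N. L2_norm S (\<lambda>x. ?D (\<phi> j) x - ?D (\<phi> k) x) < e" if "e > 0" for e
  proof -
    have "\<forall>\<^sub>F n in sequentially. \<delta> (\<phi> n) < e / 2"
      using order_tendstoD(2)[OF \<delta>0, of "e / 2"] that by simp
    then obtain N where N: "\<And>n. n \<ge> N \<Longrightarrow> \<delta> (\<phi> n) < e / 2" by (auto simp: eventually_sequentially)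
    have "L2_norm S (\<lambda>x. ?D (\<phi> j) x - ?D (\<phi> k) x) < e" if "j \<ge> N" "k \<ge> N" for j k
      using dist_grad[of j k] N[OF that(1)] N[OF that(2)] by linarith
    then show ?thesis by blast
  qed
  obtain R where R: "R \<ge> 0" "\<And>x. x \<in> S \<Longrightarrow> norm x \<le> R"
    using S(2) unfolding bounded_pos by (metis less_imp_le)
  have cauchy: "\<exists>N. \<forall>j\<ge>N. \<forall>k\<ge>N. L2_norm S (\<lambda>x. \<phi> j x - \<phi> k x) < e" if "e > 0" for e
  proof -
    have pos: "e / (2 * R + 1) > 0" using that R(1) by simp
    obtain N where N: "\<And>j k. j \<ge> N \<Longrightarrow> k \<ge> N \<Longrightarrow> L2_norm S (\<lambda>x. ?D (\<phi> j) x - ?D (\<phi> k) x) < e / (2 * R + 1)"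
      using cauchy_grad[OF pos] by blast
    have "L2_norm S (\<lambda>x. \<phi> j x - \<phi> k x) < e" if jk: "j \<ge> N" "k \<ge> N" for j k
    proof -
      have "1 * L2_norm S (\<lambda>x. \<phi> j x - \<phi> k x) \<le> DIM('a) * L2_norm S (\<lambda>x. \<phi> j x - \<phi> k x)"
        by (rule mult_right_mono) (auto simp: Suc_leI)
      also have "\<dots> \<le> 2 * R * L2_norm S (\<lambda>x. ?D (\<phi> j) x - ?D (\<phi> k) x)"
        using poincare_test_functions[OF S R(2) R(1) diffX[of j k]] unfolding Ddiff by simp
      also have "\<dots> \<le> 2 * R * (e / (2 * R + 1))"
        using N[OF jk] R(1) by (intro mult_left_mono) auto
      also have "\<dots> < e" using R(1) \<open>e > 0\<close> by (simp add: field_simps)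
      finally show ?thesis by simp
    qed
    then show ?thesis by blast
  qed
  obtain T where T: "T \<in> L2 S" "(\<lambda>n. L2_norm S (\<lambda>x. \<phi> n x - T x)) \<longlonglongrightarrow> 0"
    by (rule L2_complete[OF tL(1)[OF \<phi>] cauchy]) blast
  obtain G where G: "G \<in> L2 S" "(\<lambda>n. L2_norm S (\<lambda>x. ?D (\<phi> n) x - G x)) \<longlonglongrightarrow> 0"
    by (rule L2_complete[OF tL(2)[OF \<phi>] cauchy_grad]) blast
  have TH: "T \<in> H10 S" and TG: "AE x in lebesgue_on S. grad S T x = G x"
    by (rule H10I[OF S T(1) G(1) \<phi> T(2) G(2)])+
  have eqX: "(LINT x|lebesgue_on S. G x \<bullet> ?D \<xi> x) = F \<xi>" if \<xi>: "\<xi> \<in> ?X" for \<xi>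
  proof -
    have "(\<lambda>n. \<beta> (\<phi> n) \<xi>) \<longlonglongrightarrow> 0"
    proof (rule Lim_null_comparison[OF always_eventually, OF allI])
      show "norm (\<beta> (\<phi> n) \<xi>) \<le> \<delta> (\<phi> n) * ?N \<xi>" for n using var[OF \<phi> \<xi>] by simp
      show "(\<lambda>n. \<delta> (\<phi> n) * ?N \<xi>) \<longlonglongrightarrow> 0" using tendsto_mult_right[OF \<delta>0, of "?N \<xi>"] by simp
    qed
    moreover have "(\<lambda>n. \<beta> (\<phi> n) \<xi>) \<longlonglongrightarrow> (LINT x|lebesgue_on S. G x \<bullet> ?D \<xi> x) - F \<xi>"
      unfolding \<beta>_def by (intro tendsto_diff tendsto_const L2_tendsto_inner[OF tL(2)[OF \<phi>] G tL(2)[OF \<xi>]])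
    ultimately have "(LINT x|lebesgue_on S. G x \<bullet> ?D \<xi> x) - F \<xi> = 0" by (rule LIMSEQ_unique[rotated])
    then show ?thesis by simp
  qed
  show ?thesis
  proof (rule that[OF TH])
    fix \<xi> assume \<xi>: "\<xi> \<in> H10 S"
    obtain \<psi> where \<psi>: "\<And>n. \<psi> n \<in> ?X" and \<psi>lim: "(\<lambda>n. L2_norm S (\<lambda>x. ?D (\<psi> n) x - grad S \<xi> x)) \<longlonglongrightarrow> 0"
      by (rule H10E[OF S \<xi>]) blast
    have "(\<lambda>n. F (\<psi> n)) \<longlonglongrightarrow> F \<xi>" by (rule Hneg1_tendsto[OF S F \<xi> \<psi> \<psi>lim])
    moreover have "(\<lambda>n. LINT x|lebesgue_on S. ?D (\<psi> n) x \<bullet> G x) \<longlonglongrightarrow> (LINT x|lebesgue_on S. grad S \<xi> x \<bullet> G x)"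
      by (rule L2_tendsto_inner[OF tL(2)[OF \<psi>] H10_grad(2)[OF \<xi>] \<psi>lim G(1)])
    then have "(\<lambda>n. F (\<psi> n)) \<longlonglongrightarrow> (LINT x|lebesgue_on S. grad S \<xi> x \<bullet> G x)"
      by (simp add: eqX[OF \<psi>, symmetric] inner_commute)
    ultimately have "(LINT x|lebesgue_on S. grad S \<xi> x \<bullet> G x) = F \<xi>" by (rule LIMSEQ_unique[rotated])
    moreover have "(LINT x|lebesgue_on S. grad S \<xi> x \<bullet> grad S T x) = (LINT x|lebesgue_on S. grad S \<xi> x \<bullet> G x)"
    proof (rule integral_cong_AE)
      show "AE x in lebesgue_on S. grad S \<xi> x \<bullet> grad S T x = grad S \<xi> x \<bullet> G x"
        using TG by eventually_elim simp
    qed (use L2_inner_integrable[OF H10_grad(2)[OF \<xi>] H10_grad(2)[OF TH]]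
        L2_inner_integrable[OF H10_grad(2)[OF \<xi>] G(1)] in auto)
    ultimately show "(LINT x|lebesgue_on S. grad S \<xi> x \<bullet> grad S T x) = F \<xi>" by simp
  qed
qed

section \<open>The logarithmic test function\<close>

lemma unit_disk_eq_ball: "unit_disk = ball 0 1"
  by (auto simp: unit_disk_def)

lemma unit_disk_domain: "open unit_disk" "bounded unit_disk" "unit_disk \<in> sets lebesgue"
  by (simp_all add: unit_disk_eq_ball)

lemma unit_disk_inner_le: "x \<in> unit_disk \<Longrightarrow> x \<bullet> x \<le> 1"
  by (simp add: unit_disk_def dot_square_norm power_le_one_iff abs_square_le_1)

lemma GDERIV_inner_self: "GDERIV (\<lambda>x. x \<bullet> x) x :> 2 *\<^sub>R x"
  unfolding gderiv_def by (auto intro!: derivative_eq_intros simp: inner_commute)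

lemma GDERIV_inner_const: "GDERIV (\<lambda>x. x \<bullet> b) x :> b"
  unfolding gderiv_def by (rule bounded_linear_imp_has_derivative[OF bounded_linear_inner_left])

lemma GDERIV_radial:
  assumes "(f has_real_derivative f') (at (x \<bullet> x))"
  shows "GDERIV (\<lambda>x. f (x \<bullet> x)) x :> (2 * f') *\<^sub>R x"
  using GDERIV_DERIV_compose[OF GDERIV_inner_self assms] by (simp add: mult.commute)

text \<open>
  A function of \<open>y = \<bar>x\<bar>\<^sup>2\<close> that behaves like \<open>1 / (1 - y)\<close> up to distance of order \<open>\<epsilon>\<close> from \<open>y = 1\<close> and vanishes
  smoothly at \<open>y = 1 - \<epsilon>\<close>. With \<open>z = 1 - \<epsilon> - y\<close> it equals \<open>exp (- \<epsilon> / z) / z\<close> for \<open>z > 0\<close>.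
\<close>

definition slope :: "real \<Rightarrow> real \<Rightarrow> real" where
  "slope \<epsilon> y = flat \<epsilon> 1 (1 - \<epsilon> - y)"

lemma slope_nonneg: "0 \<le> slope \<epsilon> y"
  by (simp add: slope_def flat_nonneg)

lemma slope_eq_0: "y \<ge> 1 - \<epsilon> \<Longrightarrow> slope \<epsilon> y = 0"
  by (simp add: slope_def flat_def)

text \<open>
  Equivalent to \<open>(1 + t) exp (- t) \<le> 1\<close> for \<open>t = \<epsilon> / z\<close>. Shifting the zero of \<open>slope\<close> from \<open>1\<close> to \<open>1 - \<epsilon>\<close>
  leaves room for the compact support without losing the constant \<open>1\<close>.
\<close>

lemma slope_le:
  assumes "\<epsilon> > 0"
  shows "(1 - y) * slope \<epsilon> y \<le> 1"
proof (cases "y < 1 - \<epsilon>")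
  case True
  define z where "z = 1 - \<epsilon> - y"
  have z: "z > 0" using True by (simp add: z_def)
  have "(1 - y) * slope \<epsilon> y = (1 + \<epsilon> / z) * exp (- (\<epsilon> / z))"
    unfolding slope_def z_def[symmetric] using z by (simp add: flat_def z_def field_simps)
  also have "\<dots> \<le> exp (\<epsilon> / z) * exp (- (\<epsilon> / z))"
    by (intro mult_right_mono) auto
  also have "\<dots> = 1" by (simp add: exp_minus)
  finally show ?thesis .
qed (simp add: slope_eq_0)

lemma Ck_slope:
  assumes "\<epsilon> > 0"
  shows "Ck k (slope \<epsilon>)"
proof -
  have "Ck k (\<lambda>y::real. (1 - \<epsilon>) - y)"
    by (rule Ck_diff[OF Ck_const Ck_bounded_linear[OF bounded_linear_ident]])
  from Ck_compose[OF Ck_flat[OF assms] this] show ?thesis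
    unfolding slope_def[abs_def] by simp
qed

text \<open>
  The antiderivative has no closed form. As \<open>slope \<epsilon>\<close> vanishes from \<open>1 - \<epsilon>\<close> on, normalising at \<open>1\<close> makes it
  vanish there as well.
\<close>

definition profile :: "real \<Rightarrow> real \<Rightarrow> real" where
  "profile \<epsilon> = (SOME P. (\<forall>y. (P has_real_derivative - slope \<epsilon> y) (at y)) \<and> P 1 = 0)"

lemma profile_deriv:
  assumes "\<epsilon> > 0"
  shows "(profile \<epsilon> has_real_derivative - slope \<epsilon> y) (at y)" and "profile \<epsilon> 1 = 0"
proof -
  have "continuous_on UNIV (slope \<epsilon>)" by (rule Ck_imp_continuous[OF Ck_slope[OF assms]])
  then have "\<exists>F. \<forall>x::real. - \<infinity> < ereal x \<longrightarrow> ereal x < \<infinity> \<longrightarrow> (F has_vector_derivative slope \<epsilon> x) (at x)"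
    by (intro einterval_antiderivative) (auto simp: continuous_on_eq_continuous_at)
  then obtain F where F: "\<And>x. (F has_real_derivative slope \<epsilon> x) (at x)"
    by (auto simp: has_real_derivative_iff_has_vector_derivative)
  have "\<exists>P. (\<forall>y. (P has_real_derivative - slope \<epsilon> y) (at y)) \<and> P 1 = 0"
  proof (intro exI conjI allI)
    show "((\<lambda>y. F 1 - F y) has_real_derivative - slope \<epsilon> y) (at y)" for y
      using DERIV_diff[OF DERIV_const F, of "F 1" y] by simp
  qed simp
  from someI_ex[OF this] show "(profile \<epsilon> has_real_derivative - slope \<epsilon> y) (at y)" "profile \<epsilon> 1 = 0"
    unfolding profile_def by blast+
qed

lemma profile_antimono:
  assumes "\<epsilon> > 0" "x \<le> y"
  shows "profile \<epsilon> y \<le> profile \<epsilon> x"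
  using DERIV_nonpos_imp_nonincreasing[OF assms(2), of "profile \<epsilon>"] profile_deriv(1)[OF assms(1)] slope_nonneg
  by (metis neg_le_0_iff_le)

lemma profile_eq_0:
  assumes \<epsilon>: "\<epsilon> > 0" and y: "y \<ge> 1 - \<epsilon>"
  shows "profile \<epsilon> y = 0"
proof -
  have "profile \<epsilon> a = profile \<epsilon> b" if "a \<le> b" "1 - \<epsilon> \<le> a" for a b
  proof (rule antisym)
    show "profile \<epsilon> a \<le> profile \<epsilon> b"
    proof (rule DERIV_nonneg_imp_nondecreasing[OF that(1)])
      fix x assume "a \<le> x"
      then have "slope \<epsilon> x = 0" using that(2) by (intro slope_eq_0) simp
      then show "\<exists>y. (profile \<epsilon> has_real_derivative y) (at x) \<and> 0 \<le> y"
        using profile_deriv(1)[OF \<epsilon>, of x] by auto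
    qed
  qed (rule profile_antimono[OF \<epsilon> that(1)])
  from this[of y 1] this[of 1 y] show ?thesis
    using profile_deriv(2)[OF \<epsilon>] y \<epsilon> by (cases "y \<le> 1") auto
qed

lemma profile_nonneg: "\<epsilon> > 0 \<Longrightarrow> 0 \<le> profile \<epsilon> y"
  using profile_antimono[of \<epsilon> y "max y 1"] profile_eq_0[of \<epsilon> "max y 1"] by simp

text \<open>
  Since \<open>exp (- t) \<ge> 1 - t\<close>, the slope is at least \<open>1 / z - \<epsilon> / z\<^sup>2\<close>, which is the derivative of
  \<open>ln z + \<epsilon> / z\<close> in \<open>z = 1 - \<epsilon> - y\<close>. Comparing the two from \<open>z = \<epsilon>\<close> to \<open>z = 1 / 2 - \<epsilon>\<close> gives the logarithm.
\<close>

lemma profile_half_ge: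
  assumes \<epsilon>: "\<epsilon> > 0" "\<epsilon> \<le> 1/8"
  shows "ln (3 / (8 * \<epsilon>)) - 1 \<le> profile \<epsilon> (1/2)"
proof -
  define H where "H y = ln (1 - \<epsilon> - y) + \<epsilon> / (1 - \<epsilon> - y)" for y
  have "profile \<epsilon> (1 - 2 * \<epsilon>) - H (1 - 2 * \<epsilon>) \<le> profile \<epsilon> (1/2) - H (1/2)"
  proof (rule DERIV_nonpos_imp_nonincreasing[where f = "\<lambda>y. profile \<epsilon> y - H y"])
    show "1 / 2 \<le> 1 - 2 * \<epsilon>" using \<epsilon> by simp
    fix y assume y: "1 / 2 \<le> y" "y \<le> 1 - 2 * \<epsilon>"
    define z where "z = 1 - \<epsilon> - y"
    have z: "z > 0" using y \<epsilon> by (simp add: z_def)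
    have H': "(H has_real_derivative - (1 / z) + \<epsilon> / z\<^sup>2) (at y)"
      unfolding H_def[abs_def] using z
      by (auto intro!: derivative_eq_intros simp: z_def power2_eq_square)
    have D: "((\<lambda>y. profile \<epsilon> y - H y) has_real_derivative (- slope \<epsilon> y - (- (1 / z) + \<epsilon> / z\<^sup>2))) (at y)"
      by (rule DERIV_diff[OF profile_deriv(1)[OF \<epsilon>(1)] H'])
    have "slope \<epsilon> y = (1 / z) * exp (- \<epsilon> / z)"
      using z by (simp add: slope_def flat_def z_def)
    moreover have "(1 / z) * (1 + (- \<epsilon> / z)) \<le> (1 / z) * exp (- \<epsilon> / z)"
      by (rule mult_left_mono[OF exp_ge_add_one_self]) (use z in simp)
    moreover have "(1 / z) * (1 + (- \<epsilon> / z)) = 1 / z - \<epsilon> / z\<^sup>2"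
      using z by (simp add: power2_eq_square field_simps)
    ultimately have "- slope \<epsilon> y - (- (1 / z) + \<epsilon> / z\<^sup>2) \<le> 0" by linarith
    with D show "\<exists>d. ((\<lambda>y. profile \<epsilon> y - H y) has_real_derivative d) (at y) \<and> d \<le> 0" by blast
  qed
  moreover have "H (1 - 2 * \<epsilon>) = ln \<epsilon> + 1" using \<epsilon> by (simp add: H_def)
  moreover have "ln (3 / 8) \<le> H (1/2)"
  proof -
    have "ln (3 / 8) \<le> ln (1 / 2 - \<epsilon>)" using \<epsilon> by (subst ln_le_cancel_iff) auto
    moreover have "0 \<le> \<epsilon> / (1 / 2 - \<epsilon>)" using \<epsilon> by simp
    ultimately show ?thesis by (simp add: H_def)
  qed
  moreover have "ln (3 / (8 * \<epsilon>)) = ln (3 / 8) - ln \<epsilon>"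
    using \<epsilon> by (simp add: ln_div ln_mult)
  ultimately show ?thesis using profile_nonneg[OF \<epsilon>(1), of "1 - 2 * \<epsilon>"] by linarith
qed

definition cutoff :: "real \<Rightarrow> real^2 \<Rightarrow> real" where
  "cutoff \<epsilon> x = profile \<epsilon> (x \<bullet> x)"

lemma Ck_profile: "\<epsilon> > 0 \<Longrightarrow> Ck k (profile \<epsilon>)"
proof -
  assume \<epsilon>: "\<epsilon> > 0"
  have "Ck (Suc k) (profile \<epsilon>)"
    by (rule Ck_real_SucI[OF profile_deriv(1)[OF \<epsilon>]])
      (use Ck_cmult[OF Ck_slope[OF \<epsilon>], of k "-1"] in simp)
  then show ?thesis by (rule Ck_SucD)
qed

lemma cutoff_test_function:
  assumes \<epsilon>: "\<epsilon> > 0"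
  shows "cutoff \<epsilon> \<in> test_functions unit_disk"
proof (rule test_functionsI[where K = "{x. x \<bullet> x \<le> 1 - \<epsilon>}"])
  show "Ck k (cutoff \<epsilon>)" for k
    unfolding cutoff_def[abs_def] by (rule Ck_compose[OF Ck_profile[OF \<epsilon>] Ck_inner_self])
  have sub: "{x::real^2. x \<bullet> x \<le> 1 - \<epsilon>} \<subseteq> unit_disk"
  proof
    fix x :: "real^2" assume "x \<in> {x. x \<bullet> x \<le> 1 - \<epsilon>}"
    then have "(norm x)\<^sup>2 < 1" using \<epsilon> by (simp add: dot_square_norm)
    then show "x \<in> unit_disk" by (simp add: unit_disk_def abs_square_less_1)
  qed
  then show "{x::real^2. x \<bullet> x \<le> 1 - \<epsilon>} \<subseteq> unit_disk" .
  have "closed {x::real^2. x \<bullet> x \<le> 1 - \<epsilon>}" by (intro closed_Collect_le continuous_intros)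
  then show "compact {x::real^2. x \<bullet> x \<le> 1 - \<epsilon>}"
    using bounded_subset[OF unit_disk_domain(2) sub] by (simp add: compact_eq_bounded_closed)
  show "cutoff \<epsilon> x = 0" if "x \<notin> {x. x \<bullet> x \<le> 1 - \<epsilon>}" for x
    using that \<epsilon> by (simp add: cutoff_def profile_eq_0)
qed

lemma cutoff_GDERIV: "\<epsilon> > 0 \<Longrightarrow> GDERIV (cutoff \<epsilon>) x :> (- 2 * slope \<epsilon> (x \<bullet> x)) *\<^sub>R x"
  unfolding cutoff_def[abs_def] using GDERIV_radial[OF profile_deriv(1)] by simp

lemma measure_unit_disk: "measure lebesgue unit_disk = pi"
  by (simp add: unit_disk_eq_ball content_ball unit_ball_vol_2)

text \<open>
  The squared gradient is \<open>4 y (slope \<epsilon> y)\<^sup>2\<close> at \<open>y = x \<bullet> x\<close>. The antiderivative \<open>Q\<close> of \<open>- 2 (slope \<epsilon>)\<^sup>2\<close> is explicit and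
  at most \<open>1 / \<epsilon>\<close>, and the divergence of \<open>Q (x \<bullet> x) x\<close> is \<open>2 Q (x \<bullet> x)\<close> minus the squared gradient. The
  integral is therefore at most \<open>2 / \<epsilon>\<close> times the area of the disk.
\<close>

lemma cutoff_grad_norm:
  assumes \<epsilon>: "\<epsilon> > 0"
  shows "(L2_norm unit_disk (classical_grad (cutoff \<epsilon>)))\<^sup>2 \<le> 2 * pi / \<epsilon>"
proof -
  have \<epsilon>2: "2 * \<epsilon> > 0" using \<epsilon> by simp
  define Q where "Q y = flat (2 * \<epsilon>) 0 (1 - \<epsilon> - y) / \<epsilon>" for y
  have Q': "(Q has_real_derivative - 2 * (slope \<epsilon> y)\<^sup>2) (at y)" for y
  proof -
    have "(flat (2 * \<epsilon>) 0 has_real_derivative 2 * \<epsilon> * flat (2 * \<epsilon>) 2 z) (at z)" for z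
      using flat_has_derivative[OF \<epsilon>2, of 0 z] by (simp add: numeral_2_eq_2)
    moreover have "((\<lambda>y. 1 - \<epsilon> - y) has_real_derivative - 1) (at y)"
      by (auto intro!: derivative_eq_intros)
    ultimately have "((\<lambda>y. flat (2 * \<epsilon>) 0 (1 - \<epsilon> - y)) has_real_derivative
        (2 * \<epsilon> * flat (2 * \<epsilon>) 2 (1 - \<epsilon> - y)) * (- 1)) (at y)"
      by (rule DERIV_chain2)
    then have "(Q has_real_derivative (2 * \<epsilon> * flat (2 * \<epsilon>) 2 (1 - \<epsilon> - y)) * (- 1) / \<epsilon>) (at y)"
      unfolding Q_def[abs_def] by (rule DERIV_cdivide)
    moreover have "(slope \<epsilon> y)\<^sup>2 = flat (2 * \<epsilon>) 2 (1 - \<epsilon> - y)"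
      by (simp add: slope_def flat_def power2_eq_square flip: exp_add)
    ultimately show ?thesis using \<epsilon> by simp
  qed
  have slc: "continuous_on UNIV (slope \<epsilon>)" by (rule Ck_imp_continuous[OF Ck_slope[OF \<epsilon>]])
  have slc': "continuous_on UNIV (\<lambda>x::real^2. slope \<epsilon> (x \<bullet> x))"
    by (rule continuous_on_compose2[OF slc]) (auto intro!: continuous_intros)
  have "continuous_on UNIV Q"
    by (intro continuous_at_imp_continuous_on ballI DERIV_isCont[OF Q'])
  then have Qc: "continuous_on UNIV (\<lambda>x::real^2. Q (x \<bullet> x))"
    by (rule continuous_on_compose2) (auto intro!: continuous_intros)
  define d where "d b x = Q (x \<bullet> x) *\<^sub>R b + (x \<bullet> b) *\<^sub>R ((2 * (- 2 * (slope \<epsilon> (x \<bullet> x))\<^sup>2)) *\<^sub>R x)" for b x :: "real^2"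
  have G: "GDERIV (\<lambda>x. Q (x \<bullet> x) * (x \<bullet> b)) x :> d b x" for b x
    unfolding d_def by (rule GDERIV_mult[OF GDERIV_radial[OF Q'] GDERIV_inner_const])
  have dc: "continuous_on UNIV (d b)" for b
    unfolding d_def by (intro continuous_intros slc' Qc)
  have Q0: "Q (x \<bullet> x) = 0" if "x \<notin> cball 0 1" for x :: "real^2"
  proof -
    have "(norm x)\<^sup>2 > 1" using that by (simp add: one_less_power)
    then show ?thesis using \<epsilon> by (simp add: Q_def flat_def dot_square_norm)
  qed
  have out: "Q (x \<bullet> x) * (x \<bullet> b) = 0" if "x \<notin> cball 0 1" for x b :: "real^2"
    using Q0[OF that] by simp
  have i: "integrable lborel (\<lambda>x. d b x \<bullet> b)" "(LINT x|lborel. d b x \<bullet> b) = 0" for b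
    by (rule integral_gradient_component_eq_0[OF G dc compact_cball[of 0 1] out]; assumption)+
  define f where "f x = 2 * Q (x \<bullet> x) - 4 * (slope \<epsilon> (x \<bullet> x))\<^sup>2 * (x \<bullet> x)" for x :: "real^2"
  have "(\<Sum>b\<in>Basis. d b x \<bullet> b) = f x" for x
  proof -
    have "(\<Sum>b\<in>Basis. d b x \<bullet> b) =
        (\<Sum>b\<in>Basis. Q (x \<bullet> x) - 4 * (slope \<epsilon> (x \<bullet> x))\<^sup>2 * ((x \<bullet> b) * (x \<bullet> b)))"
      by (rule sum.cong) (auto simp: d_def inner_add_left algebra_simps)
    also have "\<dots> = f x"
      by (simp add: f_def sum_subtractf euclidean_inner[of x x] flip: sum_distrib_left)
    finally show ?thesis .
  qed
  then have "(LINT x|lborel. f x) = (\<Sum>b\<in>Basis. LINT x|lborel. d b x \<bullet> b)"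
    using i(1) by (subst Bochner_Integration.integral_sum[symmetric]) auto
  then have "(LINT x|lborel. f x) = 0" using i(2) by simp
  moreover have "(LINT x|lebesgue_on unit_disk. f x) = (LINT x|lborel. f x)"
  proof (rule integral_lebesgue_on_supported[OF _ unit_disk_domain(3)])
    show "continuous_on UNIV f" unfolding f_def by (intro continuous_intros slc' Qc)
    fix x :: "real^2" assume "x \<notin> unit_disk"
    then have "(norm x)\<^sup>2 \<ge> 1" by (simp add: unit_disk_def)
    then show "f x = 0" using \<epsilon> by (simp add: f_def Q_def flat_def slope_eq_0 dot_square_norm)
  qed
  ultimately have f0: "(LINT x|lebesgue_on unit_disk. f x) = 0" by simp
  note cL = continuous_imp_L2[OF unit_disk_domain(1,2)]
  note int = L2_imp_integrable[OF unit_disk_domain(1,2) cL]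
  have i1: "integrable (lebesgue_on unit_disk) (\<lambda>x. 2 * Q (x \<bullet> x))"
    by (rule int) (intro continuous_intros Qc)
  have i2: "integrable (lebesgue_on unit_disk) (\<lambda>x. 4 * (slope \<epsilon> (x \<bullet> x))\<^sup>2 * (x \<bullet> x))"
    by (rule int) (intro continuous_intros slc')
  have "classical_grad (cutoff \<epsilon>) x = (- 2 * slope \<epsilon> (x \<bullet> x)) *\<^sub>R x" for x
    by (rule classical_grad_eq[OF cutoff_GDERIV[OF \<epsilon>]])
  then have "(L2_norm unit_disk (classical_grad (cutoff \<epsilon>)))\<^sup>2 =
      (LINT x|lebesgue_on unit_disk. 4 * (slope \<epsilon> (x \<bullet> x))\<^sup>2 * (x \<bullet> x))"
    unfolding L2_norm_power2_inner by (simp add: power2_eq_square algebra_simps)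
  also have "\<dots> = (LINT x|lebesgue_on unit_disk. 2 * Q (x \<bullet> x))"
    using f0 i1 i2 unfolding f_def by simp
  also have "\<dots> \<le> (LINT x|lebesgue_on unit_disk. 2 / \<epsilon>)"
  proof (rule integral_mono[OF i1 integrable_const_lebesgue_on[OF unit_disk_domain(1,2)]])
    fix x :: "real^2"
    show "2 * Q (x \<bullet> x) \<le> 2 / \<epsilon>"
      using flat_0_le_1[OF \<epsilon>2, of "1 - \<epsilon> - x \<bullet> x"] \<epsilon> by (simp add: Q_def divide_right_mono)
  qed
  also have "\<dots> = 2 * pi / \<epsilon>"
    using measure_unit_disk unit_disk_domain(3) by (simp add: measure_restrict_space)
  finally show ?thesis .
qed

lemma cutoff_integral_ge:
  assumes \<epsilon>: "\<epsilon> > 0"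
  shows "pi / 2 * profile \<epsilon> (1/2) \<le> (LINT x|lebesgue_on unit_disk. cutoff \<epsilon> x)"
proof -
  define B where "B = ball (0::real^2) (sqrt (1/2))"
  have B: "B \<subseteq> unit_disk" unfolding B_def unit_disk_eq_ball by (rule subset_ball) simp
  have mB: "measure lebesgue B = pi / 2" unfolding B_def by (simp add: content_ball unit_ball_vol_2 real_sqrt_divide power_divide)
  have Bs: "B \<in> sets (lebesgue_on unit_disk)"
    using B unit_disk_domain(3) by (subst sets_restrict_space_iff) (auto simp: B_def)
  have fin: "finite_measure (lebesgue_on unit_disk)"
    by (rule finite_measure_lebesgue_on[OF lmeasurable_open[OF unit_disk_domain(2,1)]])
  have ci: "integrable (lebesgue_on unit_disk) (cutoff \<epsilon>)"
    by (rule L2_imp_integrable[OF unit_disk_domain(1,2) test_functions_L2(1)[OF unit_disk_domain(1,2) cutoff_test_function[OF \<epsilon>]]])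
  have bi: "integrable (lebesgue_on unit_disk) (\<lambda>x. indicator B x * profile \<epsilon> (1/2))"
    by (intro integrable_mult_left integrable_real_indicator Bs)
      (simp add: finite_measure.emeasure_finite[OF fin] less_top[symmetric])
  have "(LINT x|lebesgue_on unit_disk. indicator B x * profile \<epsilon> (1/2)) \<le> (LINT x|lebesgue_on unit_disk. cutoff \<epsilon> x)"
  proof (rule integral_mono[OF bi ci])
    fix x :: "real^2"
    show "indicator B x * profile \<epsilon> (1/2) \<le> cutoff \<epsilon> x"
    proof (cases "x \<in> B")
      case True
      then have "(norm x)\<^sup>2 \<le> (sqrt (1/2))\<^sup>2" unfolding B_def by (intro power_mono) auto
      then have "x \<bullet> x \<le> 1/2" by (simp add: dot_square_norm)
      then show ?thesis using True profile_antimono[OF \<epsilon>] by (simp add: cutoff_def)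
    qed (simp add: cutoff_def profile_nonneg \<epsilon>)
  qed
  moreover have "measure (lebesgue_on unit_disk) B = pi / 2"
    using mB B unit_disk_domain(3) by (subst measure_restrict_space) auto
  ultimately show ?thesis
    using Int_absorb2[OF B] by simp
qed

section \<open>Averages along rays\<close>

text \<open>
  Rotation by a right angle; \<open>\<nabla>v \<bullet> perp x\<close> is the angular derivative of \<open>v\<close>.
\<close>

definition perp :: "real^2 \<Rightarrow> real^2" where
  "perp x = (\<chi> i. if i = 1 then - x $ 2 else x $ 1)"

lemma perp_nth [simp]: "perp x $ 1 = - x $ 2" "perp x $ 2 = x $ 1"
  by (simp_all add: perp_def)

lemma inner_real2: "x \<bullet> y = x $ 1 * y $ 1 + x $ 2 * y $ 2" for x y :: "real^2"
  by (simp add: inner_vec_def sum_2)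

lemma inner_perp_self [simp]: "x \<bullet> perp x = 0"
  by (simp add: inner_real2)

lemma norm_perp [simp]: "norm (perp x) = norm x"
  by (simp add: norm_eq_sqrt_inner inner_real2 add.commute)

lemma perp_scaleR: "perp (c *\<^sub>R x) = c *\<^sub>R perp x"
  by (simp add: vec_eq_iff forall_2)

lemma perp_decomposition: "(x \<bullet> x) *\<^sub>R v = (x \<bullet> v) *\<^sub>R x + (v \<bullet> perp x) *\<^sub>R perp x"
  by (simp add: vec_eq_iff forall_2 inner_real2 algebra_simps)

lemma inner_perp_eq: "v \<bullet> perp x = (x \<bullet> axis 1 1) * (v \<bullet> axis 2 1) - (x \<bullet> axis 2 1) * (v \<bullet> axis 1 1)"
  by (simp add: inner_real2 axis_def)

lemma continuous_perp: "continuous_on S perp"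
  unfolding perp_def[abs_def]
proof (rule continuous_on_vec_lambda)
  show "continuous_on S (\<lambda>x. if i = 1 then - x $ 2 else x $ 1)" for i
    by (cases "i = 1") (auto intro!: continuous_intros)
qed

text \<open>
  The solution of \<open>2 M + x \<bullet> \<nabla>M = G\<close> that is regular at the origin (\<open>ray_avg_euler\<close>).
\<close>

definition ray_avg :: "('a::euclidean_space \<Rightarrow> real) \<Rightarrow> 'a \<Rightarrow> real" where
  "ray_avg G x = integral {0..1} (\<lambda>s. s * G (s *\<^sub>R x))"

lemma continuous_on_ray:
  fixes d :: "'a::euclidean_space \<Rightarrow> 'b::euclidean_space"
  assumes "continuous_on UNIV d"
  shows "continuous_on S (\<lambda>(x, s). d (s *\<^sub>R x))" "continuous_on T (\<lambda>s. d (s *\<^sub>R x))"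
proof -
  have "continuous_on S (\<lambda>p. d (snd p *\<^sub>R fst p))"
    by (intro continuous_on_compose2[OF assms] continuous_intros) auto
  then show "continuous_on S (\<lambda>(x, s). d (s *\<^sub>R x))" by (simp add: case_prod_beta')
  show "continuous_on T (\<lambda>s. d (s *\<^sub>R x))"
    by (intro continuous_on_compose2[OF assms] continuous_intros) auto
qed

lemma GDERIV_ray_avg:
  fixes G :: "'a::euclidean_space \<Rightarrow> real"
  assumes G: "\<And>x. GDERIV G x :> d x" and d: "continuous_on UNIV d"
  shows "GDERIV (ray_avg G) x :> integral {0..1} (\<lambda>s. s\<^sup>2 *\<^sub>R d (s *\<^sub>R x))"
proof -
  have Gc: "continuous_on UNIV G"
    by (rule GDERIV_imp_continuous_on[OF G])
  define fx where "fx x s = blinfun_inner_left (s\<^sup>2 *\<^sub>R d (s *\<^sub>R x))" for x and s :: real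
  have "((\<lambda>x. integral (cbox 0 1) (\<lambda>s. s * G (s *\<^sub>R x))) has_derivative integral (cbox 0 1) (fx x)) (at x within UNIV)"
  proof (rule leibniz_rule)
    fix x and s :: real
    have "((\<lambda>x. G (s *\<^sub>R x)) has_derivative (\<lambda>h. (s *\<^sub>R h) \<bullet> d (s *\<^sub>R x))) (at x)"
      by (rule has_derivative_compose[OF _ G[unfolded gderiv_def]])
        (auto intro!: derivative_eq_intros)
    then have "((\<lambda>x. s * G (s *\<^sub>R x)) has_derivative (\<lambda>h. s * ((s *\<^sub>R h) \<bullet> d (s *\<^sub>R x)))) (at x)"
      by (rule has_derivative_mult_right)
    moreover have "(\<lambda>h. s * ((s *\<^sub>R h) \<bullet> d (s *\<^sub>R x))) = blinfun_apply (fx x s)"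
      by (auto simp: fx_def fun_eq_iff power2_eq_square)
    ultimately show "((\<lambda>x. s * G (s *\<^sub>R x)) has_derivative blinfun_apply (fx x s)) (at x within UNIV)" by simp
  next
    fix x :: 'a
    show "(\<lambda>s. s * G (s *\<^sub>R x)) integrable_on cbox 0 1"
      by (intro integrable_continuous continuous_intros continuous_on_ray Gc)
  next
    show "continuous_on (UNIV \<times> cbox 0 1) (\<lambda>(x, t). fx x t)"
    proof -
      have "continuous_on (UNIV \<times> cbox 0 1) (\<lambda>p. (snd p)\<^sup>2 *\<^sub>R d (snd p *\<^sub>R fst p))"
        using continuous_on_ray(1)[OF d, of "UNIV \<times> cbox 0 1"]
        by (intro continuous_intros) (simp add: case_prod_beta')
      then show ?thesis unfolding fx_def case_prod_beta'
        by (rule bounded_linear.continuous_on[OF bounded_linear_blinfun_inner_left])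
    qed
  qed auto
  moreover have "blinfun_apply (integral (cbox 0 1) (fx x)) = (\<lambda>h. h \<bullet> integral (cbox 0 1) (\<lambda>s. s\<^sup>2 *\<^sub>R d (s *\<^sub>R x)))"
  proof -
    have "(\<lambda>s. s\<^sup>2 *\<^sub>R d (s *\<^sub>R x)) integrable_on cbox 0 1"
      by (intro integrable_continuous continuous_intros continuous_on_ray d)
    from integral_linear[OF this bounded_linear_blinfun_inner_left]
    have "integral (cbox 0 1) (fx x) = blinfun_inner_left (integral (cbox 0 1) (\<lambda>s. s\<^sup>2 *\<^sub>R d (s *\<^sub>R x)))"
      unfolding fx_def o_def .
    then show ?thesis by simp
  qed
  ultimately show ?thesis unfolding gderiv_def ray_avg_def[abs_def] by simp
qed

lemma continuous_ray_avg_grad: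
  fixes d :: "'a::euclidean_space \<Rightarrow> 'a"
  assumes d: "continuous_on UNIV d"
  shows "continuous_on UNIV (\<lambda>x. integral {0..1} (\<lambda>s. s\<^sup>2 *\<^sub>R d (s *\<^sub>R x)))"
proof -
  have "continuous_on (UNIV \<times> cbox 0 1) (\<lambda>(x, s::real). s\<^sup>2 *\<^sub>R d (s *\<^sub>R x))"
    using continuous_on_ray(1)[OF d, of "UNIV \<times> cbox 0 1"]
    unfolding case_prod_beta' by (intro continuous_intros)
  from integral_continuous_on_param[OF this] show ?thesis by simp
qed

text \<open>
  The left-hand side is the integral of the derivative of \<open>s\<^sup>2 G (s x)\<close> over \<open>0 \<le> s \<le> 1\<close>.
\<close>

lemma ray_avg_euler:
  fixes G :: "'a::euclidean_space \<Rightarrow> real"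
  assumes G: "\<And>x. GDERIV G x :> d x" and d: "continuous_on UNIV d"
  shows "2 * ray_avg G x + x \<bullet> integral {0..1} (\<lambda>s. s\<^sup>2 *\<^sub>R d (s *\<^sub>R x)) = G x"
proof -
  have Gc: "continuous_on UNIV G"
    by (rule GDERIV_imp_continuous_on[OF G])
  have "((\<lambda>s. 2 * (s * G (s *\<^sub>R x)) + x \<bullet> (s\<^sup>2 *\<^sub>R d (s *\<^sub>R x))) has_integral
      1\<^sup>2 * G (1 *\<^sub>R x) - 0\<^sup>2 * G (0 *\<^sub>R x)) {0..1}"
  proof (rule fundamental_theorem_of_calculus)
    fix s :: real
    have "((\<lambda>s. G (s *\<^sub>R x)) has_derivative (\<lambda>h. (h *\<^sub>R x) \<bullet> d (s *\<^sub>R x))) (at s)"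
      by (rule has_derivative_compose[OF _ G[unfolded gderiv_def]])
        (auto intro!: derivative_eq_intros)
    then have "((\<lambda>s. G (s *\<^sub>R x)) has_real_derivative (x \<bullet> d (s *\<^sub>R x))) (at s)"
      by (simp add: has_field_derivative_def mult_commute_abs)
    then have "((\<lambda>s. s\<^sup>2 * G (s *\<^sub>R x)) has_real_derivative
        2 * (s * G (s *\<^sub>R x)) + x \<bullet> (s\<^sup>2 *\<^sub>R d (s *\<^sub>R x))) (at s)"
      by (auto intro!: derivative_eq_intros)
    then show "((\<lambda>s. s\<^sup>2 * G (s *\<^sub>R x)) has_vector_derivative
        2 * (s * G (s *\<^sub>R x)) + x \<bullet> (s\<^sup>2 *\<^sub>R d (s *\<^sub>R x))) (at s within {0..1})"
      by (simp add: has_real_derivative_iff_has_vector_derivative has_vector_derivative_at_within)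
  qed simp
  then have eq: "integral {0..1} (\<lambda>s. 2 * (s * G (s *\<^sub>R x)) + x \<bullet> (s\<^sup>2 *\<^sub>R d (s *\<^sub>R x))) = G x"
    by (simp add: integral_unique)
  have i1: "(\<lambda>s. s * G (s *\<^sub>R x)) integrable_on {0..1}"
    by (intro integrable_continuous_real continuous_intros continuous_on_ray Gc)
  have i2: "(\<lambda>s. s\<^sup>2 *\<^sub>R d (s *\<^sub>R x)) integrable_on {0..1}"
    by (intro integrable_continuous_real continuous_intros continuous_on_ray d)
  have i3: "(\<lambda>s. x \<bullet> (s\<^sup>2 *\<^sub>R d (s *\<^sub>R x))) integrable_on {0..1}"
    by (intro integrable_continuous_real continuous_intros continuous_on_ray d)
  have "integral {0..1} (\<lambda>s. x \<bullet> (s\<^sup>2 *\<^sub>R d (s *\<^sub>R x))) = x \<bullet> integral {0..1} (\<lambda>s. s\<^sup>2 *\<^sub>R d (s *\<^sub>R x))"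
    using integral_linear[OF i2 bounded_linear_inner_right[of x]] by (simp add: o_def)
  moreover have "integral {0..1} (\<lambda>s. 2 * (s * G (s *\<^sub>R x)) + x \<bullet> (s\<^sup>2 *\<^sub>R d (s *\<^sub>R x))) =
      2 * ray_avg G x + integral {0..1} (\<lambda>s. x \<bullet> (s\<^sup>2 *\<^sub>R d (s *\<^sub>R x)))"
    using i1 i3 by (simp add: Henstock_Kurzweil_Integration.integral_add ray_avg_def)
  ultimately show ?thesis using eq by simp
qed

text \<open>
  Averaging along rays commutes with rotations about the origin, hence with the angular derivative.
\<close>

lemma ray_avg_rotation:
  fixes G :: "real^2 \<Rightarrow> real"
  assumes d: "continuous_on UNIV d"
  shows "ray_avg (\<lambda>y. d y \<bullet> perp y) x = integral {0..1} (\<lambda>s. s\<^sup>2 *\<^sub>R d (s *\<^sub>R x)) \<bullet> perp x"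
proof -
  have i2: "(\<lambda>s. s\<^sup>2 *\<^sub>R d (s *\<^sub>R x)) integrable_on {0..1}"
    by (intro integrable_continuous_real continuous_intros continuous_on_ray d)
  have "integral {0..1} (\<lambda>s. s\<^sup>2 *\<^sub>R d (s *\<^sub>R x)) \<bullet> perp x = integral {0..1} (\<lambda>s. (s\<^sup>2 *\<^sub>R d (s *\<^sub>R x)) \<bullet> perp x)"
    using integral_linear[OF i2 bounded_linear_inner_left[of "perp x"]] by (simp add: o_def)
  then show ?thesis by (simp add: ray_avg_def perp_scaleR power2_eq_square mult.assoc)
qed

section \<open>A Hardy inequality at the boundary\<close>

lemma locally_lipschitz_mult:
  fixes f g :: "'a::euclidean_space \<Rightarrow> real"
  assumes f: "\<And>r. \<exists>K. K-lipschitz_on (cball 0 r) f" and g: "\<And>r. \<exists>K. K-lipschitz_on (cball 0 r) g"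
  shows "\<exists>K. K-lipschitz_on (cball 0 r) (\<lambda>x. f x * g x)"
proof -
  obtain K L where K: "K-lipschitz_on (cball 0 r) f" and L: "L-lipschitz_on (cball 0 r) g"
    using f g by blast
  have "\<exists>B. \<forall>x\<in>cball 0 r. norm (h x) \<le> B" if "C-lipschitz_on (cball 0 r) h" for h :: "'a \<Rightarrow> real" and C
  proof -
    have "bounded (h ` cball 0 r)"
      by (intro compact_imp_bounded compact_continuous_image lipschitz_on_continuous_on[OF that] compact_cball)
    then show ?thesis by (auto simp: bounded_iff)
  qed
  from this[OF K] this[OF L] obtain A B
    where A: "\<And>x. x \<in> cball 0 r \<Longrightarrow> \<bar>f x\<bar> \<le> A" and B: "\<And>x. x \<in> cball 0 r \<Longrightarrow> \<bar>g x\<bar> \<le> B"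
    unfolding real_norm_def by blast
  have "(\<bar>A\<bar> * L + \<bar>B\<bar> * K)-lipschitz_on (cball 0 r) (\<lambda>x. f x * g x)"
  proof (rule lipschitz_onI)
    fix x y :: 'a assume xy: "x \<in> cball 0 r" "y \<in> cball 0 r"
    have "f x * g x - f y * g y = f x * (g x - g y) + g y * (f x - f y)" by (simp add: algebra_simps)
    then have "\<bar>f x * g x - f y * g y\<bar> \<le> \<bar>f x\<bar> * \<bar>g x - g y\<bar> + \<bar>g y\<bar> * \<bar>f x - f y\<bar>"
      by (metis abs_mult abs_triangle_ineq)
    also have "\<dots> \<le> \<bar>A\<bar> * (L * dist x y) + \<bar>B\<bar> * (K * dist x y)"
      using lipschitz_onD[OF L xy] lipschitz_onD[OF K xy] A[OF xy(1)] B[OF xy(2)]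
      by (intro add_mono mult_mono) (auto simp: dist_real_def)
    finally show "dist (f x * g x) (f y * g y) \<le> (\<bar>A\<bar> * L + \<bar>B\<bar> * K) * dist x y"
      by (simp add: dist_real_def algebra_simps)
  qed (use lipschitz_on_nonneg[OF K] lipschitz_on_nonneg[OF L] in simp)
  then show ?thesis by blast
qed

lemma lipschitz_on_max_0:
  fixes f :: "'a::euclidean_space \<Rightarrow> real"
  assumes "K-lipschitz_on S f"
  shows "K-lipschitz_on S (\<lambda>x. max 0 (f x))"
proof (rule lipschitz_onI)
  fix x y assume "x \<in> S" "y \<in> S"
  then have "dist (f x) (f y) \<le> K * dist x y" by (rule lipschitz_onD[OF assms])
  then show "dist (max 0 (f x)) (max 0 (f y)) \<le> K * dist x y"
    unfolding dist_real_def by linarith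
qed (rule lipschitz_on_nonneg[OF assms])

text \<open>
  The integrand is the derivative in direction \<open>b\<close> of \<open>(1 - x \<bullet> x) * v x\<close>. The weight vanishes on the
  circle, so extension by \<open>0\<close> outside the disk is Lipschitz and no boundary term appears.
\<close>

lemma integral_weighted_component_eq_0:
  fixes v :: "real^2 \<Rightarrow> real"
  assumes v: "\<And>x. GDERIV v x :> n x" and n: "continuous_on UNIV n"
  shows "(LINT x|lebesgue_on unit_disk. ((1 - x \<bullet> x) *\<^sub>R n x - (2 * v x) *\<^sub>R x) \<bullet> b) = 0"
proof -
  define e where "e x = (1 - x \<bullet> x) *\<^sub>R n x - (2 * v x) *\<^sub>R x" for x
  define w where "w x = max 0 (1 - x \<bullet> x) * v x" for x
  define g where "g x = indicator unit_disk x * (e x \<bullet> b)" for x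
  have vc: "continuous_on UNIV v"
    by (rule GDERIV_imp_continuous_on[OF v])
  have ec: "continuous_on UNIV e" unfolding e_def by (intro continuous_intros n vc)
  have k: "GDERIV (\<lambda>x. 1 - x \<bullet> x) x :> - 2 *\<^sub>R x" for x :: "real^2"
    using GDERIV_diff[OF GDERIV_const GDERIV_inner_self, of 1 x] by simp
  have kv: "GDERIV (\<lambda>x. (1 - x \<bullet> x) * v x) x :> e x" for x
    using GDERIV_mult[OF k v, of x] by (simp add: e_def mult.commute)
  have "\<exists>K. K-lipschitz_on (cball 0 r) (\<lambda>x::real^2. 1 - x \<bullet> x)" for r
    by (rule locally_lipschitz_of_continuous_GDERIV[OF k]) (intro continuous_intros)
  then have "\<exists>K. K-lipschitz_on (cball 0 r) (\<lambda>x::real^2. max 0 (1 - x \<bullet> x))" for r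
    using lipschitz_on_max_0 by blast
  then have lip: "\<exists>K. K-lipschitz_on (cball 0 r) w" for r
    unfolding w_def by (intro locally_lipschitz_mult locally_lipschitz_of_continuous_GDERIV[OF v n])
  have supp: "w x = 0" if "norm x > 1" for x
    using that one_less_power[of "norm x" 2] by (simp add: w_def dot_square_norm)
  have der: "AE x in lborel. ((\<lambda>t. w (x + t *\<^sub>R b)) has_real_derivative g x) (at 0)"
  proof -
    have "sphere (0::real^2) 1 \<in> null_sets lborel"
      using negligible_sphere[of "0::real^2" 1] by (simp add: negligible_iff_null_sets null_sets_completion_iff)
    then have "AE x in lborel. x \<notin> sphere (0::real^2) 1" by (rule AE_not_in)
    then show ?thesis
    proof eventually_elim
      fix x :: "real^2" assume x: "x \<notin> sphere 0 1"
      show "((\<lambda>t. w (x + t *\<^sub>R b)) has_real_derivative g x) (at 0)"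
      proof (cases "x \<in> unit_disk")
        case True
        have "(w has_derivative (\<lambda>h. h \<bullet> e x)) (at x)"
          by (rule has_derivative_transform_within_open[OF kv[unfolded gderiv_def] unit_disk_domain(1) True])
            (auto simp: w_def max_def dest: unit_disk_inner_le)
        then have "GDERIV w x :> e x" by (simp add: gderiv_def)
        then show ?thesis using GDERIV_directional[of w x "e x" b] True by (simp add: g_def)
      next
        case False
        then have "norm x > 1" using x by (simp add: unit_disk_def)
        have "(w has_derivative (\<lambda>h. 0)) (at x)"
          by (rule has_derivative_transform_within_open[of "\<lambda>x. 0" _ _ _ "- cball 0 1"])
            (use \<open>norm x > 1\<close> in \<open>auto simp: supp open_Compl\<close>)
        then have "GDERIV w x :> 0" by (simp add: gderiv_def)
        then show ?thesis using GDERIV_directional[of w x 0 b] False by (simp add: g_def)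
      qed
    qed
  qed
  have gm: "g \<in> borel_measurable borel"
  proof -
    have "(\<lambda>x. e x \<bullet> b) \<in> borel_measurable borel"
      by (intro borel_measurable_continuous_onI continuous_intros ec)
    moreover have "unit_disk \<in> sets borel" using unit_disk_domain(1) by simp
    ultimately show ?thesis unfolding g_def by measurable
  qed
  have "integral\<^sup>L lborel g = 0"
    by (rule integral_directional_derivative_eq_0(2)[OF lip supp der gm])
  then have "integral\<^sup>L lebesgue g = 0" using gm by (simp add: integral_completion)
  then show ?thesis
    using unit_disk_domain(3) by (subst integral_restrict_space) (auto simp: g_def[abs_def] e_def)
qed

text \<open>
  A Hardy inequality at the boundary circle, dual to the usual one. Using the transport equation, the
  divergence of \<open>(1 - x \<bullet> x) N\<^sup>2 x\<close> equals \<open>2 N (1 - x \<bullet> x) q - 2 N\<^sup>2\<close>. It integrates to \<open>0\<close>, so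
  \<open>\<parallel>N\<parallel>\<^sup>2 = \<integral> N (1 - x \<bullet> x) q\<close>.
\<close>

lemma hardy_unit_disk:
  fixes N :: "real^2 \<Rightarrow> real"
  assumes N: "\<And>x. GDERIV N x :> n x" and n: "continuous_on UNIV n"
    and q: "\<And>x. q x = 2 * N x + x \<bullet> n x"
  shows "L2_norm unit_disk N \<le> L2_norm unit_disk (\<lambda>x. (1 - x \<bullet> x) * q x)"
proof -
  have Nc: "continuous_on UNIV N"
    by (rule GDERIV_imp_continuous_on[OF N])
  define d where "d b x = (N x * N x) *\<^sub>R b + (x \<bullet> b) *\<^sub>R (N x *\<^sub>R n x + N x *\<^sub>R n x)" for b x
  have G: "GDERIV (\<lambda>x. (N x * N x) * (x \<bullet> b)) x :> d b x" for b x
    unfolding d_def by (intro GDERIV_mult N GDERIV_inner_const)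
  have dc: "continuous_on UNIV (d b)" for b unfolding d_def by (intro continuous_intros Nc n)
  define E where "E b x = ((1 - x \<bullet> x) *\<^sub>R d b x - (2 * (N x * N x * (x \<bullet> b))) *\<^sub>R x) \<bullet> b" for b x
  have E0: "(LINT x|lebesgue_on unit_disk. E b x) = 0" for b
    unfolding E_def by (rule integral_weighted_component_eq_0[OF G dc])
  note cL = continuous_imp_L2[OF unit_disk_domain(1,2)]
  note int = L2_imp_integrable[OF unit_disk_domain(1,2) cL]
  have Ei: "integrable (lebesgue_on unit_disk) (E b)" for b
    unfolding E_def by (rule int) (intro continuous_intros dc Nc)
  have qc: "continuous_on UNIV (\<lambda>x. (1 - x \<bullet> x) * q x)"
    unfolding q by (intro continuous_intros Nc n)
  have sum: "(\<Sum>b\<in>Basis. E b x) = 2 * (N x \<bullet> ((1 - x \<bullet> x) * q x)) - 2 * (N x \<bullet> N x)" for x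
  proof -
    have "(\<Sum>b\<in>Basis. E b x) = (\<Sum>b\<in>(Basis :: (real^2) set). (1 - x \<bullet> x) * (N x * N x)
        + (2 * (1 - x \<bullet> x) * N x) * ((x \<bullet> b) * (n x \<bullet> b)) - (2 * (N x * N x)) * ((x \<bullet> b) * (x \<bullet> b)))"
    proof (rule sum.cong)
      fix b :: "real^2" assume "b \<in> Basis"
      then have "d b x \<bullet> b = N x * N x + 2 * (x \<bullet> b) * N x * (n x \<bullet> b)"
        unfolding d_def inner_add_left inner_scaleR_left by (simp add: algebra_simps)
      then show "E b x = (1 - x \<bullet> x) * (N x * N x) + (2 * (1 - x \<bullet> x) * N x) * ((x \<bullet> b) * (n x \<bullet> b))
          - (2 * (N x * N x)) * ((x \<bullet> b) * (x \<bullet> b))"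
        unfolding E_def inner_diff_left inner_scaleR_left by (simp add: algebra_simps)
    qed simp
    also have "\<dots> = 2 * ((1 - x \<bullet> x) * (N x * N x)) + (2 * (1 - x \<bullet> x) * N x) * (x \<bullet> n x)
        - (2 * (N x * N x)) * (x \<bullet> x)"
      by (simp add: sum.distrib sum_subtractf euclidean_inner[of x x] euclidean_inner[of x "n x"] flip: sum_distrib_left)
    finally show ?thesis by (simp add: q algebra_simps)
  qed
  have "(LINT x|lebesgue_on unit_disk. (\<Sum>b\<in>Basis. E b x)) = 0"
    using Ei E0 by (subst Bochner_Integration.integral_sum) auto
  then have eq: "(LINT x|lebesgue_on unit_disk. N x \<bullet> ((1 - x \<bullet> x) * q x)) = (LINT x|lebesgue_on unit_disk. N x \<bullet> N x)"
    unfolding sum using L2_inner_integrable[OF cL[OF Nc] cL[OF qc]] L2_inner_integrable[OF cL[OF Nc] cL[OF Nc]]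
    by simp
  have "(L2_norm unit_disk N)\<^sup>2 \<le> L2_norm unit_disk N * L2_norm unit_disk (\<lambda>x. (1 - x \<bullet> x) * q x)"
    unfolding L2_norm_power2_inner eq[symmetric]
    using L2_Cauchy_Schwarz[OF cL[OF Nc] cL[OF qc]] by linarith
  then have le: "L2_norm unit_disk N * L2_norm unit_disk N \<le>
      L2_norm unit_disk N * L2_norm unit_disk (\<lambda>x. (1 - x \<bullet> x) * q x)" by (simp add: power2_eq_square)
  show ?thesis
  proof (cases "L2_norm unit_disk N = 0")
    case False
    then have "L2_norm unit_disk N > 0" using L2_norm_nonneg[of unit_disk N] by linarith
    with le show ?thesis by (simp only: mult_le_cancel_left_pos)
  qed simp
qed

section \<open>The advection estimate\<close>

text \<open>
  With \<open>G = T slope\<close> and \<open>E\<close> its ray average, the gradient of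
  \<open>\<Psi> = cutoff T + 2 \<bar>x\<bar>\<^sup>2 E\<close> is \<open>cutoff \<nabla>T + 2 N perp x\<close>: the radial part of the second term cancels
  \<open>T \<nabla>cutoff = - 2 G x\<close>, and its azimuthal part is governed by the ray average \<open>N\<close> of the angular
  derivative \<open>R\<close> of \<open>G\<close>. As \<open>u\<close> is orthogonal to \<open>\<nabla>\<Psi>\<close>, the advection term equals \<open>- 2 \<integral> N (u \<bullet> perp x)\<close>. The slope
  is radial, so \<open>R\<close> is \<open>slope\<close> times the angular derivative of \<open>T\<close>, and the Hardy inequality bounds \<open>N\<close>.
\<close>

lemma advection_bound_test_functions:
  assumes \<epsilon>: "\<epsilon> > 0" and u: "u \<in> L2 unit_disk"
    and div: "\<And>\<phi>. \<phi> \<in> H1 unit_disk \<Longrightarrow> (LINT x|lebesgue_on unit_disk. u x \<bullet> grad unit_disk \<phi> x) = 0"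
    and T: "T \<in> test_functions unit_disk"
  shows "\<bar>LINT x|lebesgue_on unit_disk. cutoff \<epsilon> x * (u x \<bullet> classical_grad T x)\<bar> \<le>
    2 * L2_norm unit_disk u * L2_norm unit_disk (classical_grad T)"
proof -
  let ?S = unit_disk
  note dom = unit_disk_domain(1,2)
  note Tg = test_functions_GDERIV[OF T]
  define G where "G x = T x * slope \<epsilon> (x \<bullet> x)" for x
  have GC: "Ck k G" for k
    unfolding G_def[abs_def] by (rule Ck_mult[OF test_functionsD(1)[OF T] Ck_compose[OF Ck_slope[OF \<epsilon>] Ck_inner_self]])
  define d where "d = classical_grad G"
  have Gd: "GDERIV G x :> d x" for x unfolding d_def by (rule Ck_GDERIV[OF GC])
  have dc: "continuous_on UNIV d" unfolding d_def by (rule Ck_continuous_grad[OF GC])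
  define R where "R x = d x \<bullet> perp x" for x
  have R_eq: "R x = slope \<epsilon> (x \<bullet> x) * (classical_grad T x \<bullet> perp x)" for x
  proof -
    have "slope \<epsilon> differentiable (at (x \<bullet> x))" using Ck_slope[OF \<epsilon>, of "Suc 0"] by simp
    then obtain s' where "(slope \<epsilon> has_real_derivative s') (at (x \<bullet> x))" by (auto simp: real_differentiable_def)
    from GDERIV_mult[OF Tg(1) GDERIV_radial[OF this]]
    have "d x = T x *\<^sub>R (2 * s') *\<^sub>R x + slope \<epsilon> (x \<bullet> x) *\<^sub>R classical_grad T x"
      unfolding G_def[symmetric] by (rule GDERIV_unique[OF Gd])
    then show ?thesis by (simp add: R_def inner_add_left)
  qed
  have RC: "Ck (Suc 0) R"
  proof -
    have "Ck (Suc 0) (\<lambda>x. (x \<bullet> axis 1 1) * (d x \<bullet> axis 2 1) - (x \<bullet> axis 2 1) * (d x \<bullet> axis 1 1))"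
      unfolding d_def
      by (rule Ck_diff[OF Ck_mult[OF Ck_bounded_linear[OF bounded_linear_inner_left] Ck_classical_grad_inner[OF GC]]
            Ck_mult[OF Ck_bounded_linear[OF bounded_linear_inner_left] Ck_classical_grad_inner[OF GC]]])
    then show ?thesis unfolding R_def[abs_def] inner_perp_eq .
  qed
  define N where "N = ray_avg R"
  define n where "n x = integral {0..1} (\<lambda>s. s\<^sup>2 *\<^sub>R classical_grad R (s *\<^sub>R x))" for x
  note Rg = Ck_GDERIV[OF RC] Ck_continuous_grad[OF RC]
  have Nn: "GDERIV N x :> n x" for x unfolding N_def n_def by (rule GDERIV_ray_avg[OF Rg])
  have nc: "continuous_on UNIV n" unfolding n_def by (rule continuous_ray_avg_grad[OF Rg(2)])
  have NR: "R x = 2 * N x + x \<bullet> n x" for x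
    unfolding N_def n_def by (rule ray_avg_euler[OF Rg, symmetric])
  have Nc: "continuous_on UNIV N"
    by (rule GDERIV_imp_continuous_on[OF Nn])
  have slc: "continuous_on UNIV (\<lambda>x::real^2. slope \<epsilon> (x \<bullet> x))"
    by (rule Ck_imp_continuous[OF Ck_compose[OF Ck_slope[OF \<epsilon>] Ck_inner_self, of 0]])
  have Nle: "L2_norm ?S N \<le> L2_norm ?S (classical_grad T)"
  proof -
    have "L2_norm ?S N \<le> L2_norm ?S (\<lambda>x. (1 - x \<bullet> x) * R x)" by (rule hardy_unit_disk[OF Nn nc NR])
    also have "\<dots> \<le> L2_norm ?S (classical_grad T)"
    proof (rule L2_norm_mono[OF AE_I2])
      fix x assume "x \<in> space (lebesgue_on ?S)"
      then have x: "norm x \<le> 1" "x \<bullet> x \<le> 1" using unit_disk_inner_le[of x] by (auto simp: unit_disk_def)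
      have "norm ((1 - x \<bullet> x) * R x) = ((1 - x \<bullet> x) * slope \<epsilon> (x \<bullet> x)) * \<bar>classical_grad T x \<bullet> perp x\<bar>"
        using x(2) slope_nonneg[of \<epsilon> "x \<bullet> x"] by (simp add: R_eq abs_mult)
      also have "\<dots> \<le> 1 * \<bar>classical_grad T x \<bullet> perp x\<bar>"
        by (intro mult_right_mono slope_le[OF \<epsilon>]) simp
      also have "\<dots> \<le> norm (classical_grad T x) * norm (perp x)"
        unfolding mult_1 by (rule Cauchy_Schwarz_ineq2)
      also have "\<dots> \<le> norm (classical_grad T x)" using x(1) by (simp add: mult_left_le)
      finally show "norm ((1 - x \<bullet> x) * R x) \<le> norm (classical_grad T x)" .
    next
      show "(\<lambda>x. (1 - x \<bullet> x) * R x) \<in> L2 ?S"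
        by (rule continuous_imp_L2[OF dom]) (intro continuous_intros Ck_imp_continuous[OF RC])
      show "classical_grad T \<in> L2 ?S" by (rule test_functions_L2(2)[OF dom T])
    qed
    finally show ?thesis .
  qed
  define E where "E = ray_avg G"
  define e where "e x = integral {0..1} (\<lambda>s. s\<^sup>2 *\<^sub>R d (s *\<^sub>R x))" for x
  have Ee: "GDERIV E x :> e x" for x unfolding E_def e_def by (rule GDERIV_ray_avg[OF Gd dc])
  have EG: "2 * E x + x \<bullet> e x = G x" for x unfolding E_def e_def by (rule ray_avg_euler[OF Gd dc])
  have Ne: "N x = e x \<bullet> perp x" for x
    unfolding N_def e_def R_def[abs_def] by (rule ray_avg_rotation[OF dc])
  define \<Psi> where "\<Psi> x = cutoff \<epsilon> x * T x + (2 * (x \<bullet> x)) * E x" for x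
  define \<psi> where "\<psi> x = cutoff \<epsilon> x *\<^sub>R classical_grad T x + 2 *\<^sub>R (N x *\<^sub>R perp x)" for x
  have \<Psi>\<psi>: "GDERIV \<Psi> x :> \<psi> x" for x
  proof -
    have "GDERIV (\<lambda>x. 2 * (x \<bullet> x)) x :> 2 *\<^sub>R (2 *\<^sub>R x) + (x \<bullet> x) *\<^sub>R 0"
      by (rule GDERIV_mult[OF GDERIV_const GDERIV_inner_self])
    note g = GDERIV_add[OF GDERIV_mult[OF cutoff_GDERIV[OF \<epsilon>] Tg(1)] GDERIV_mult[OF this Ee]]
    have h1: "(2 * (x \<bullet> x)) *\<^sub>R e x = 2 *\<^sub>R ((x \<bullet> e x) *\<^sub>R x + N x *\<^sub>R perp x)"
      unfolding Ne perp_decomposition[symmetric] by simp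
    have h2: "T x *\<^sub>R ((- 2 * slope \<epsilon> (x \<bullet> x)) *\<^sub>R x) = - (2 * G x) *\<^sub>R x"
      by (simp add: G_def)
    have "(cutoff \<epsilon> x *\<^sub>R classical_grad T x + T x *\<^sub>R ((- 2 * slope \<epsilon> (x \<bullet> x)) *\<^sub>R x)) +
        ((2 * (x \<bullet> x)) *\<^sub>R e x + E x *\<^sub>R (2 *\<^sub>R (2 *\<^sub>R x) + (x \<bullet> x) *\<^sub>R 0)) =
        cutoff \<epsilon> x *\<^sub>R classical_grad T x + (2 * (2 * E x + x \<bullet> e x - G x)) *\<^sub>R x + 2 *\<^sub>R (N x *\<^sub>R perp x)"
      unfolding h1 h2 by (simp add: vec_eq_iff algebra_simps)
    also have "\<dots> = \<psi> x" using EG[of x] by (simp add: \<psi>_def)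
    finally show ?thesis using g unfolding \<Psi>_def[abs_def] by (rule GDERIV_subst[rotated])
  qed
  have cc: "continuous_on UNIV (cutoff \<epsilon>)" by (rule test_functions_GDERIV(2)[OF cutoff_test_function[OF \<epsilon>]])
  have \<psi>c: "continuous_on UNIV \<psi>" unfolding \<psi>_def by (intro continuous_intros cc Tg(3) Nc continuous_perp)
  note \<Psi>H = continuous_GDERIV_H1[OF dom \<Psi>\<psi> \<psi>c]
  note cL = continuous_imp_L2[OF dom]
  have L1: "(\<lambda>x. cutoff \<epsilon> x *\<^sub>R classical_grad T x) \<in> L2 ?S"
    by (rule cL) (intro continuous_intros cc Tg(3))
  have L2: "(\<lambda>x. N x *\<^sub>R perp x) \<in> L2 ?S"
    by (rule cL) (intro continuous_intros Nc continuous_perp)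
  have "0 = (LINT x|lebesgue_on ?S. u x \<bullet> \<psi> x)"
    unfolding div[OF \<Psi>H(1), symmetric]
  proof (rule integral_cong_AE)
    show "AE x in lebesgue_on ?S. u x \<bullet> grad ?S \<Psi> x = u x \<bullet> \<psi> x"
      using \<Psi>H(2) by eventually_elim simp
  qed (use L2_inner_integrable[OF u H1_grad(2)[OF \<Psi>H(1)]] L2_inner_integrable[OF u cL[OF \<psi>c]] in auto)
  also have "\<dots> = (LINT x|lebesgue_on ?S. u x \<bullet> (cutoff \<epsilon> x *\<^sub>R classical_grad T x) + 2 * (u x \<bullet> (N x *\<^sub>R perp x)))"
    by (simp add: \<psi>_def inner_add_right mult.assoc)
  also have "\<dots> = (LINT x|lebesgue_on ?S. u x \<bullet> (cutoff \<epsilon> x *\<^sub>R classical_grad T x)) +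
      2 * (LINT x|lebesgue_on ?S. u x \<bullet> (N x *\<^sub>R perp x))"
    using L2_inner_integrable[OF u L1] L2_inner_integrable[OF u L2]
    by (subst Bochner_Integration.integral_add) auto
  finally have "\<bar>LINT x|lebesgue_on ?S. cutoff \<epsilon> x * (u x \<bullet> classical_grad T x)\<bar> =
      2 * \<bar>LINT x|lebesgue_on ?S. u x \<bullet> (N x *\<^sub>R perp x)\<bar>" by simp
  also have "\<dots> \<le> 2 * (L2_norm ?S u * L2_norm ?S (\<lambda>x. N x *\<^sub>R perp x))"
    using L2_Cauchy_Schwarz[OF u L2] by simp
  also have "\<dots> \<le> 2 * (L2_norm ?S u * L2_norm ?S (classical_grad T))"
  proof -
    have "L2_norm ?S (\<lambda>x. N x *\<^sub>R perp x) \<le> L2_norm ?S N"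
    proof (rule L2_norm_mono[OF AE_I2 L2 cL[OF Nc]])
      fix x assume "x \<in> space (lebesgue_on ?S)"
      then have "norm x \<le> 1" by (auto simp: unit_disk_def)
      then show "norm (N x *\<^sub>R perp x) \<le> norm (N x)" by (simp add: mult_left_le)
    qed
    also note Nle
    finally show ?thesis by (intro mult_left_mono) auto
  qed
  finally show ?thesis by (simp add: mult.assoc)
qed

lemma advection_bound:
  assumes \<epsilon>: "\<epsilon> > 0" and u: "u \<in> L2 unit_disk"
    and div: "\<And>\<phi>. \<phi> \<in> H1 unit_disk \<Longrightarrow> (LINT x|lebesgue_on unit_disk. u x \<bullet> grad unit_disk \<phi> x) = 0"
    and T: "T \<in> H10 unit_disk"
  shows "\<bar>LINT x|lebesgue_on unit_disk. cutoff \<epsilon> x * (u x \<bullet> grad unit_disk T x)\<bar> \<le>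
    2 * L2_norm unit_disk u * L2_norm unit_disk (grad unit_disk T)"
proof -
  let ?S = unit_disk
  note dom = unit_disk_domain(1,2)
  obtain \<phi> where \<phi>: "\<And>n. \<phi> n \<in> test_functions ?S"
    "(\<lambda>n. L2_norm ?S (\<lambda>x. classical_grad (\<phi> n) x - grad ?S T x)) \<longlonglongrightarrow> 0"
    by (rule H10E[OF dom T]) blast
  note \<phi>L = test_functions_L2(2)[OF dom \<phi>(1)] and TL = H10_grad(2)[OF T]
  have cc: "continuous_on UNIV (cutoff \<epsilon>)" by (rule test_functions_GDERIV(2)[OF cutoff_test_function[OF \<epsilon>]])
  obtain B where "\<And>x. x \<in> ?S \<Longrightarrow> norm (cutoff \<epsilon> x) \<le> B"
    using continuous_bounded_on_bounded[OF dom(2) cc] by blast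
  then have B: "AE x in lebesgue_on ?S. \<bar>cutoff \<epsilon> x\<bar> \<le> B" by (intro AE_I2) simp
  have cu: "(\<lambda>x. cutoff \<epsilon> x *\<^sub>R u x) \<in> L2 ?S"
    by (rule L2_mult_bounded[OF continuous_measurable_lebesgue_on[OF dom(1) cc] B u])
  have comm: "cutoff \<epsilon> x * (u x \<bullet> v) = v \<bullet> (cutoff \<epsilon> x *\<^sub>R u x)" for x v by (simp add: inner_commute)
  have "(\<lambda>n. LINT x|lebesgue_on ?S. cutoff \<epsilon> x * (u x \<bullet> classical_grad (\<phi> n) x)) \<longlonglongrightarrow>
      (LINT x|lebesgue_on ?S. cutoff \<epsilon> x * (u x \<bullet> grad ?S T x))"
    unfolding comm by (rule L2_tendsto_inner[OF \<phi>L TL \<phi>(2) cu])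
  then have "(\<lambda>n. \<bar>LINT x|lebesgue_on ?S. cutoff \<epsilon> x * (u x \<bullet> classical_grad (\<phi> n) x)\<bar>) \<longlonglongrightarrow>
      \<bar>LINT x|lebesgue_on ?S. cutoff \<epsilon> x * (u x \<bullet> grad ?S T x)\<bar>" by (rule tendsto_rabs)
  moreover have "(\<lambda>n. 2 * L2_norm ?S u * L2_norm ?S (classical_grad (\<phi> n))) \<longlonglongrightarrow>
      2 * L2_norm ?S u * L2_norm ?S (grad ?S T)"
    by (intro tendsto_mult_left L2_tendsto_norm[OF \<phi>L TL \<phi>(2)])
  ultimately show ?thesis
    by (rule LIMSEQ_le) (use advection_bound_test_functions[OF \<epsilon> u div \<phi>(1)] in blast)
qed

section \<open>Lower bound for the dissipation\<close>

text \<open>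
  With \<open>\<epsilon> = 1 / (8 Pe\<^sup>2)\<close> the test function satisfies \<open>\<integral> \<xi> \<ge> pi ln Pe\<close> and \<open>\<parallel>\<nabla>\<xi>\<parallel> \<le> 4 sqrt pi Pe\<close>, so
  \<open>f_min pi ln Pe \<le> (4 sqrt pi + 2) Pe \<parallel>\<nabla>T\<parallel>\<close>. Finally \<open>(4 sqrt pi + 2)\<^sup>2 \<le> 64 + 32 pi e\<close>.
\<close>

lemma dissipation_lower_bound:
  assumes fmin: "f_min > 0" and f: "azimuthal_average_ge f f_min" and Pe: "Pe \<ge> 1"
    and u: "admissible_velocity unit_disk Pe u" and T: "weak_temperature unit_disk f u T"
  shows "pi\<^sup>2 * f_min\<^sup>2 / (64 + 32 * pi * exp 1) * ((ln Pe)\<^sup>2 / Pe\<^sup>2) \<le>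
    (LINT x|lebesgue_on unit_disk. (norm (grad unit_disk T x))\<^sup>2)"
proof -
  let ?S = unit_disk
  note dom = unit_disk_domain(1,2)
  define \<epsilon> where "\<epsilon> = 1 / (8 * Pe\<^sup>2)"
  have Pe2: "Pe\<^sup>2 \<ge> 1" using Pe by (simp add: one_le_power)
  have \<epsilon>: "\<epsilon> > 0" "\<epsilon> \<le> 1/8" using Pe2 by (auto simp: \<epsilon>_def divide_simps)
  define \<xi> where "\<xi> = cutoff \<epsilon>"
  define A where "A = L2_norm ?S (grad ?S T)"
  have A0: "A \<ge> 0" by (simp add: A_def)
  have \<xi>t: "\<xi> \<in> test_functions ?S" unfolding \<xi>_def by (rule cutoff_test_function[OF \<epsilon>(1)])
  note \<xi>H = test_functions_H10[OF dom \<xi>t]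
  have uL: "u \<in> L2 ?S" and div: "\<And>\<phi>. \<phi> \<in> H1 ?S \<Longrightarrow> (LINT x|lebesgue_on ?S. u x \<bullet> grad ?S \<phi> x) = 0"
    and uPe: "L2_norm ?S u \<le> Pe"
    using u by (auto simp: admissible_velocity_def)
  have TH: "T \<in> H10 ?S" using T by (simp add: weak_temperature_def)
  obtain B where B: "advection_extension ?S u T B"
    and eq: "\<And>\<xi>. \<xi> \<in> H10 ?S \<Longrightarrow> (LINT x|lebesgue_on ?S. grad ?S \<xi> x \<bullet> grad ?S T x) + B \<xi> - f \<xi> = 0"
    using T by (auto simp: weak_temperature_def)
  have cc: "continuous_on UNIV \<xi>" by (rule test_functions_GDERIV(2)[OF \<xi>t])
  have "\<xi> \<in> Linf ?S"
  proof -
    obtain b where "\<And>x. x \<in> ?S \<Longrightarrow> norm (\<xi> x) \<le> b"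
      using continuous_bounded_on_bounded[OF dom(2) cc] by blast
    then have "AE x in lebesgue_on ?S. \<bar>\<xi> x\<bar> \<le> b" by (intro AE_I2) simp
    then show ?thesis unfolding Linf_def using continuous_measurable_lebesgue_on[OF dom(1) cc] by blast
  qed
  then have "B \<xi> = (LINT x|lebesgue_on ?S. \<xi> x * (u x \<bullet> grad ?S T x))"
    using B \<xi>H(1) by (simp add: advection_extension_def)
  then have "\<bar>B \<xi>\<bar> \<le> 2 * L2_norm ?S u * A"
    using advection_bound[OF \<epsilon>(1) uL div TH] by (simp add: \<xi>_def A_def)
  also have "\<dots> \<le> 2 * Pe * A" using uPe A0 by (simp add: mult_right_mono)
  finally have Bb: "\<bar>B \<xi>\<bar> \<le> 2 * Pe * A" .
  have "L2_norm ?S (grad ?S \<xi>) \<le> 4 * sqrt pi * Pe"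
  proof (rule power2_le_imp_le)
    have "(L2_norm ?S (grad ?S \<xi>))\<^sup>2 \<le> 2 * pi / \<epsilon>"
      unfolding \<xi>H(3) unfolding \<xi>_def by (rule cutoff_grad_norm[OF \<epsilon>(1)])
    also have "\<dots> = (4 * sqrt pi * Pe)\<^sup>2" by (simp add: \<epsilon>_def power_mult_distrib)
    finally show "(L2_norm ?S (grad ?S \<xi>))\<^sup>2 \<le> (4 * sqrt pi * Pe)\<^sup>2" .
  qed (use Pe in simp)
  then have "L2_norm ?S (grad ?S \<xi>) * A \<le> 4 * sqrt pi * Pe * A" using A0 by (rule mult_right_mono)
  then have Db: "\<bar>LINT x|lebesgue_on ?S. grad ?S \<xi> x \<bullet> grad ?S T x\<bar> \<le> 4 * sqrt pi * Pe * A"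
    using L2_Cauchy_Schwarz[OF H10_grad(2)[OF \<xi>H(1)] H10_grad(2)[OF TH]] unfolding A_def by linarith
  have upper: "f \<xi> \<le> (4 * sqrt pi + 2) * Pe * A"
    using eq[OF \<xi>H(1)] Bb Db by (simp add: algebra_simps)
  have lower: "f_min * (pi * ln Pe) \<le> f \<xi>"
  proof -
    have "2 * ln Pe \<le> ln (3 / (8 * \<epsilon>)) - 1"
    proof -
      have "1 \<le> ln (3::real)" using exp_le by (subst ln_ge_iff) auto
      \<comment> \<open>the choice of \<open>\<epsilon>\<close> leaves the factor \<open>3 \<ge> e\<close>, which cancels the \<open>- 1\<close>\<close>
      moreover have "ln (3 / (8 * \<epsilon>)) = ln 3 + 2 * ln Pe"
        using Pe by (simp add: \<epsilon>_def ln_mult ln_realpow)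
      ultimately show ?thesis by simp
    qed
    then have "2 * ln Pe \<le> profile \<epsilon> (1/2)" using profile_half_ge[OF \<epsilon>] by linarith
    then have "pi * ln Pe \<le> pi / 2 * profile \<epsilon> (1/2)" using mult_left_mono[of "2 * ln Pe" _ "pi / 2"] by simp
    also have "\<dots> \<le> (LINT x|lebesgue_on ?S. \<xi> x)" unfolding \<xi>_def by (rule cutoff_integral_ge[OF \<epsilon>(1)])
    finally have "f_min * (pi * ln Pe) \<le> f_min * (LINT x|lebesgue_on ?S. \<xi> x)" using fmin by simp
    also have "\<dots> \<le> f \<xi>"
    proof -
      have "AE x in lebesgue_on ?S. 0 \<le> \<xi> x" by (simp add: \<xi>_def cutoff_def profile_nonneg \<epsilon>)
      moreover have "\<exists>g. AE x in lebesgue_on ?S. \<xi> x = g (norm x)"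
        by (rule exI[of _ "\<lambda>r. profile \<epsilon> (r\<^sup>2)"]) (simp add: \<xi>_def cutoff_def dot_square_norm)
      ultimately show ?thesis
        by (rule f[unfolded azimuthal_average_ge_def, THEN bspec, OF \<xi>H(1), THEN mp, THEN mp])
    qed
    finally show ?thesis .
  qed
  define K where "K = 64 + 32 * pi * exp 1"
  have K: "(4 * sqrt pi + 2)\<^sup>2 \<le> K"
  proof -
    have "sqrt pi \<le> pi" using pi_gt3 by (intro real_le_lsqrt) (auto simp: power2_eq_square)
    moreover have "pi * 1 \<le> pi * exp 1" by (intro mult_left_mono) auto
    moreover have "(4 * sqrt pi + 2)\<^sup>2 = 16 * pi + 16 * sqrt pi + 4" by (simp add: power2_sum power_mult_distrib)
    ultimately show ?thesis unfolding K_def using pi_gt_zero by linarith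
  qed
  have K0: "K > 0" unfolding K_def by (simp add: add_pos_pos)
  have "(f_min * (pi * ln Pe))\<^sup>2 \<le> ((4 * sqrt pi + 2) * Pe * A)\<^sup>2"
    using upper lower fmin Pe by (intro power_mono) auto
  also have "\<dots> = (4 * sqrt pi + 2)\<^sup>2 * (Pe\<^sup>2 * A\<^sup>2)" by (simp add: power_mult_distrib)
  also have "\<dots> \<le> K * (Pe\<^sup>2 * A\<^sup>2)" by (intro mult_right_mono K) simp
  finally have "pi\<^sup>2 * f_min\<^sup>2 * (ln Pe)\<^sup>2 \<le> A\<^sup>2 * (K * Pe\<^sup>2)"
    by (simp only: power_mult_distrib mult.assoc mult.commute mult.left_commute)
  then have "pi\<^sup>2 * f_min\<^sup>2 * (ln Pe)\<^sup>2 / (K * Pe\<^sup>2) \<le> A\<^sup>2"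
    using K0 Pe by (subst pos_divide_le_eq) auto
  then have "pi\<^sup>2 * f_min\<^sup>2 / K * ((ln Pe)\<^sup>2 / Pe\<^sup>2) \<le> A\<^sup>2" by simp
  then show ?thesis by (simp add: A_def L2_norm_power2 K_def)
qed

lemma conductive_temperature_exists:
  assumes f: "f \<in> Hneg1 unit_disk" and Pe: "Pe \<ge> 0"
  shows "\<exists>T. admissible_velocity unit_disk Pe (\<lambda>x. 0) \<and> weak_temperature unit_disk f (\<lambda>x. 0) T"
proof -
  obtain T where T: "T \<in> H10 unit_disk"
    "\<And>\<xi>. \<xi> \<in> H10 unit_disk \<Longrightarrow> (LINT x|lebesgue_on unit_disk. grad unit_disk \<xi> x \<bullet> grad unit_disk T x) = f \<xi>"
    by (rule riesz_H10[OF unit_disk_domain(1,2) f]) blast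
  have "(\<lambda>\<xi>. 0) \<in> Hneg1 unit_disk" unfolding Hneg1_def by (auto intro: exI[of _ 0])
  then have "advection_extension unit_disk (\<lambda>x. 0) T (\<lambda>\<xi>. 0)" by (simp add: advection_extension_def)
  then have "weak_temperature unit_disk f (\<lambda>x. 0) T"
    unfolding weak_temperature_def using T by auto
  moreover have "admissible_velocity unit_disk Pe (\<lambda>x. 0)"
    using Pe by (simp add: admissible_velocity_def L2_zero)
  ultimately show ?thesis by blast
qed

lemma cooling_min_ge:
  assumes "f_min > 0" "f \<in> Hneg1 unit_disk" "azimuthal_average_ge f f_min" "Pe \<ge> 1"
  shows "pi\<^sup>2 * f_min\<^sup>2 / (64 + 32 * pi * exp 1) * ((ln Pe)\<^sup>2 / Pe\<^sup>2) \<le> cooling_min unit_disk f Pe"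
  unfolding cooling_min_def
proof (rule cInf_greatest)
  show "{LINT x|lebesgue_on unit_disk. (norm (grad unit_disk T x))\<^sup>2 | u T.
      admissible_velocity unit_disk Pe u \<and> weak_temperature unit_disk f u T} \<noteq> {}"
    using conductive_temperature_exists[OF assms(2), of Pe] assms(4) by auto
qed (use dissipation_lower_bound[OF assms(1,3,4)] in auto)

text \<open>
  The summand \<open>1\<close> keeps the constant positive, so that at \<open>Pe = 1\<close> the right-hand side is infinite.
\<close>

lemma efficiency_le:
  assumes c: "c > 0" and J: "c * ((ln Pe)\<^sup>2 / Pe\<^sup>2) \<le> cooling_min S f Pe" and Pe: "Pe \<ge> 1"
  shows "efficiency S f Pe \<le> ereal ((Hneg1_norm S f)\<^sup>2 / c + 1) * (ereal (Pe\<^sup>2) / ereal ((ln Pe)\<^sup>2))"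
proof (cases "Pe = 1")
  case True
  have "(Hneg1_norm S f)\<^sup>2 / c + 1 > 0" using c by (simp add: add_nonneg_pos)
  then show ?thesis using True by (simp add: divide_ereal_def)
next
  case False
  then have l: "ln Pe > 0" using Pe by simp
  define h where "h = (Hneg1_norm S f)\<^sup>2"
  have h: "h \<ge> 0" by (simp add: h_def)
  have pos: "0 < c * ((ln Pe)\<^sup>2 / Pe\<^sup>2)" using c l Pe by simp
  have "h / cooling_min S f Pe \<le> h / (c * ((ln Pe)\<^sup>2 / Pe\<^sup>2))"
    by (rule divide_left_mono[OF J h mult_pos_pos[OF less_le_trans[OF pos J] pos]])
  also have "\<dots> = (h / c) * (Pe\<^sup>2 / (ln Pe)\<^sup>2)" by simp
  also have "\<dots> \<le> (h / c + 1) * (Pe\<^sup>2 / (ln Pe)\<^sup>2)" by (intro mult_right_mono) auto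
  finally show ?thesis using pos J l unfolding efficiency_def h_def by simp
qed

theorem theorem5p2:
  fixes f_min :: real
  assumes "f_min > 0"
  shows "(\<exists>C::real. C \<ge> pi\<^sup>2 * f_min\<^sup>2 / (64 + 32 * pi * exp 1) \<and>
            (\<forall>f\<in>Hneg1 unit_disk. azimuthal_average_ge f f_min \<longrightarrow>
               (\<forall>Pe\<ge>1. cooling_min unit_disk f Pe \<ge> C * ((ln Pe)\<^sup>2 / Pe\<^sup>2)))) \<and>
         (\<forall>f\<in>Hneg1 unit_disk. azimuthal_average_ge f f_min \<longrightarrow>
            (\<exists>C'::real. \<forall>Pe\<ge>1.
               efficiency unit_disk f Pe \<le> ereal C' * (ereal (Pe\<^sup>2) / ereal ((ln Pe)\<^sup>2))))"
proof -
  define c where "c = pi\<^sup>2 * f_min\<^sup>2 / (64 + 32 * pi * exp 1)"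
  have c: "c > 0" unfolding c_def using assms by (simp add: add_pos_pos)
  note J = cooling_min_ge[OF assms, folded c_def]
  show ?thesis unfolding c_def[symmetric]
  proof (intro conjI ballI impI)
    show "\<exists>C\<ge>c. \<forall>f\<in>Hneg1 unit_disk. azimuthal_average_ge f f_min \<longrightarrow>
        (\<forall>Pe\<ge>1. cooling_min unit_disk f Pe \<ge> C * ((ln Pe)\<^sup>2 / Pe\<^sup>2))"
      using J by (intro exI[of _ c]) simp
    fix f assume "f \<in> Hneg1 unit_disk" "azimuthal_average_ge f f_min"
    then have "efficiency unit_disk f Pe \<le>
        ereal ((Hneg1_norm unit_disk f)\<^sup>2 / c + 1) * (ereal (Pe\<^sup>2) / ereal ((ln Pe)\<^sup>2))" if "Pe \<ge> 1" for Pe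
      by (intro efficiency_le c J that)
    then show "\<exists>C'. \<forall>Pe\<ge>1. efficiency unit_disk f Pe \<le> ereal C' * (ereal (Pe\<^sup>2) / ereal ((ln Pe)\<^sup>2))"
      by blast
  qed
qed

end
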